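(* Fix a set $S$ of primes. For every $n\ge 1$ the following sums of power sums are Schur-positive: (1) $\displaystyle\sum_{\lambda\vdash n:\ \lambda_i\in P(S)\,\forall i} p_\lambda$; (2) $\displaystyle\sum_{\lambda\vdash n:\ \lambda_i\in P(\bar{S})\,\forall i} p_\lambda$; (3) $\displaystyle\sum_{\substack{\lambda\vdash n:\ \lambda_i\in P(S)\,\forall i\\ n-\ell(\lambda)\text{ even}}} p_\lambda=\sum_{\substack{\lambda\vdash n:\ \lambda_i\in P(S)\,\forall i\\ \lambda\text{ has an even number of even parts}}} p_\lambda$.
   Context: $p_\lambda=\prod_i p_{\lambda_i}$ is the power-sum symmetric function and $\ell(\lambda)$ the number of parts of $\lambda$. A symmetric function is Schur-positive if it is a linear combination of Schur functions with nonnegative integer coefficients (i.e. the Frobenius characteristic of a true representation). For a set $S$ of primes, $P(S)$ is the set of positive integers all of whose prime factors lie in $S$, and $P(\bar S)$ is the set of positive integers none of whose prime factors lies in $S$; both contain $1$. *)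

theory Defs
  imports "HOL-Library.Poly_Mapping" "HOL-Library.FuncSet" "HOL-Computational_Algebra.Primes"
begin

section \<open>Formal power series in the variables $x_0, x_1, x_2, \ldots$\<close>

text \<open>
  Symmetric functions are formal power series in countably many variables. A monomial is its
  exponent vector, of type \<^typ>\<open>nat \<Rightarrow>\<^sub>0 nat\<close> (finite support), and a series is its family of
  coefficients.
\<close>

typedef (overloaded) 'a mseries = "UNIV :: ((nat \<Rightarrow>\<^sub>0 nat) \<Rightarrow> 'a) set"
  morphisms mcoeff Abs_mseries by simp

setup_lifting type_definition_mseries

lemma mseries_eqI: "(\<And>m. mcoeff f m = mcoeff g m) \<Longrightarrow> f = g"
  by (metis mcoeff_inject ext)

definition splits :: "(nat \<Rightarrow>\<^sub>0 nat) \<Rightarrow> ((nat \<Rightarrow>\<^sub>0 nat) \<times> (nat \<Rightarrow>\<^sub>0 nat)) set" where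
  "splits m = {(a, b). a + b = m}"

lemma finite_splits [simp]: "finite (splits m)"
proof -
  have "inj_on (\<lambda>p. restrict (Poly_Mapping.lookup (fst p)) (Poly_Mapping.keys m)) (splits m)"
  proof (rule inj_onI)
    fix p q
    assume p: "p \<in> splits m" and q: "q \<in> splits m"
      and eq: "restrict (Poly_Mapping.lookup (fst p)) (Poly_Mapping.keys m) = restrict (Poly_Mapping.lookup (fst q)) (Poly_Mapping.keys m)"
    have sp: "fst p + snd p = m" and sq: "fst q + snd q = m"
      using p q by (auto simp: splits_def)
    have "Poly_Mapping.lookup (fst p) i = Poly_Mapping.lookup (fst q) i" for i
    proof (cases "i \<in> Poly_Mapping.keys m")
      case True
      then show ?thesis using fun_cong[OF eq, of i] by simp
    next
      case False
      then have "Poly_Mapping.lookup m i = 0" by (simp add: in_keys_iff)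
      then show ?thesis using sp sq by (metis add_is_0 lookup_add)
    qed
    then have "fst p = fst q" by (intro poly_mapping_eqI)
    moreover from this sp sq have "snd p = snd q" by (metis add_left_cancel)
    ultimately show "p = q" by (simp add: prod_eq_iff)
  qed
  moreover have "(\<lambda>p. restrict (Poly_Mapping.lookup (fst p)) (Poly_Mapping.keys m)) ` splits m
      \<subseteq> (\<Pi>\<^sub>E i\<in>Poly_Mapping.keys m. {..Poly_Mapping.lookup m i})"
    by (auto simp: splits_def lookup_add)
  moreover have "finite (\<Pi>\<^sub>E i\<in>Poly_Mapping.keys m. {..Poly_Mapping.lookup m i})"
    by (intro finite_PiE) auto
  ultimately show ?thesis
    by (meson finite_imageD finite_subset)
qed

instantiation mseries :: (comm_ring_1) comm_ring_1
begin

lift_definition zero_mseries :: "'a mseries" is "\<lambda>_. 0" .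
lift_definition one_mseries :: "'a mseries" is "\<lambda>m. if m = 0 then 1 else 0" .
lift_definition plus_mseries :: "'a mseries \<Rightarrow> 'a mseries \<Rightarrow> 'a mseries"
  is "\<lambda>f g m. f m + g m" .
lift_definition minus_mseries :: "'a mseries \<Rightarrow> 'a mseries \<Rightarrow> 'a mseries"
  is "\<lambda>f g m. f m - g m" .
lift_definition uminus_mseries :: "'a mseries \<Rightarrow> 'a mseries" is "\<lambda>f m. - f m" .
lift_definition times_mseries :: "'a mseries \<Rightarrow> 'a mseries \<Rightarrow> 'a mseries"
  is "\<lambda>f g m. \<Sum>(a, b)\<in>splits m. f a * g b" .

instance
proof
  fix f g h :: "'a mseries"
  show "f * g * h = f * (g * h)"
  proof (rule mseries_eqI)
    fix m
    have "mcoeff (f * g * h) m =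
        (\<Sum>(u, c)\<in>splits m. \<Sum>(a, b)\<in>splits u. mcoeff f a * mcoeff g b * mcoeff h c)"
      by (simp add: times_mseries.rep_eq sum_distrib_right split_def)
    also have "\<dots> = (\<Sum>(p, q)\<in>(SIGMA p:splits m. splits (fst p)).
        mcoeff f (fst q) * mcoeff g (snd q) * mcoeff h (snd p))"
      by (simp add: sum.Sigma split_def)
    also have "\<dots> = (\<Sum>(p, q)\<in>(SIGMA p:splits m. splits (snd p)).
        mcoeff f (fst p) * (mcoeff g (fst q) * mcoeff h (snd q)))"
      by (rule sum.reindex_bij_witness[
            where i = "\<lambda>(p, q). ((fst p + fst q, snd q), (fst p, fst q))"
              and j = "\<lambda>(p, q). ((fst q, snd q + snd p), (snd q, snd p))"])
        (auto simp: splits_def mult.assoc add.assoc)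
    also have "\<dots> = (\<Sum>(a, v)\<in>splits m. \<Sum>(b, c)\<in>splits v.
        mcoeff f a * (mcoeff g b * mcoeff h c))"
      by (simp add: sum.Sigma split_def)
    also have "\<dots> = mcoeff (f * (g * h)) m"
      by (simp add: times_mseries.rep_eq sum_distrib_left split_def)
    finally show "mcoeff (f * g * h) m = mcoeff (f * (g * h)) m" .
  qed
  show "f * g = g * f"
  proof (rule mseries_eqI)
    fix m
    show "mcoeff (f * g) m = mcoeff (g * f) m"
      unfolding times_mseries.rep_eq
      by (rule sum.reindex_bij_witness[where i = prod.swap and j = prod.swap])
        (auto simp: splits_def add.commute mult.commute)
  qed
  show "1 * f = f"
  proof (rule mseries_eqI)
    fix m
    have "mcoeff (1 * f) m
        = (\<Sum>p\<in>splits m. if p = (0, m) then mcoeff f m else 0)"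
      unfolding times_mseries.rep_eq one_mseries.rep_eq
      by (intro sum.cong refl) (auto simp: splits_def split: if_splits)
    also have "\<dots> = mcoeff f m"
      by (simp add: splits_def[of m, symmetric]) (simp add: splits_def)
    finally show "mcoeff (1 * f) m = mcoeff f m" .
  qed
  show "(f + g) * h = f * h + g * h"
    by (rule mseries_eqI)
      (simp add: times_mseries.rep_eq plus_mseries.rep_eq split_def distrib_right sum.distrib)
  show "(0 :: 'a mseries) \<noteq> 1"
    by (metis one_mseries.rep_eq zero_mseries.rep_eq zero_neq_one)
qed (rule mseries_eqI; simp add: plus_mseries.rep_eq zero_mseries.rep_eq minus_mseries.rep_eq
      uminus_mseries.rep_eq algebra_simps)+

end

section \<open>Partitions, power sums, Schur functions\<close>

definition partitions_of :: "nat \<Rightarrow> nat list set" where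
  "partitions_of n = {\<mu>. sorted_wrt (\<ge>) \<mu> \<and> (\<forall>k\<in>set \<mu>. k > 0) \<and> sum_list \<mu> = n}"

lemma finite_partitions_of [simp]: "finite (partitions_of n)"
proof (rule finite_subset)
  have len: "length xs \<le> sum_list xs" if "\<forall>k\<in>set xs. k > 0" for xs :: "nat list"
    using that by (induction xs) auto
  show "partitions_of n \<subseteq> {xs. set xs \<subseteq> {..n} \<and> length xs \<le> n}"
    using len by (auto simp: partitions_of_def dest: member_le_sum_list)
  show "finite {xs. set xs \<subseteq> {..n} \<and> length xs \<le> n}"
    by (rule finite_lists_length_le) simp
qed

text \<open>$p_k = \sum_i x_i^k$, meaningful for $k \ge 1$ (only then are the $x_i^k$ distinct monomials).\<close>

lift_definition power_sum :: "nat \<Rightarrow> 'a :: comm_ring_1 mseries"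
  is "\<lambda>k m. if \<exists>i. m = Poly_Mapping.single i k then 1 else 0" .

definition power_sum_part :: "nat list \<Rightarrow> 'a :: comm_ring_1 mseries" where
  "power_sum_part \<mu> = (\<Prod>k\<leftarrow>\<mu>. power_sum k)"

text \<open>Cells (row, column), both counted from 0, in English notation.\<close>

definition cells :: "nat list \<Rightarrow> (nat \<times> nat) set" where
  "cells \<mu> = {(i, j). i < length \<mu> \<and> j < \<mu> ! i}"

text \<open>
  Semistandard Young tableaux of shape \<open>\<mu>\<close>, as functions that are \<^term>\<open>undefined\<close> off the
  diagram. An entry \<open>k\<close> stands for the variable $x_k$, so entries start at 0.
\<close>

definition ssyt :: "nat list \<Rightarrow> (nat \<times> nat \<Rightarrow> nat) set" where
  "ssyt \<mu> = {T \<in> cells \<mu> \<rightarrow>\<^sub>E UNIV.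
     (\<forall>i j j'. j < j' \<longrightarrow> (i, j) \<in> cells \<mu> \<longrightarrow> (i, j') \<in> cells \<mu> \<longrightarrow> T (i, j) \<le> T (i, j')) \<and>
     (\<forall>i i' j. i < i' \<longrightarrow> (i, j) \<in> cells \<mu> \<longrightarrow> (i', j) \<in> cells \<mu> \<longrightarrow> T (i, j) < T (i', j))}"

definition content :: "nat list \<Rightarrow> (nat \<times> nat \<Rightarrow> nat) \<Rightarrow> (nat \<Rightarrow>\<^sub>0 nat)" where
  "content \<mu> T = (\<Sum>c\<in>cells \<mu>. Poly_Mapping.single (T c) 1)"

lemma finite_cells [simp]: "finite (cells \<mu>)"
proof -
  have "cells \<mu> = (SIGMA i:{..<length \<mu>}. {..<\<mu> ! i})"
    by (auto simp: cells_def)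
  then show ?thesis by simp
qed

text \<open>The cardinality in the definition of the Schur function below is that of a finite set.\<close>

lemma finite_ssyt_content [simp]: "finite {T \<in> ssyt \<mu>. content \<mu> T = m}"
proof (rule finite_subset)
  have "T c \<in> Poly_Mapping.keys m" if "c \<in> cells \<mu>" "content \<mu> T = m" for T c
  proof -
    have "Poly_Mapping.lookup m (T c) = (\<Sum>d\<in>cells \<mu>. Poly_Mapping.lookup (Poly_Mapping.single (T d) 1) (T c))"
      using that(2) by (auto simp: content_def lookup_sum)
    also have "\<dots> \<ge> Poly_Mapping.lookup (Poly_Mapping.single (T c) (1 :: nat)) (T c)"
      using that(1) by (intro member_le_sum) auto
    finally show ?thesis by (simp add: in_keys_iff)
  qed
  then show "{T \<in> ssyt \<mu>. content \<mu> T = m} \<subseteq> cells \<mu> \<rightarrow>\<^sub>E Poly_Mapping.keys m"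
    by (auto simp: ssyt_def PiE_iff extensional_def)
  show "finite (cells \<mu> \<rightarrow>\<^sub>E Poly_Mapping.keys m)"
    by (intro finite_PiE) auto
qed

text \<open>$s_\mu = \sum_T x^T$ over the semistandard tableaux $T$ of shape $\mu$.\<close>

lift_definition schur :: "nat list \<Rightarrow> 'a :: comm_ring_1 mseries"
  is "\<lambda>\<mu> m. of_nat (card {T \<in> ssyt \<mu>. content \<mu> T = m})" .

definition schur_positive :: "'a :: comm_ring_1 mseries \<Rightarrow> bool" where
  "schur_positive f \<longleftrightarrow>
     (\<exists>A (c :: nat list \<Rightarrow> nat). finite A \<and> A \<subseteq> (\<Union>n. partitions_of n) \<and>
        f = (\<Sum>\<mu>\<in>A. of_nat (c \<mu>) * schur \<mu>))"

section \<open>The sets $P(S)$ and $P(\bar S)$\<close>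

definition P_in :: "nat set \<Rightarrow> nat set" where
  "P_in S = {k. k > 0 \<and> (\<forall>p. prime p \<longrightarrow> p dvd k \<longrightarrow> p \<in> S)}"

definition P_avoid :: "nat set \<Rightarrow> nat set" where
  "P_avoid S = {k. k > 0 \<and> (\<forall>p. prime p \<longrightarrow> p dvd k \<longrightarrow> p \<notin> S)}"

end

theory Submission
  imports Defs "HOL-Combinatorics.Cycles" "HOL-Number_Theory.Cong" "Jordan_Normal_Form.Determinant"
begin

text \<open>
  If \<open>w\<close> has cycle type \<open>\<mu>\<close>, then the coefficients of \<open>p\<^sub>\<mu>\<close> count the words fixed by \<open>w\<close>. Hence a
  sum of \<open>p\<^sub>\<mu>\<close> over a set \<open>Q\<close> of partitions corresponds to the class function \<open>X w = |C(w)|\<close> if the type of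
  \<open>w\<close> lies in \<open>Q\<close>, and \<open>0\<close> otherwise, and its Schur coefficients are the inner products of \<open>X\<close> with
  the class functions \<open>J\<^sub>\<mu>\<close> given by the Jacobi-Trudi determinants of permutation characters. These are
  integers.

  For nonnegativity, the \<open>J\<^sub>\<mu>\<close> are orthonormal (triangularity of the Kostka numbers, used on both
  sides) and therefore a basis, and they are positive multiples of the characters of the
  Young symmetrizers, since both families are orthogonal and triangular for dominance. The inner product of
  the latter with \<open>X\<close> is nonnegative as soon as \<open>X\<close> is positive definite. This is shown by writing
  \<open>X = \<Sum>\<^sub>u \<chi>\<^sub>u\<close> with \<open>\<chi>\<^sub>u\<close> a linear character of the centralizer of \<open>u\<close>, extended by zero: on an
  element permuting the cycles of \<open>u\<close>, \<open>\<chi>\<^sub>u\<close> is the product of \<open>exp (2 \<pi> i M j / l)\<close> over the shifts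
  \<open>j\<close> along the cycles, of length \<open>l\<close>, where \<open>M\<close> is divisible by precisely those \<open>k \<le> n\<close> that lie in
  \<open>P(S)\<close>. For even \<open>n - \<ell>(\<mu>)\<close> one uses \<open>(1 + sign) X / 2\<close> instead, and \<open>P(S)\<close>-avoiding parts are the
  case of the complement of \<open>S\<close>.
\<close>

unbundle no m_inv_syntax

section \<open>Words and permutations\<close>

text \<open>The two families of class functions have complementary strengths. Jacobi-Trudi
  determinants are signed sums of permutation characters, so their pairings with \<open>X\<close>
  are visibly integral but of unclear sign; Young symmetrizers give the sign but no coefficients.
  Proportionality with a positive factor lets each supply what the other lacks, and no
  representation is constructed.

  The sign comes from an identity valid for class functions: (r c)(r' c')^-1 is conjugate to (r'^-1
  r)(c c'^-1), so the value of \<open>X\<close> at a symmetrizer is, up to a positive factor, a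
  quadratic form in the kernel \<open>X (a \<circ> inv b)\<close>.

  The shape of \<chi>_u is dictated by summing over \<open>u\<close> for fixed \<open>w\<close>. If
  all cycle lengths of \<open>w\<close> are in P(S), then \<open>w\<close> has a power with exponent
  in P(S) equal to 1, while the choice of \<open>M\<close> makes the values of \<chi>_u have order
  prime to \<open>S\<close>; so \<chi>_u(w) = 1. If some cycle length \<open>k\<close> is not in
  P(S), then \<open>k\<close> does not divide \<open>M\<close>, and multiplying \<open>u\<close> by
  the powers of \<open>w\<close> on that cycle alone takes \<chi>_u(w) through a constant times all
  powers of exp (2 pi i M / k), which sum to zero.\<close>

abbreviation perms :: "nat \<Rightarrow> (nat \<Rightarrow> nat) set" where
  "perms n \<equiv> {w. w permutes {..<n}}"

lemma finite_perms [simp]: "finite (perms n)"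
  by (simp add: finite_permutations)

lemma permutation_perms: "w \<in> perms n \<Longrightarrow> permutation w"
  using permutes_imp_permutation[of "{..<n}" w] by simp

text \<open>Orbit-stabilizer in summed form: the stabilizer of \<open>y\<close> is as large as the
  fibre of group elements taking \<open>y0\<close> to \<open>y\<close>, and these fibres partition
  \<open>perms n\<close>. It serves rearrangements of words and conjugation of permutations
  alike.\<close>

lemma transitive_action_sum_stabilizers:
  assumes comp: "\<And>g h y. g \<in> perms n \<Longrightarrow> h \<in> perms n \<Longrightarrow> y \<in> Y \<Longrightarrow> act (g \<circ> h) y = act g (act h y)"
    and closed: "\<And>g y. g \<in> perms n \<Longrightarrow> y \<in> Y \<Longrightarrow> act g y \<in> Y"
    and y0: "y0 \<in> Y"
    and trans: "\<And>y. y \<in> Y \<Longrightarrow> \<exists>g\<in>perms n. act g y0 = y"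
  shows "(\<Sum>y\<in>Y. card {g \<in> perms n. act g y = y}) = fact n"
proof -
  have Y: "Y = (\<lambda>g. act g y0) ` perms n" using closed trans y0 by blast
  then have fin: "finite Y" by simp
  have "card {g \<in> perms n. act g y = y} = card {g \<in> perms n. act g y0 = y}" if y: "y \<in> Y" for y
  proof -
    obtain h where h: "h \<in> perms n" "act h y0 = y" using trans y by blast
    have hi: "inv h \<in> perms n" using h by (simp add: permutes_inv)
    have "act (inv h) y = act (inv h \<circ> h) y0" using comp[OF hi h(1) y0] h by simp
    also have "\<dots> = y0"
    proof -
      obtain g where g: "g \<in> perms n" "act g y0 = y0" using trans[OF y0] by blast
      \<comment> \<open>Transitivity writes \<open>y0\<close> as \<open>act g y0\<close>, so the
        composition law yields the identity law at \<open>y0\<close>.\<close>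
      have "act id y0 = y0" using comp[of id g y0] g y0 by simp
      then show ?thesis using h by (auto simp: permutes_inv_o)
    qed
    finally have hy: "act (inv h) y = y0" .
    have "bij_betw (\<lambda>g. g \<circ> h) {g \<in> perms n. act g y = y} {g \<in> perms n. act g y0 = y}"
    proof (rule bij_betw_byWitness[where f' = "\<lambda>g. g \<circ> inv h"])
      show "\<forall>a\<in>{g \<in> perms n. act g y = y}. a \<circ> h \<circ> inv h = a"
        using h by (auto simp: o_assoc[symmetric] permutes_inv_o)
      show "\<forall>a\<in>{g \<in> perms n. act g y0 = y}. a \<circ> inv h \<circ> h = a"
        using h by (auto simp: o_assoc[symmetric] permutes_inv_o)
      show "(\<lambda>g. g \<circ> h) ` {g \<in> perms n. act g y = y} \<subseteq> {g \<in> perms n. act g y0 = y}"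
        using h comp y0 by (auto intro: permutes_compose)
      show "(\<lambda>g. g \<circ> inv h) ` {g \<in> perms n. act g y0 = y} \<subseteq> {g \<in> perms n. act g y = y}"
        using hi hy y comp by (auto intro: permutes_compose)
    qed
    then show ?thesis by (rule bij_betw_same_card)
  qed
  then have "(\<Sum>y\<in>Y. card {g \<in> perms n. act g y = y}) = (\<Sum>y\<in>Y. card {g \<in> perms n. act g y0 = y})"
    by (intro sum.cong) auto
  also have "\<dots> = (\<Sum>y\<in>Y. sum (\<lambda>_. 1) {g \<in> perms n. act g y0 = y})" by simp
  also have "\<dots> = sum (\<lambda>_. 1) (perms n)"
    by (rule sum.group) (use fin Y in auto)
  also have "\<dots> = fact n" by (simp add: card_permutations)
  finally show ?thesis .
qed

definition words :: "nat \<Rightarrow> 'b multiset \<Rightarrow> (nat \<Rightarrow> 'b) set" where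
  "words n A = {v \<in> {..<n} \<rightarrow>\<^sub>E UNIV. image_mset v (mset_set {..<n}) = A}"

text \<open>The permutation character on the arrangements of \<open>A\<close>, that is, the trivial
  character induced from a Young subgroup when \<open>size A = n\<close>. The letter type is left
  open because products lead to words over pairs.\<close>

definition fixed_words :: "nat \<Rightarrow> 'b multiset \<Rightarrow> (nat \<Rightarrow> nat) \<Rightarrow> nat" where
  "fixed_words n A w = card {v \<in> words n A. \<forall>x<n. v (w x) = v x}"

lemma finite_words [simp]: "finite (words n A)"
proof (rule finite_subset)
  show "words n A \<subseteq> {..<n} \<rightarrow>\<^sub>E set_mset A"
    by (auto simp: words_def PiE_iff extensional_def)
  show "finite ({..<n} \<rightarrow>\<^sub>E set_mset A)" by (intro finite_PiE) auto
qed

lemma words_mset: "v \<in> words n A \<Longrightarrow> image_mset v (mset_set {..<n}) = A"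
  by (simp add: words_def)

lemma words_undefined: "v \<in> words n A \<Longrightarrow> \<not> x < n \<Longrightarrow> v x = undefined"
  by (auto simp: words_def PiE_iff extensional_def)

lemma wordsI:
  "(\<And>x. \<not> x < n \<Longrightarrow> v x = undefined) \<Longrightarrow> image_mset v (mset_set {..<n}) = A \<Longrightarrow> v \<in> words n A"
  by (simp add: words_def PiE_iff extensional_def)

lemma words_size: "v \<in> words n A \<Longrightarrow> size A = n"
  using words_mset[of v n A] by (metis card_lessThan size_image_mset size_mset_set)

lemma fixed_words_eq_0: "size A \<noteq> n \<Longrightarrow> fixed_words n A w = 0"
  using words_size by (force simp: fixed_words_def)

lemma words_nonempty:
  assumes "size A = n" shows "words n A \<noteq> {}"
proof -
  obtain xs where xs: "mset xs = A" using ex_mset by blast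
  then have l: "length xs = n" using assms by auto
  have "image_mset (\<lambda>i\<in>{..<n}. xs ! i) (mset_set {..<n}) = image_mset (\<lambda>i. xs ! i) (mset_set {..<n})"
    by (intro image_mset_cong) auto
  also have "\<dots> = mset (map (\<lambda>i. xs ! i) [0..<n])" by (simp add: lessThan_atLeast0 flip: mset_upt)
  also have "\<dots> = A" using xs l map_nth[of xs] by simp
  finally have "(\<lambda>i\<in>{..<n}. xs ! i) \<in> words n A" by (intro wordsI) auto
  then show ?thesis by blast
qed

lemma words_comp:
  assumes "v \<in> words n A" "w \<in> perms n" shows "v \<circ> w \<in> words n A"
proof -
  have "image_mset (v \<circ> w) (mset_set {..<n}) = image_mset v (image_mset w (mset_set {..<n}))"
    by (simp add: multiset.map_comp)
  also have "image_mset w (mset_set {..<n}) = mset_set {..<n}"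
    using assms by (intro permutes_image_mset) auto
  also have "image_mset v (mset_set {..<n}) = A" using assms(1) by (rule words_mset)
  finally have m: "image_mset (v \<circ> w) (mset_set {..<n}) = A" .
  have "(v \<circ> w) x = undefined" if "\<not> x < n" for x
    using words_undefined[OF assms(1), of x] permutes_not_in[of w "{..<n}" x] assms(2) that by simp
  then show ?thesis using m by (rule wordsI)
qed

lemma words_fixed_iff:
  assumes "w permutes {..<n}" shows "(\<forall>x<n. v (w x) = v x) \<longleftrightarrow> v \<circ> w = v"
proof
  assume a: "\<forall>x<n. v (w x) = v x"
  show "v \<circ> w = v"
  proof
    show "(v \<circ> w) x = v x" for x
      using a permutes_not_in[OF assms, of x] by (cases "x < n") auto
  qed
qed (metis comp_apply)

lemma sum_word_stabilizers:
  assumes "size A = n"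
  shows "(\<Sum>v\<in>words n A. card {w \<in> perms n. \<forall>x<n. v (w x) = v x}) = fact n"
proof -
  obtain v0 where v0: "v0 \<in> words n A" using words_nonempty assms by blast
  have eq: "(v \<circ> inv w = v) \<longleftrightarrow> (\<forall>x<n. v (w x) = v x)" if "w permutes {..<n}" for v :: "nat \<Rightarrow> 'a" and w
  proof -
    have "v \<circ> inv w = v \<longleftrightarrow> v \<circ> w = v"
      by (metis comp_assoc comp_id permutes_inv_o[OF that])
    then show ?thesis using words_fixed_iff[OF that, of v] by simp
  qed
  \<comment> \<open>The inverse turns precomposition into a left action.\<close>
  have "(\<Sum>v\<in>words n A. card {w \<in> perms n. v \<circ> inv w = v}) = fact n"
  proof (rule transitive_action_sum_stabilizers[where act = "\<lambda>w v. v \<circ> inv w" and ?y0.0 = v0])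
    show "v \<circ> inv (g \<circ> h) = v \<circ> inv h \<circ> inv g" if "g \<in> perms n" "h \<in> perms n" for g h and v :: "nat \<Rightarrow> 'a"
      using that by (metis comp_assoc mem_Collect_eq o_inv_distrib permutes_bij)
    show "v \<circ> inv g \<in> words n A" if "g \<in> perms n" "v \<in> words n A" for g v
      using that by (intro words_comp) (auto intro: permutes_inv)
    show "v0 \<in> words n A" by fact
    show "\<exists>g\<in>perms n. v0 \<circ> inv g = v" if v: "v \<in> words n A" for v
    proof -
      have "image_mset v0 (mset_set {..<n}) = image_mset v (mset_set {..<n})"
        using words_mset[OF v] words_mset[OF v0] by simp
      then obtain p where p: "p permutes {..<n}" "\<forall>x\<in>{..<n}. v0 x = v (p x)"
        using image_mset_eq_implies_permutes[of "{..<n}" v0 v] by auto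
      have "v0 = v \<circ> p"
      proof
        show "v0 x = (v \<circ> p) x" for x
          using p words_undefined[OF v, of x] words_undefined[OF v0, of x] permutes_not_in[OF p(1), of x]
          by (cases "x < n") auto
      qed
      then have "v0 \<circ> inv p = v" using p by (simp add: o_assoc[symmetric] permutes_inv_o)
      then show ?thesis using p by blast
    qed
  qed
  then show ?thesis using eq by (simp cong: conj_cong)
qed

text \<open>Burnside's count for a transitive action: the permutation character contains the trivial
  one exactly once.\<close>

lemma sum_fixed_words:
  assumes "size A = n" shows "(\<Sum>w\<in>perms n. fixed_words n A w) = fact n"
proof -
  have "(\<Sum>w\<in>perms n. fixed_words n A w)
      = (\<Sum>w\<in>perms n. \<Sum>v\<in>words n A. if \<forall>x<n. v (w x) = v x then 1 else 0)"
    unfolding fixed_words_def by (simp add: sum.If_cases Int_def)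
  also have "\<dots> = (\<Sum>v\<in>words n A. \<Sum>w\<in>perms n. if \<forall>x<n. v (w x) = v x then 1 else 0)"
    by (rule sum.swap)
  also have "\<dots> = (\<Sum>v\<in>words n A. card {w \<in> perms n. \<forall>x<n. v (w x) = v x})"
    by (simp add: sum.If_cases Int_def)
  finally show ?thesis using sum_word_stabilizers[OF assms] by simp
qed

text \<open>Contingency tables with given margins, encoded as multisets of pairs.\<close>

definition tables :: "'a multiset \<Rightarrow> 'b multiset \<Rightarrow> ('a \<times> 'b) multiset set" where
  "tables A B = {Z. image_mset fst Z = A \<and> image_mset snd Z = B}"

lemma finite_tables [simp]: "finite (tables A B)"
proof (rule finite_subset)
  show "tables A B \<subseteq> (\<lambda>v. image_mset v (mset_set {..<size A})) ` ({..<size A} \<rightarrow>\<^sub>E set_mset A \<times> set_mset B)"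
  proof
    fix Z assume "Z \<in> tables A B"
    then have Z: "image_mset fst Z = A" "image_mset snd Z = B" by (auto simp: tables_def)
    have s: "size Z = size A" using Z(1) by auto
    obtain v where v: "v \<in> words (size A) Z" using words_nonempty[OF s] by blast
    have "(v x) \<in># Z" if "x < size A" for x
      using words_mset[OF v] that by (metis finite_lessThan finite_set_mset_mset_set image_eqI lessThan_iff set_image_mset)
    then have "v x \<in> set_mset A \<times> set_mset B" if "x < size A" for x
      using Z that by (metis imageI mem_Times_iff multiset.set_map)
    then have "v \<in> {..<size A} \<rightarrow>\<^sub>E set_mset A \<times> set_mset B"
      using words_undefined[OF v] by (auto simp: PiE_iff extensional_def)
    moreover have "Z = image_mset v (mset_set {..<size A})" using words_mset[OF v] by simp
    ultimately show "Z \<in> (\<lambda>v. image_mset v (mset_set {..<size A})) ` ({..<size A} \<rightarrow>\<^sub>E set_mset A \<times> set_mset B)"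
      by blast
  qed
  show "finite ((\<lambda>v. image_mset v (mset_set {..<size A})) ` ({..<size A} \<rightarrow>\<^sub>E set_mset A \<times> set_mset B))"
    by (intro finite_imageI finite_PiE) auto
qed

text \<open>Two words fixed by \<open>w\<close> are one fixed word over pairs, and the contents of
  such words are the tables with margins \<open>A\<close> and \<open>B\<close>. This is Mackey's
  decomposition of a product of two permutation characters.\<close>

lemma fixed_words_product:
  "w \<in> perms n \<Longrightarrow> fixed_words n A w * fixed_words n B w = (\<Sum>Z\<in>tables A B. fixed_words n Z w)"
proof -
  assume w: "w \<in> perms n"
  let ?FA = "{v \<in> words n A. \<forall>x<n. v (w x) = v x}"
  let ?FB = "{v \<in> words n B. \<forall>x<n. v (w x) = v x}"
  let ?F = "\<lambda>Z. {v \<in> words n Z. \<forall>x<n. v (w x) = v x}"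
  have "bij_betw (\<lambda>(a, b). \<lambda>x\<in>{..<n}. (a x, b x)) (?FA \<times> ?FB) (\<Union>Z\<in>tables A B. ?F Z)"
  proof (rule bij_betw_byWitness[where f' = "\<lambda>v. (\<lambda>x\<in>{..<n}. fst (v x), \<lambda>x\<in>{..<n}. snd (v x))"])
    have wn: "w x < n" if "x < n" for x using w that by (metis lessThan_iff mem_Collect_eq permutes_in_image)
    have wn': "x < n" if "w x < n" for x using w that by (metis lessThan_iff mem_Collect_eq permutes_in_image)
    have r: "image_mset (restrict f {..<n}) (mset_set {..<n}) = image_mset f (mset_set {..<n})" for f :: "nat \<Rightarrow> 'z"
      by (intro image_mset_cong) auto
    show "\<forall>p\<in>?FA \<times> ?FB. (\<lambda>v. (\<lambda>x\<in>{..<n}. fst (v x), \<lambda>x\<in>{..<n}. snd (v x))) ((\<lambda>(a, b). \<lambda>x\<in>{..<n}. (a x, b x)) p) = p"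
      by (auto simp: fun_eq_iff dest: words_undefined)
    show "\<forall>v\<in>\<Union> (?F ` tables A B). (\<lambda>(a, b). \<lambda>x\<in>{..<n}. (a x, b x)) (\<lambda>x\<in>{..<n}. fst (v x), \<lambda>x\<in>{..<n}. snd (v x)) = v"
      by (auto simp: fun_eq_iff dest: words_undefined)
    show "(\<lambda>(a, b). \<lambda>x\<in>{..<n}. (a x, b x)) ` (?FA \<times> ?FB) \<subseteq> \<Union> (?F ` tables A B)"
    proof
      fix v assume "v \<in> (\<lambda>(a, b). \<lambda>x\<in>{..<n}. (a x, b x)) ` (?FA \<times> ?FB)"
      then obtain a b where ab: "a \<in> ?FA" "b \<in> ?FB" and v: "v = (\<lambda>x\<in>{..<n}. (a x, b x))" by auto
      define Z where "Z = image_mset v (mset_set {..<n})"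
      have Z: "Z = image_mset (\<lambda>x. (a x, b x)) (mset_set {..<n})"
        unfolding Z_def v by (intro image_mset_cong) auto
      have "image_mset fst Z = A" "image_mset snd Z = B"
        using words_mset[of a n A] words_mset[of b n B] ab by (simp_all add: Z multiset.map_comp comp_def)
      then have "Z \<in> tables A B" by (simp add: tables_def)
      moreover have "v \<in> words n Z" by (rule wordsI) (auto simp: v Z_def)
      moreover have "\<forall>x<n. v (w x) = v x" using ab v wn by auto
      ultimately show "v \<in> \<Union> (?F ` tables A B)" by blast
    qed
    show "(\<lambda>v. (\<lambda>x\<in>{..<n}. fst (v x), \<lambda>x\<in>{..<n}. snd (v x))) ` \<Union> (?F ` tables A B) \<subseteq> ?FA \<times> ?FB"
    proof
      fix p assume "p \<in> (\<lambda>v. (\<lambda>x\<in>{..<n}. fst (v x), \<lambda>x\<in>{..<n}. snd (v x))) ` \<Union> (?F ` tables A B)"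
      then obtain Z v where Z: "Z \<in> tables A B" "v \<in> words n Z" "\<forall>x<n. v (w x) = v x"
        and p: "p = (\<lambda>x\<in>{..<n}. fst (v x), \<lambda>x\<in>{..<n}. snd (v x))" by auto
      have "image_mset (\<lambda>x\<in>{..<n}. fst (v x)) (mset_set {..<n}) = image_mset fst (image_mset v (mset_set {..<n}))"
        by (auto simp: multiset.map_comp intro!: image_mset_cong)
      then have "(\<lambda>x\<in>{..<n}. fst (v x)) \<in> words n A"
        using Z words_mset[OF Z(2)] by (intro wordsI) (auto simp: tables_def)
      moreover have "image_mset (\<lambda>x\<in>{..<n}. snd (v x)) (mset_set {..<n}) = image_mset snd (image_mset v (mset_set {..<n}))"
        by (auto simp: multiset.map_comp intro!: image_mset_cong)
      then have "(\<lambda>x\<in>{..<n}. snd (v x)) \<in> words n B"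
        using Z words_mset[OF Z(2)] by (intro wordsI) (auto simp: tables_def)
      ultimately show "p \<in> ?FA \<times> ?FB" using Z p wn by simp
    qed
  qed
  then have "card (?FA \<times> ?FB) = card (\<Union>Z\<in>tables A B. ?F Z)" by (rule bij_betw_same_card)
  also have "\<dots> = (\<Sum>Z\<in>tables A B. card (?F Z))"
    by (rule card_UN_disjoint) (auto dest!: words_mset)
  finally show ?thesis by (simp add: fixed_words_def card_cartesian_product)
qed

lemma sum_fixed_words_product:
  assumes "size A = n"
  shows "(\<Sum>w\<in>perms n. fixed_words n A w * fixed_words n B w) = fact n * card (tables A B)"
proof -
  have "(\<Sum>w\<in>perms n. fixed_words n A w * fixed_words n B w)
      = (\<Sum>Z\<in>tables A B. \<Sum>w\<in>perms n. fixed_words n Z w)"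
    by (simp add: fixed_words_product sum.swap[of _ "tables A B"])
  also have "\<dots> = (\<Sum>Z\<in>tables A B. fact n)"
    using assms by (intro sum.cong refl sum_fixed_words) (auto simp: tables_def)
  finally show ?thesis by simp
qed

section \<open>The Jacobi-Trudi determinant\<close>

definition vec_mset :: "nat \<Rightarrow> (nat \<Rightarrow> int) \<Rightarrow> nat multiset" where
  "vec_mset r k = (\<Sum>j<r. replicate_mset (nat (k j)) j)"

text \<open>The coefficient of x^B in the product of the complete homogeneous functions h_(k j).
  Indices are integers because determinants produce negative ones; the case distinction is the
  convention that h vanishes there, whereas \<open>nat\<close> in \<open>vec_mset\<close> would turn
  it into h_0 = 1.\<close>

definition table_count :: "nat \<Rightarrow> (nat \<Rightarrow> int) \<Rightarrow> 'b multiset \<Rightarrow> int" where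
  "table_count r k B = (if \<forall>j<r. k j \<ge> 0 then int (card (tables (vec_mset r k) B)) else 0)"

definition below :: "nat \<Rightarrow> (nat \<Rightarrow> int) \<Rightarrow> nat \<Rightarrow> (nat \<Rightarrow> int) set" where
  "below r k b = {m \<in> {..<r} \<rightarrow>\<^sub>E UNIV. (\<forall>j<r. m j \<le> k j) \<and> (\<Sum>j<r. k j - m j) = int b}"

lemma count_vec_mset: "count (vec_mset r k) j = (if j < r then nat (k j) else 0)"
  by (simp add: vec_mset_def count_sum)

lemma size_vec_mset: "size (vec_mset r k) = (\<Sum>j<r. nat (k j))"
  by (simp add: vec_mset_def)

lemma vec_mset_cong: "(\<And>j. j < r \<Longrightarrow> k j = k' j) \<Longrightarrow> vec_mset r k = vec_mset r k'"
  by (simp add: vec_mset_def)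

lemma table_count_cong: "(\<And>j. j < r \<Longrightarrow> k j = k' j) \<Longrightarrow> table_count r k B = table_count r k' B"
  using vec_mset_cong[of r k k'] unfolding table_count_def by (metis (no_types, lifting))

lemma finite_below [simp]: "finite (below r k b)"
proof (rule finite_subset)
  show "below r k b \<subseteq> (\<Pi>\<^sub>E j\<in>{..<r}. {k j - int b..k j})"
  proof
    fix m assume m: "m \<in> below r k b"
    have "k j - m j \<le> int b" if "j < r" for j
    proof -
      have "k j - m j \<le> (\<Sum>j<r. k j - m j)"
        using m that by (intro member_le_sum) (auto simp: below_def)
      then show ?thesis using m by (simp add: below_def)
    qed
    then show "m \<in> (\<Pi>\<^sub>E j\<in>{..<r}. {k j - int b..k j})"
      using m by (force simp: below_def PiE_iff)
  qed
  show "finite (\<Pi>\<^sub>E j\<in>{..<r}. {k j - int b..k j})"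
    by (intro finite_PiE) auto
qed

section \<open>Removing one letter from tables and determinants\<close>

lemma filter_image_mset: "filter_mset P (image_mset f M) = image_mset f (filter_mset (\<lambda>x. P (f x)) M)"
  by (induction M) auto

lemma finite_submultisets: "finite {A'. A' \<subseteq># A}"
proof (induction A)
  case (add x A)
  have "A' \<in> {A'. A' \<subseteq># A} \<union> add_mset x ` {A'. A' \<subseteq># A}" if "A' \<subseteq># add_mset x A" for A'
  proof (cases "x \<in># A'")
    case True
    then have "A' = add_mset x (A' - {#x#})" by simp
    moreover have "A' - {#x#} \<subseteq># A" using that by (simp add: subset_eq_diff_conv)
    ultimately show ?thesis by blast
  next
    case False
    then show ?thesis using that
      by (metis UnI1 diff_single_trivial mem_Collect_eq subset_eq_diff_conv add_mset_add_single)
  qed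
  then have "{A'. A' \<subseteq># add_mset x A} \<subseteq> {A'. A' \<subseteq># A} \<union> add_mset x ` {A'. A' \<subseteq># A}" by blast
  then show ?case using add finite_subset by blast
qed simp

text \<open>The pairs with second entry \<open>b\<close> are determined by their first entries
  \<open>A - A'\<close>, where \<open>A'\<close> collects the first entries of all other pairs;
  hence a table amounts to \<open>A'\<close> together with a table without column
  \<open>b\<close>.\<close>

lemma card_tables_remove_letter:
  fixes A :: "'a multiset" and B :: "'b multiset"
  shows "card (tables A B) = (\<Sum>A' | A' \<subseteq># A \<and> size A = size A' + count B b.
    card (tables A' (filter_mset (\<lambda>x. x \<noteq> b) B)))"
proof -
  let ?S = "{A'. A' \<subseteq># A \<and> size A = size A' + count B b}"
  let ?B = "filter_mset (\<lambda>x. x \<noteq> b) B"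
  have fin: "finite ?S"
    by (rule finite_subset[of _ "{A'. A' \<subseteq># A}"]) (auto intro: finite_submultisets)
  have "bij_betw (\<lambda>Z. let Z' = filter_mset (\<lambda>z. snd z \<noteq> b) Z in (image_mset fst Z', Z'))
      (tables A B) (SIGMA A':?S. tables A' ?B)"
  proof (rule bij_betw_byWitness[where f' = "\<lambda>(A', Z'). Z' + image_mset (\<lambda>a. (a, b)) (A - A')"])
    have dec: "Z = filter_mset (\<lambda>z. snd z \<noteq> b) Z + filter_mset (\<lambda>z. snd z = b) Z" for Z :: "('a \<times> 'b) multiset"
      using multiset_partition[of Z "\<lambda>z. snd z \<noteq> b"] by simp
    have sub: "A - image_mset fst (filter_mset (\<lambda>z. snd z \<noteq> b) Z) = image_mset fst (filter_mset (\<lambda>z. snd z = b) Z)"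
      if "Z \<in> tables A B" for Z
    proof -
      have "A = image_mset fst Z" using that by (simp add: tables_def)
      also have "\<dots> = image_mset fst (filter_mset (\<lambda>z. snd z \<noteq> b) Z) + image_mset fst (filter_mset (\<lambda>z. snd z = b) Z)"
        using arg_cong[OF dec[of Z], of "image_mset fst"] by (simp only: image_mset_union)
      finally show ?thesis by simp
    qed
    have im: "image_mset (\<lambda>a. (a, b)) (image_mset fst (filter_mset (\<lambda>z. snd z = b) Z)) = filter_mset (\<lambda>z. snd z = b) Z"
      for Z :: "('a \<times> 'b) multiset"
      by (induction Z) auto
    show "\<forall>Z\<in>tables A B. (case let Z' = filter_mset (\<lambda>z. snd z \<noteq> b) Z in (image_mset fst Z', Z') of
        (A', Z') \<Rightarrow> Z' + image_mset (\<lambda>a. (a, b)) (A - A')) = Z"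
      using sub im dec by (simp add: Let_def)
    have no: "snd z \<noteq> b" if "Z' \<in> tables A' ?B" "z \<in># Z'" for Z' A' z
    proof -
      have "snd z \<in># ?B" using that unfolding tables_def by (metis (mono_tags, lifting) imageI mem_Collect_eq set_image_mset)
      then show ?thesis by simp
    qed
    show "\<forall>p\<in>SIGMA A':?S. tables A' ?B. (let Z' = filter_mset (\<lambda>z. snd z \<noteq> b) (case p of
        (A', Z') \<Rightarrow> Z' + image_mset (\<lambda>a. (a, b)) (A - A')) in (image_mset fst Z', Z')) = p"
    proof
      fix p assume p: "p \<in> (SIGMA A':?S. tables A' ?B)"
      obtain A' Z' where pp: "p = (A', Z')" by force
      have Z': "Z' \<in> tables A' ?B" using p pp by auto
      have "filter_mset (\<lambda>z. snd z \<noteq> b) Z' = Z'" using no[OF Z'] by (simp add: filter_mset_eq_conv)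
      then have "filter_mset (\<lambda>z. snd z \<noteq> b) (Z' + image_mset (\<lambda>a. (a, b)) (A - A')) = Z'"
        by (simp add: filter_image_mset)
      then show "(let Z' = filter_mset (\<lambda>z. snd z \<noteq> b) (case p of
        (A', Z') \<Rightarrow> Z' + image_mset (\<lambda>a. (a, b)) (A - A')) in (image_mset fst Z', Z')) = p"
        using Z' by (simp add: pp Let_def tables_def)
    qed
    show "(\<lambda>Z. let Z' = filter_mset (\<lambda>z. snd z \<noteq> b) Z in (image_mset fst Z', Z')) ` tables A B \<subseteq> (SIGMA A':?S. tables A' ?B)"
    proof
      fix p assume "p \<in> (\<lambda>Z. let Z' = filter_mset (\<lambda>z. snd z \<noteq> b) Z in (image_mset fst Z', Z')) ` tables A B"
      then obtain Z where Z: "Z \<in> tables A B" and p: "p = (image_mset fst (filter_mset (\<lambda>z. snd z \<noteq> b) Z), filter_mset (\<lambda>z. snd z \<noteq> b) Z)"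
        by (auto simp: Let_def)
      have fs: "image_mset fst Z = A" "image_mset snd Z = B" using Z by (auto simp: tables_def)
      have "image_mset fst (filter_mset (\<lambda>z. snd z \<noteq> b) Z) \<subseteq># A"
        using fs(1) image_mset_subseteq_mono[OF multiset_filter_subset] by blast
      moreover have "count B b = size (filter_mset (\<lambda>z. snd z = b) Z)"
        unfolding fs(2)[symmetric] by (induction Z) auto
      then have "size A = size (filter_mset (\<lambda>z. snd z \<noteq> b) Z) + count B b"
        using arg_cong[OF dec[of Z], of size] fs(1) by (metis size_image_mset size_union)
      moreover have "image_mset snd (filter_mset (\<lambda>z. snd z \<noteq> b) Z) = ?B"
        unfolding fs(2)[symmetric] by (simp add: filter_image_mset)
      ultimately show "p \<in> (SIGMA A':?S. tables A' ?B)"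
        by (simp add: p tables_def)
    qed
    show "(\<lambda>(A', Z'). Z' + image_mset (\<lambda>a. (a, b)) (A - A')) ` (SIGMA A':?S. tables A' ?B) \<subseteq> tables A B"
    proof
      fix Z assume "Z \<in> (\<lambda>(A', Z'). Z' + image_mset (\<lambda>a. (a, b)) (A - A')) ` (SIGMA A':?S. tables A' ?B)"
      then obtain A' Z' where A': "A' \<subseteq># A" "size A = size A' + count B b" and Z': "Z' \<in> tables A' ?B"
        and Z: "Z = Z' + image_mset (\<lambda>a. (a, b)) (A - A')" by auto
      have "image_mset fst Z = A' + (A - A')" using Z' by (simp add: Z tables_def multiset.map_comp comp_def)
      then have "image_mset fst Z = A" using A'(1) by simp
      moreover have "image_mset snd Z = ?B + replicate_mset (size (A - A')) b"
        using Z' by (simp add: Z tables_def multiset.map_comp comp_def image_mset_const_eq)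
      then have "image_mset snd Z = ?B + filter_mset (\<lambda>x. x = b) B"
        using A' by (simp add: size_Diff_submset filter_eq_replicate_mset)
      then have "image_mset snd Z = B" using multiset_partition[of B "\<lambda>x. x \<noteq> b"] by simp
      ultimately show "Z \<in> tables A B" by (simp add: tables_def)
    qed
  qed
  then have "card (tables A B) = card (SIGMA A':?S. tables A' ?B)" by (rule bij_betw_same_card)
  also have "\<dots> = (\<Sum>A'\<in>?S. card (tables A' ?B))" using fin by simp
  finally show ?thesis .
qed

lemma table_count_remove_letter:
  "table_count r k B = (\<Sum>m\<in>below r k (count B b). table_count r m (filter_mset (\<lambda>x. x \<noteq> b) B))"
proof (cases "\<forall>j<r. k j \<ge> 0")
  \<comment> \<open>A negative entry stays negative in every vector of \<open>below\<close>, so both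
    sides vanish.\<close>
  case False
  then obtain j where j: "j < r" "k j < 0" by force
  have "table_count r m B' = 0" if "m \<in> below r k (count B b)" for m and B' :: "'a multiset"
  proof -
    have "m j < 0" using that j by (force simp: below_def)
    then show ?thesis using j by (auto simp: table_count_def)
  qed
  then show ?thesis using False by (auto simp: table_count_def)
next
  case True
  let ?S = "{A'. A' \<subseteq># vec_mset r k \<and> size (vec_mset r k) = size A' + count B b}"
  let ?P = "{m \<in> below r k (count B b). \<forall>j<r. m j \<ge> 0}"
  let ?B = "filter_mset (\<lambda>x. x \<noteq> b) B"
  have sz: "int (size (vec_mset r m)) = (\<Sum>j<r. m j)" if "\<forall>j<r. m j \<ge> 0" for m
    using that by (simp add: size_vec_mset)
  have "table_count r k B = (\<Sum>A'\<in>?S. int (card (tables A' ?B)))"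
    using True by (simp add: table_count_def card_tables_remove_letter[of _ B b])
  also have "\<dots> = (\<Sum>m\<in>?P. int (card (tables (vec_mset r m) ?B)))"
  proof (rule sum.reindex_bij_witness[where i = "vec_mset r" and j = "\<lambda>A'. \<lambda>j\<in>{..<r}. int (count A' j)"])
    fix A' assume A': "A' \<in> ?S"
    have z: "count A' j = 0" if "\<not> j < r" for j
      using A' that mset_subset_eq_count[of A' "vec_mset r k" j] by (simp add: count_vec_mset)
    show *: "vec_mset r (\<lambda>j\<in>{..<r}. int (count A' j)) = A'"
      using z by (intro multiset_eqI) (auto simp: count_vec_mset)
    have le: "int (count A' j) \<le> k j" if "j < r" for j
      using A' that True mset_subset_eq_count[of A' "vec_mset r k" j] by (auto simp: count_vec_mset)
    have "int (size A') = (\<Sum>j<r. int (count A' j))"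
      using sz[of "\<lambda>j\<in>{..<r}. int (count A' j)"] * by simp
    then have "(\<Sum>j<r. k j - int (count A' j)) = int (count B b)"
      using A' sz[OF True] by (simp add: sum_subtractf)
    then show "(\<lambda>j\<in>{..<r}. int (count A' j)) \<in> ?P" using le by (simp add: below_def)
    show "int (card (tables (vec_mset r (\<lambda>j\<in>{..<r}. int (count A' j))) ?B)) = int (card (tables A' ?B))"
      unfolding * ..
  next
    fix m assume m: "m \<in> ?P"
    show "(\<lambda>j\<in>{..<r}. int (count (vec_mset r m) j)) = m"
      using m by (auto simp: below_def fun_eq_iff count_vec_mset PiE_iff extensional_def)
    have "vec_mset r m \<subseteq># vec_mset r k"
      using m by (intro mset_subset_eqI) (auto simp: below_def count_vec_mset nat_mono)
    moreover have "int (size (vec_mset r k)) = int (size (vec_mset r m)) + int (count B b)"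
      using m sz[OF True] sz[of m] by (simp add: below_def sum_subtractf)
    ultimately show "vec_mset r m \<in> ?S" by simp
  qed
  also have "\<dots> = (\<Sum>m\<in>?P. table_count r m ?B)"
    by (intro sum.cong) (auto simp: table_count_def)
  also have "\<dots> = (\<Sum>m\<in>below r k (count B b). table_count r m ?B)"
    by (rule sum.mono_neutral_left) (auto simp: table_count_def)
  finally show ?thesis .
qed

text \<open>The coefficient of x^B in the r by r determinant with entries h_(l i + j). With
  \<open>l j = mu j - j\<close> this is the Jacobi-Trudi determinant of \<open>mu\<close>; general
  \<open>l\<close> occurs because removing a letter produces vectors that come from no
  partition.\<close>

definition jt_sum :: "nat \<Rightarrow> (nat \<Rightarrow> int) \<Rightarrow> 'b multiset \<Rightarrow> int" where
  "jt_sum r l B = (\<Sum>s\<in>perms r. sign s * table_count r (\<lambda>j. l j + int (s j)) B)"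

text \<open>Lowering the index vector commutes with shifting it by \<open>s\<close>, so the
  recursion for tables passes through the alternating sum.\<close>

lemma jt_remove_letter:
  "jt_sum r l B = (\<Sum>m\<in>below r l (count B b). jt_sum r m (filter_mset (\<lambda>x. x \<noteq> b) B))"
proof -
  let ?B = "filter_mset (\<lambda>x. x \<noteq> b) B"
  have "table_count r (\<lambda>j. l j + int (s j)) B
     = (\<Sum>m\<in>below r l (count B b). table_count r (\<lambda>j. m j + int (s j)) ?B)" for s
    unfolding table_count_remove_letter[of r _ B b]
    by (rule sum.reindex_bij_witness[where i = "\<lambda>m. \<lambda>j\<in>{..<r}. m j + int (s j)" and j = "\<lambda>m. \<lambda>j\<in>{..<r}. m j - int (s j)"])
      (auto simp: below_def fun_eq_iff PiE_iff extensional_def algebra_simps intro!: table_count_cong)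
  then have "jt_sum r l B = (\<Sum>s\<in>perms r. \<Sum>m\<in>below r l (count B b). sign s * table_count r (\<lambda>j. m j + int (s j)) ?B)"
    by (simp add: jt_sum_def sum_distrib_left)
  also have "\<dots> = (\<Sum>m\<in>below r l (count B b). jt_sum r m ?B)"
    unfolding jt_sum_def by (rule sum.swap)
  finally show ?thesis .
qed

section \<open>Antisymmetry of the determinant\<close>

lemma card_tables_transpose:
  "card (tables (image_mset (transpose a b) A) B) = card (tables A B)"
proof -
  have inv: "image_mset (map_prod (transpose a b) id) (image_mset (map_prod (transpose a b) id) Z) = Z" for Z :: "('a \<times> 'b) multiset"
    by (induction Z) auto
  have inv': "image_mset (transpose a b) (image_mset (transpose a b) Z) = Z" for Z
    by (simp add: multiset.map_comp comp_def)
  have "bij_betw (image_mset (map_prod (transpose a b) id)) (tables (image_mset (transpose a b) A) B) (tables A B)"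
  proof (rule bij_betw_byWitness[where f' = "image_mset (map_prod (transpose a b) id)"])
    show "image_mset (map_prod (transpose a b) id) ` tables (image_mset (transpose a b) A) B \<subseteq> tables A B"
    proof
      fix Z assume "Z \<in> image_mset (map_prod (transpose a b) id) ` tables (image_mset (transpose a b) A) B"
      then obtain Y where Y: "image_mset fst Y = image_mset (transpose a b) A" "image_mset snd Y = B"
        "Z = image_mset (map_prod (transpose a b) id) Y" by (auto simp: tables_def)
      have "image_mset fst Z = image_mset (transpose a b) (image_mset fst Y)"
        by (simp add: Y(3) multiset.map_comp comp_def)
      moreover have "image_mset snd Z = B" using Y(2) by (simp add: Y(3) multiset.map_comp comp_def)
      ultimately show "Z \<in> tables A B" using Y(1) inv' by (simp add: tables_def)
    qed
    show "image_mset (map_prod (transpose a b) id) ` tables A B \<subseteq> tables (image_mset (transpose a b) A) B"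
      by (auto simp: tables_def multiset.map_comp comp_def)
  qed (simp_all add: inv)
  then show ?thesis by (rule bij_betw_same_card)
qed

lemma table_count_transpose:
  assumes "a < r" "b < r"
  shows "table_count r (k \<circ> transpose a b) B = table_count r k B"
proof -
  have lt: "transpose a b j < r \<longleftrightarrow> j < r" for j
    using assms by (auto simp: transpose_def)
  have c: "count (image_mset (transpose a b) M) (transpose a b x) = count M x" for x M
  proof (induction M)
    case (add y M)
    have "transpose a b y = transpose a b x \<longleftrightarrow> y = x" by (metis transpose_involutory)
    then show ?case using add by simp
  qed simp
  have "vec_mset r (k \<circ> transpose a b) = image_mset (transpose a b) (vec_mset r k)"
  proof (rule multiset_eqI)
    fix j
    have "count (image_mset (transpose a b) (vec_mset r k)) j
        = count (image_mset (transpose a b) (vec_mset r k)) (transpose a b (transpose a b j))" by simp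
    also have "\<dots> = count (vec_mset r k) (transpose a b j)"
      by (rule c)
    finally show "count (vec_mset r (k \<circ> transpose a b)) j = count (image_mset (transpose a b) (vec_mset r k)) j"
      using lt by (simp add: count_vec_mset)
  qed
  moreover have "(\<forall>j<r. 0 \<le> k (transpose a b j)) \<longleftrightarrow> (\<forall>j<r. 0 \<le> k j)"
    by (metis lt transpose_involutory)
  ultimately show ?thesis unfolding table_count_def comp_def by (simp only: card_tables_transpose)
qed

text \<open>A swap of two rows: the factors h commute, so composing the permutation with the
  transposition changes only the sign.\<close>

lemma jt_transpose:
  assumes "a < r" "b < r" "a \<noteq> b"
  shows "jt_sum r (l \<circ> transpose a b) B = - jt_sum r l B"
proof -
  have t: "transpose a b permutes {..<r}" using assms by (intro permutes_swap_id) auto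
  have "jt_sum r (l \<circ> transpose a b) B
      = (\<Sum>s\<in>perms r. sign (s \<circ> transpose a b) * table_count r (\<lambda>j. l (transpose a b j) + int (s (transpose a b j))) B)"
    unfolding jt_sum_def by (subst sum_permutations_compose_right[OF t]) simp
  also have "\<dots> = (\<Sum>s\<in>perms r. - (sign s * table_count r (\<lambda>j. l j + int (s j)) B))"
  proof (rule sum.cong[OF refl])
    fix s assume s: "s \<in> perms r"
    have "sign (s \<circ> transpose a b) = - sign s"
      using assms s by (simp add: sign_compose permutation_perms permutation_swap_id sign_swap_id)
    moreover have "table_count r (\<lambda>j. l (transpose a b j) + int (s (transpose a b j))) B = table_count r (\<lambda>j. l j + int (s j)) B"
      using table_count_transpose[OF assms(1,2), of "\<lambda>j. l j + int (s j)" B] by (simp add: comp_def)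
    ultimately show "sign (s \<circ> transpose a b) * table_count r (\<lambda>j. l (transpose a b j) + int (s (transpose a b j))) B
        = - (sign s * table_count r (\<lambda>j. l j + int (s j)) B)" by simp
  qed
  also have "\<dots> = - jt_sum r l B" by (simp add: jt_sum_def sum_negf)
  finally show ?thesis .
qed

text \<open>For \<open>l j = mu j - j\<close> and \<open>m j = nu j - j\<close> the strict
  inequality says \<open>mu (j + 1) \<le> nu j\<close>, so the cells of \<open>mu\<close> outside
  \<open>nu\<close> form a horizontal strip.\<close>

definition interlacing :: "nat \<Rightarrow> (nat \<Rightarrow> int) \<Rightarrow> nat \<Rightarrow> (nat \<Rightarrow> int) set" where
  "interlacing r l b = {m \<in> below r l b. \<forall>j. Suc j < r \<longrightarrow> l (Suc j) < m j}"

text \<open>The vectors of \<^const>\<open>below\<close> that do not interlace cancel in pairs: at the first violation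
  \<open>m j \<le> l (j + 1)\<close>, swap the entries \<open>j\<close> and \<open>j + 1\<close>.\<close>

lemma jt_interlacing:
  assumes dec: "\<And>j. Suc j < r \<Longrightarrow> l (Suc j) \<le> l j"
  shows "jt_sum r l B = (\<Sum>m\<in>interlacing r l (count B b). jt_sum r m (filter_mset (\<lambda>x. x \<noteq> b) B))"
proof -
  let ?B = "filter_mset (\<lambda>x. x \<noteq> b) B"
  define V where "V = (\<lambda>m j. Suc j < r \<and> m j \<le> l (Suc j))"
  define Bad where "Bad = {m \<in> below r l (count B b). \<exists>j. V m j}"
  define s where "s = (\<lambda>m. let j = (LEAST j. V m j) in m \<circ> transpose j (Suc j))"
  have s: "s m \<in> Bad \<and> s (s m) = m \<and> jt_sum r (s m) ?B = - jt_sum r m ?B" if m: "m \<in> Bad" for m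
  proof -
    define j where "j = (LEAST j. V m j)"
    have j: "V m j" using m unfolding Bad_def j_def by (auto intro: LeastI_ex)
    have jl: "\<not> V m i" if "i < j" for i using that not_less_Least unfolding j_def by blast
    have sm: "s m = m \<circ> transpose j (Suc j)" by (simp add: s_def j_def Let_def)
    have jr: "j < r" "Suc j < r" using j by (auto simp: V_def)
    have mb: "m \<in> below r l (count B b)" using m by (simp add: Bad_def)
    have t: "transpose j (Suc j) permutes {..<r}" using jr by (intro permutes_swap_id) auto
    have ext: "(m \<circ> transpose j (Suc j)) \<in> {..<r} \<rightarrow>\<^sub>E UNIV"
      using mb jr by (auto simp: below_def PiE_iff extensional_def transpose_def)
    \<comment> \<open>The entry moved to \<open>j + 1\<close> is at most \<open>l (j + 1)\<close>
      because \<open>j\<close> is a violation; the one moved to \<open>j\<close> is at most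
      \<open>l (j + 1)\<close>, hence at most \<open>l j\<close>.\<close>
    have le: "m (transpose j (Suc j) i) \<le> l i" if "i < r" for i
    proof -
      have "m (Suc j) \<le> l (Suc j)" "m j \<le> l (Suc j)" "l (Suc j) \<le> l j"
        using mb jr j dec by (auto simp: below_def V_def)
      then show ?thesis using mb that by (auto simp: below_def transpose_def)
    qed
    have "(\<Sum>i<r. (m \<circ> transpose j (Suc j)) i) = (\<Sum>i<r. m i)"
      using sum.permute[OF t, of m] by simp
    then have sb: "s m \<in> below r l (count B b)"
      using mb ext le by (simp add: sm below_def sum_subtractf)
    \<comment> \<open>After the swap position \<open>j\<close> is still a violation and the earlier
      positions are unchanged, so \<open>s\<close> picks the same \<open>j\<close> again and is an
      involution.\<close>
    have Vj: "V (s m) j" using mb jr by (auto simp: sm V_def below_def)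
    have Vl: "\<not> V (s m) i" if "i < j" for i using jl[OF that] that by (simp add: sm V_def)
    have "(LEAST j. V (s m) j) = j"
      by (rule Least_equality) (use Vj Vl not_le in blast)+
    then have "s (s m) = s m \<circ> transpose j (Suc j)" by (simp add: s_def Let_def)
    then have "s (s m) = m" by (simp add: sm comp_assoc)
    moreover have "jt_sum r (s m) ?B = - jt_sum r m ?B" unfolding sm using jr by (intro jt_transpose) auto
    ultimately show ?thesis using sb Vj by (auto simp: Bad_def)
  qed
  have "(\<Sum>m\<in>Bad. jt_sum r m ?B) = (\<Sum>m\<in>Bad. - jt_sum r m ?B)"
    by (rule sum.reindex_bij_witness[where i = s and j = s]) (use s in auto)
  then have bad: "(\<Sum>m\<in>Bad. jt_sum r m ?B) = 0" by (simp add: sum_negf)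
  have "jt_sum r l B = (\<Sum>m\<in>interlacing r l (count B b) \<union> Bad. jt_sum r m ?B)"
    unfolding jt_remove_letter[of r l B b]
    by (intro sum.cong) (auto simp: interlacing_def Bad_def V_def not_less)
  also have "\<dots> = (\<Sum>m\<in>interlacing r l (count B b). jt_sum r m ?B) + (\<Sum>m\<in>Bad. jt_sum r m ?B)"
    by (rule sum.union_disjoint) (auto simp: interlacing_def Bad_def V_def)
  finally show ?thesis using bad by simp
qed

text \<open>All indices \<open>l j + s j\<close> with \<open>s j < r\<close> are negative, so row
  \<open>j\<close> of the determinant is zero.\<close>

lemma jt_eq_0:
  assumes "j < r" "l j + int r \<le> 0" shows "jt_sum r l B = 0"
proof -
  have "table_count r (\<lambda>j. l j + int (s j)) B = 0" if "s \<in> perms r" for s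
  proof -
    have "s j < r" using that assms(1) by (metis lessThan_iff mem_Collect_eq permutes_in_image)
    then have "l j + int (s j) < 0" using assms by linarith
    then show ?thesis using assms(1) by (auto simp: table_count_def)
  qed
  then show ?thesis by (simp add: jt_sum_def)
qed

text \<open>Rows may be empty: the number \<open>r\<close> of rows, which is also the size of the
  determinant, stays the same while cells are removed.\<close>

definition shape :: "nat \<Rightarrow> (nat \<Rightarrow> nat) \<Rightarrow> nat list" where
  "shape r mu = map mu [0..<r]"

text \<open>The Kostka number of shape \<open>\<mu>\<close> and content \<open>B\<close>.\<close>

definition ssyt_count :: "nat list \<Rightarrow> nat multiset \<Rightarrow> nat" where
  "ssyt_count \<mu> B = card {T \<in> ssyt \<mu>. image_mset T (mset_set (cells \<mu>)) = B}"

lemma finite_ssyt_content_mset: "finite {T \<in> ssyt \<mu>. image_mset T (mset_set (cells \<mu>)) = B}"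
proof (rule finite_subset)
  have "T c \<in># B" if "image_mset T (mset_set (cells \<mu>)) = B" "c \<in> cells \<mu>" for T c
    using that by (metis finite_cells finite_set_mset_mset_set image_eqI set_image_mset)
  then show "{T \<in> ssyt \<mu>. image_mset T (mset_set (cells \<mu>)) = B} \<subseteq> cells \<mu> \<rightarrow>\<^sub>E set_mset B"
    by (auto simp: ssyt_def PiE_iff extensional_def)
  show "finite (cells \<mu> \<rightarrow>\<^sub>E set_mset B)" by (intro finite_PiE) auto
qed

lemma cells_shape: "cells (shape r mu) = {(i, j). i < r \<and> j < mu i}"
  by (auto simp: cells_def shape_def)

lemma mem_cells_shape [simp]: "(i, j) \<in> cells (shape r mu) \<longleftrightarrow> i < r \<and> j < mu i"
  by (simp add: cells_shape)

lemma cells_shape_Sigma: "cells (shape r mu) = (SIGMA i:{..<r}. {..<mu i})"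
  by (auto simp: cells_shape)

lemma card_cells_shape: "card (cells (shape r mu)) = (\<Sum>i<r. mu i)"
  by (simp add: cells_shape_Sigma)

section \<open>Branching of semistandard tableaux\<close>

lemma down_closed_nat:
  fixes A :: "nat set"
  assumes "finite A" "\<And>a b. a \<in> A \<Longrightarrow> b < a \<Longrightarrow> b \<in> A"
  shows "A = {..<card A}"
proof (cases "A = {}")
  case False
  have "A = {..Max A}"
  proof
    show "A \<subseteq> {..Max A}" using assms(1) by auto
    show "{..Max A} \<subseteq> A"
      using assms Max_in[OF assms(1) False] by (metis atMost_iff le_neq_implies_less subsetI)
  qed
  then show ?thesis by (metis card_atMost lessThan_Suc_atMost)
qed simp

lemma content_split:
  assumes le: "\<And>i. i < r \<Longrightarrow> nu i \<le> mu i"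
    and N: "\<And>i j. i < r \<Longrightarrow> nu i \<le> j \<Longrightarrow> j < mu i \<Longrightarrow> T (i, j) = N"
    and nN: "\<And>i j. i < r \<Longrightarrow> j < nu i \<Longrightarrow> T (i, j) \<noteq> N"
  shows "image_mset T (mset_set (cells (shape r mu))) = B \<longleftrightarrow>
    image_mset T (mset_set (cells (shape r nu))) = filter_mset (\<lambda>x. x \<noteq> N) B \<and>
    (\<Sum>j<r. mu j - nu j) = count B N"
proof -
  let ?C = "cells (shape r mu)" and ?D = "cells (shape r nu)"
  have sub: "?D \<subseteq> ?C" using le by (fastforce simp: cells_shape)
  have "card (?C - ?D) = (\<Sum>i<r. mu i) - (\<Sum>i<r. nu i)"
    using sub by (simp add: card_Diff_subset card_cells_shape)
  also have "\<dots> = (\<Sum>j<r. mu j - nu j)"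
    using le by (intro sum_subtractf_nat[symmetric]) auto
  finally have card: "card (?C - ?D) = (\<Sum>j<r. mu j - nu j)" .
  have "image_mset T (mset_set (?C - ?D)) = image_mset (\<lambda>_. N) (mset_set (?C - ?D))"
    using N by (intro image_mset_cong) (auto simp: not_less)
  then have b: "image_mset T (mset_set (?C - ?D)) = replicate_mset (\<Sum>j<r. mu j - nu j) N"
    by (simp add: image_mset_const_eq card)
  have "mset_set ?C = mset_set ?D + mset_set (?C - ?D)"
    using sub mset_set_Union[of ?D "?C - ?D"] by (simp add: Un_absorb1)
  then have eq: "image_mset T (mset_set ?C) = image_mset T (mset_set ?D) + replicate_mset (\<Sum>j<r. mu j - nu j) N"
    using b by simp
  have nD: "N \<notin># image_mset T (mset_set ?D)" using nN by fastforce
  have f: "filter_mset (\<lambda>x. x \<noteq> N) (image_mset T (mset_set ?D)) = image_mset T (mset_set ?D)"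
    using nD by (auto simp: filter_mset_eq_conv)
  have c: "count (image_mset T (mset_set ?D)) N = 0" using nD by (simp only: not_in_iff)
  show ?thesis
  proof
    assume "image_mset T (mset_set ?C) = B"
    then have B: "B = image_mset T (mset_set ?D) + replicate_mset (\<Sum>j<r. mu j - nu j) N" using eq by simp
    have "filter_mset (\<lambda>x. x \<noteq> N) (replicate_mset k N) = {#}" for k by (induction k) auto
    then show "image_mset T (mset_set ?D) = filter_mset (\<lambda>x. x \<noteq> N) B \<and> (\<Sum>j<r. mu j - nu j) = count B N"
      unfolding B using f c by simp
  next
    assume a: "image_mset T (mset_set ?D) = filter_mset (\<lambda>x. x \<noteq> N) B \<and> (\<Sum>j<r. mu j - nu j) = count B N"
    have "B = filter_mset (\<lambda>x. x \<noteq> N) B + filter_mset (\<lambda>x. x = N) B"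
      using multiset_partition[of B "\<lambda>x. x \<noteq> N"] by simp
    then show "image_mset T (mset_set ?C) = B"
      unfolding eq using a by (simp add: filter_eq_replicate_mset)
  qed
qed

text \<open>The shapes left after removing a horizontal strip of \<open>b\<close> cells, the
  counterpart of \<open>interlacing\<close> on the side of tableaux.\<close>

definition branches :: "nat \<Rightarrow> (nat \<Rightarrow> nat) \<Rightarrow> nat \<Rightarrow> (nat \<Rightarrow> nat) set" where
  "branches r mu b = {nu \<in> {..<r} \<rightarrow>\<^sub>E UNIV. (\<forall>j<r. nu j \<le> mu j) \<and>
     (\<forall>j. Suc j < r \<longrightarrow> mu (Suc j) \<le> nu j) \<and> (\<Sum>j<r. mu j - nu j) = b}"

lemma finite_branches [simp]: "finite (branches r mu b)"
proof (rule finite_subset)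
  show "branches r mu b \<subseteq> (\<Pi>\<^sub>E j\<in>{..<r}. {..mu j})" by (auto simp: branches_def PiE_iff extensional_def)
  show "finite (\<Pi>\<^sub>E j\<in>{..<r}. {..mu j})" by (intro finite_PiE) auto
qed

lemma antimono_chain:
  fixes mu :: "nat \<Rightarrow> 'a :: order"
  assumes "\<And>j. Suc j < r \<Longrightarrow> mu (Suc j) \<le> mu j" "i \<le> i'" "i' < r"
  shows "mu i' \<le> mu i"
  using assms(2,3)
proof (induction i' rule: dec_induct)
  case (step k)
  then show ?case using assms(1)[of k] by (metis Suc_lessD order_trans)
qed simp

lemma ssyt_shapeD:
  assumes "T \<in> ssyt (shape r mu)"
  shows "\<And>i j j'. i < r \<Longrightarrow> j < j' \<Longrightarrow> j' < mu i \<Longrightarrow> T (i, j) \<le> T (i, j')"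
    and "\<And>i i' j. i < i' \<Longrightarrow> i' < r \<Longrightarrow> j < mu i \<Longrightarrow> j < mu i' \<Longrightarrow> T (i, j) < T (i', j)"
    and "\<And>i j. \<not> (i < r \<and> j < mu i) \<Longrightarrow> T (i, j) = undefined"
  using assms by (auto simp: ssyt_def cells_shape PiE_iff extensional_def)

lemma ssyt_shapeI:
  assumes "\<And>i j j'. i < r \<Longrightarrow> j < j' \<Longrightarrow> j' < mu i \<Longrightarrow> T (i, j) \<le> T (i, j')"
    and "\<And>i i' j. i < i' \<Longrightarrow> i' < r \<Longrightarrow> j < mu i \<Longrightarrow> j < mu i' \<Longrightarrow> T (i, j) < T (i', j)"
    and "\<And>i j. \<not> (i < r \<and> j < mu i) \<Longrightarrow> T (i, j) = undefined"
  shows "T \<in> ssyt (shape r mu)"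
  using assms by (auto simp: ssyt_def cells_shape PiE_iff extensional_def)

text \<open>Cells holding the largest possible letter \<open>N\<close> lie at the ends of rows, at
  most one in each column, so they form a horizontal strip; conversely, filling such a strip with
  \<open>N\<close> extends any tableau of the smaller shape.\<close>

lemma ssyt_count_branch:
  assumes anti: "\<And>j. Suc j < r \<Longrightarrow> mu (Suc j) \<le> mu j"
    and B: "set_mset B \<subseteq> {..N}"
  shows "ssyt_count (shape r mu) B
    = (\<Sum>nu\<in>branches r mu (count B N). ssyt_count (shape r nu) (filter_mset (\<lambda>x. x \<noteq> N) B))"
proof -
  let ?S = "\<lambda>mu B. {T \<in> ssyt (shape r mu). image_mset T (mset_set (cells (shape r mu))) = B}"
  let ?B = "filter_mset (\<lambda>x. x \<noteq> N) B"
  define rows where "rows = (\<lambda>T. \<lambda>i\<in>{..<r}. card {j. j < mu i \<and> T (i, j) < N})"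
  define ext where "ext = (\<lambda>(nu :: nat \<Rightarrow> nat, T'). \<lambda>(i, j). if i < r \<and> j < nu i then T' (i, j)
    else if i < r \<and> j < mu i then N else undefined)"
  have fwd: "rows T \<in> branches r mu (count B N) \<and> restrict T (cells (shape r (rows T))) \<in> ?S (rows T) ?B
      \<and> ext (rows T, restrict T (cells (shape r (rows T)))) = T" if T: "T \<in> ?S mu B" for T
  proof -
    let ?nu = "rows T"
    have Ts: "T \<in> ssyt (shape r mu)" and cont: "image_mset T (mset_set (cells (shape r mu))) = B"
      using T by auto
    note D = ssyt_shapeD[OF Ts]
    have leN: "T (i, j) \<le> N" if "i < r" "j < mu i" for i j
    proof -
      have "T (i, j) \<in># image_mset T (mset_set (cells (shape r mu)))"
        using that by (intro image_eqI[where x = "(i, j)", THEN in_image_mset[THEN iffD2]]) auto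
      then show ?thesis using cont B by auto
    qed
    have row: "T (i, j) < N \<longleftrightarrow> j < ?nu i" if "i < r" "j < mu i" for i j
    proof -
      have eq: "{j. j < mu i \<and> T (i, j) < N} = {..<card {j. j < mu i \<and> T (i, j) < N}}"
        using D(1)[OF that(1)] by (intro down_closed_nat) (auto intro: le_less_trans)
      show ?thesis using arg_cong[OF eq, of "\<lambda>A. j \<in> A"] that by (simp add: rows_def)
    qed
    have le: "?nu i \<le> mu i" if "i < r" for i
      using that card_mono[of "{..<mu i}" "{j. j < mu i \<and> T (i, j) < N}"] by (auto simp: rows_def)
    \<comment> \<open>Otherwise row \<open>j\<close> holds \<open>N\<close> in column
      \<open>?nu j\<close> and has a cell below it, against column strictness.\<close>
    have il: "mu (Suc j) \<le> ?nu j" if "Suc j < r" for j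
    proof (rule ccontr)
      assume n: "\<not> ?thesis"
      then have c: "?nu j < mu (Suc j)" "?nu j < mu j" using anti[OF that] by auto
      then have "T (j, ?nu j) < T (Suc j, ?nu j)" using that by (intro D(2)) auto
      also have "\<dots> \<le> N" using that c by (intro leN) auto
      finally show False using row[of j "?nu j"] c that by simp
    qed
    have spl: "image_mset T (mset_set (cells (shape r ?nu))) = ?B \<and> (\<Sum>j<r. mu j - ?nu j) = count B N"
    proof (rule content_split[THEN iffD1, OF _ _ _ cont])
      show "T (i, j) = N" if "i < r" "?nu i \<le> j" "j < mu i" for i j
        using row[OF that(1,3)] leN[OF that(1,3)] that(2) by auto
      show "T (i, j) \<noteq> N" if "i < r" "j < ?nu i" for i j
        using row[of i j] le[OF that(1)] that by auto
    qed (use le in auto)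
    have "?nu \<in> branches r mu (count B N)"
      using le il spl by (auto simp: branches_def rows_def)
    moreover have "restrict T (cells (shape r ?nu)) \<in> ssyt (shape r ?nu)"
    proof (rule ssyt_shapeI)
      show "restrict T (cells (shape r ?nu)) (i, j) \<le> restrict T (cells (shape r ?nu)) (i, j')"
        if "i < r" "j < j'" "j' < ?nu i" for i j j'
        using that D(1)[of i j j'] le[of i] by simp
      show "restrict T (cells (shape r ?nu)) (i, j) < restrict T (cells (shape r ?nu)) (i', j)"
        if "i < i'" "i' < r" "j < ?nu i" "j < ?nu i'" for i i' j
        using that D(2)[of i i' j] le[of i] le[of i'] by simp
      show "restrict T (cells (shape r ?nu)) (i, j) = undefined" if "\<not> (i < r \<and> j < ?nu i)" for i j
        using that by auto
    qed
    moreover have "image_mset (restrict T (cells (shape r ?nu))) (mset_set (cells (shape r ?nu)))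
        = image_mset T (mset_set (cells (shape r ?nu)))"
      by (intro image_mset_cong) simp
    moreover have "ext (?nu, restrict T (cells (shape r ?nu))) = T"
    proof
      fix c :: "nat \<times> nat"
      obtain i j where c: "c = (i, j)" by force
      show "ext (?nu, restrict T (cells (shape r ?nu))) c = T c"
        using row[of i j] leN[of i j] D(3)[of i j] le[of i] by (auto simp: ext_def c)
    qed
    ultimately show ?thesis using spl by simp
  qed
  have bwd: "ext (nu, T') \<in> ?S mu B \<and> rows (ext (nu, T')) = nu
      \<and> restrict (ext (nu, T')) (cells (shape r nu)) = T'"
    if nu: "nu \<in> branches r mu (count B N)" and T': "T' \<in> ?S nu ?B" for nu T'
  proof -
    let ?T = "ext (nu, T')"
    have Ts: "T' \<in> ssyt (shape r nu)" and cont: "image_mset T' (mset_set (cells (shape r nu))) = ?B"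
      using T' by auto
    note D = ssyt_shapeD[OF Ts]
    have le: "nu i \<le> mu i" if "i < r" for i using nu that by (simp add: branches_def)
    have il: "mu i' \<le> nu i" if "i < i'" "i' < r" for i i'
    proof -
      have "mu i' \<le> mu (Suc i)" by (rule antimono_chain[where mu = mu and r = r, OF anti]) (use that in auto)
      also have "\<dots> \<le> nu i" using that nu by (simp add: branches_def)
      finally show ?thesis .
    qed
    have lt: "T' (i, j) < N" if "i < r" "j < nu i" for i j
    proof -
      have "T' (i, j) \<in># image_mset T' (mset_set (cells (shape r nu)))"
        using that by (auto intro!: image_eqI[where x = "(i, j)"])
      then have "T' (i, j) \<in># B \<and> T' (i, j) \<noteq> N" using cont by simp
      then show ?thesis using B by (metis atMost_iff le_neq_implies_less subsetD)
    qed
    have "?T \<in> ssyt (shape r mu)"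
    proof (rule ssyt_shapeI)
      show "?T (i, j) \<le> ?T (i, j')" if "i < r" "j < j'" "j' < mu i" for i j j'
        using that D(1)[of i j j'] lt[of i j] by (auto simp: ext_def)
      show "?T (i, j) < ?T (i', j)" if "i < i'" "i' < r" "j < mu i" "j < mu i'" for i i' j
        using that D(2)[of i i' j] lt[of i j] il[of i i'] by (auto simp: ext_def)
      show "?T (i, j) = undefined" if "\<not> (i < r \<and> j < mu i)" for i j
        using that le[of i] by (auto simp: ext_def)
    qed
    moreover have "image_mset ?T (mset_set (cells (shape r mu))) = B"
    proof (rule content_split[THEN iffD2])
      show "?T (i, j) = N" if "i < r" "nu i \<le> j" "j < mu i" for i j using that by (auto simp: ext_def)
      show "?T (i, j) \<noteq> N" if "i < r" "j < nu i" for i j using that lt[of i j] by (auto simp: ext_def)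
      have "image_mset ?T (mset_set (cells (shape r nu))) = image_mset T' (mset_set (cells (shape r nu)))"
        by (intro image_mset_cong) (auto simp: ext_def)
      then show "image_mset ?T (mset_set (cells (shape r nu))) = ?B \<and> (\<Sum>j<r. mu j - nu j) = count B N"
        using cont nu by (simp add: branches_def)
    qed (use le in auto)
    moreover have "rows ?T i = nu i" for i
    proof (cases "i < r")
      case True
      have "{j. j < mu i \<and> ?T (i, j) < N} = {..<nu i}"
        using True le[OF True] lt[OF True] by (auto simp: ext_def)
      then show ?thesis using True by (simp add: rows_def)
    next
      case False
      then show ?thesis using nu by (simp add: rows_def branches_def PiE_iff extensional_def)
    qed
    then have "rows ?T = nu" by (rule ext)
    moreover have "restrict ?T (cells (shape r nu)) = T'"
      using D(3) by (auto simp: fun_eq_iff ext_def)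
    ultimately show ?thesis by simp
  qed
  have "bij_betw (\<lambda>T. (rows T, restrict T (cells (shape r (rows T))))) (?S mu B)
      (SIGMA nu:branches r mu (count B N). ?S nu ?B)"
    by (rule bij_betw_byWitness[where f' = ext]) (use fwd bwd in auto)
  then have "card (?S mu B) = card (SIGMA nu:branches r mu (count B N). ?S nu ?B)"
    by (rule bij_betw_same_card)
  also have "\<dots> = (\<Sum>nu\<in>branches r mu (count B N). card (?S nu ?B))"
    by (rule card_SigmaI) (auto intro: finite_ssyt_content_mset)
  finally show ?thesis by (simp add: ssyt_count_def)
qed

lemma tables_empty: "tables A {#} = (if A = {#} then {{#}} else {})"
  by (auto simp: tables_def)

text \<open>Both sides obey the same recursion on the largest letter, with \<open>branches\<close>
  on the left and \<open>interlacing\<close> on the right, matched by \<open>m j = nu j - j\<close>.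
  Without letters only the empty shape and the identity permutation contribute.\<close>

theorem jacobi_trudi:
  assumes anti: "\<And>j. Suc j < r \<Longrightarrow> mu (Suc j) \<le> mu j"
    and B: "set_mset B \<subseteq> {..<N}"
  shows "int (ssyt_count (shape r mu) B) = jt_sum r (\<lambda>j. int (mu j) - int j) B"
  using assms
proof (induction N arbitrary: mu B)
  case 0
  then have B: "B = {#}" by simp
  have tc: "table_count r k {#} = (if \<forall>j<r. k j = 0 then 1 else 0)" for k
  proof -
    have "vec_mset r k = {#} \<longleftrightarrow> (\<forall>j<r. k j \<le> 0)"
      by (auto simp: multiset_eq_iff count_vec_mset)
    moreover have "(\<forall>j<r. k j = 0) \<longleftrightarrow> (\<forall>j<r. k j \<le> 0) \<and> (\<forall>j<r. k j \<ge> 0)"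
      by (auto intro: order_antisym)
    ultimately show ?thesis unfolding table_count_def tables_empty by simp
  qed
  show ?case
  proof (cases "\<forall>j<r. mu j = 0")
    case True
    then have c: "cells (shape r mu) = {}" by (auto simp: cells_shape)
    then have "{T \<in> ssyt (shape r mu). image_mset T (mset_set (cells (shape r mu))) = B} = {\<lambda>_. undefined}"
      by (auto simp: ssyt_def B)
    then have l: "ssyt_count (shape r mu) B = 1" by (simp add: ssyt_count_def)
    have "(\<forall>j<r. int (mu j) - int j + int (s j) = 0) \<longleftrightarrow> s = id" if "s \<in> perms r" for s
    proof
      assume a: "\<forall>j<r. int (mu j) - int j + int (s j) = 0"
      show "s = id"
      proof
        fix j show "s j = id j"
          using a True that permutes_not_in[of s "{..<r}" j] by (cases "j < r") auto
      qed
    qed (use True in auto)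
    then have "jt_sum r (\<lambda>j. int (mu j) - int j) B = (\<Sum>s\<in>perms r. if s = id then 1 else 0)"
      unfolding jt_sum_def B tc by (intro sum.cong) auto
    then show ?thesis using l by simp
  next
    case False
    then obtain i where i: "i < r" "mu i \<noteq> 0" by auto
    then have "(i, 0) \<in> cells (shape r mu)" by (auto simp: cells_shape)
    then have "cells (shape r mu) \<noteq> {}" by blast
    then have l: "ssyt_count (shape r mu) B = 0" by (simp add: ssyt_count_def B mset_set_empty_iff)
    have "\<not> (\<forall>j<r. int (mu j) - int j + int (s j) = 0)" if s: "s \<in> perms r" for s
    proof
      assume a: "\<forall>j<r. int (mu j) - int j + int (s j) = 0"
      \<comment> \<open>The equations say \<open>mu j + s j = j\<close>; a permutation with
        \<open>s j \<le> j\<close> everywhere is the identity, and then all \<open>mu j\<close>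
        vanish.\<close>
      have "\<forall>j\<in>{..<r}. s j \<le> j" using a by force
      then have "s = id" using permutes_natset_le[of s "{..<r}"] s by simp
      then show False using a i by auto
    qed
    then have "jt_sum r (\<lambda>j. int (mu j) - int j) B = 0"
      unfolding jt_sum_def B tc by (intro sum.neutral) auto
    then show ?thesis using l by simp
  qed
next
  case (Suc N)
  let ?B = "filter_mset (\<lambda>x. x \<noteq> N) B" and ?l = "\<lambda>j. int (mu j) - int j"
  let ?I = "interlacing r ?l (count B N)"
  let ?nu = "\<lambda>m. \<lambda>j\<in>{..<r}. nat (m j + int j)" and ?m = "\<lambda>nu. \<lambda>j\<in>{..<r}. int (nu j) - int j"
  have B: "set_mset B \<subseteq> {..N}" "set_mset ?B \<subseteq> {..<N}" using Suc.prems(2) by fastforce+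
  have antinu: "nu (Suc j) \<le> nu j" if "nu \<in> branches r mu (count B N)" "Suc j < r" for nu j
    using that by (auto simp: branches_def intro: order_trans)
  have "int (ssyt_count (shape r mu) B) = (\<Sum>nu\<in>branches r mu (count B N). jt_sum r (?m nu) ?B)"
  proof -
    have "int (ssyt_count (shape r nu) ?B) = jt_sum r (?m nu) ?B" if "nu \<in> branches r mu (count B N)" for nu
    proof -
      have "int (ssyt_count (shape r nu) ?B) = jt_sum r (\<lambda>j. int (nu j) - int j) ?B"
        using antinu[OF that] B(2) by (rule Suc.IH)
      also have "\<dots> = jt_sum r (?m nu) ?B"
        unfolding jt_sum_def by (intro sum.cong refl arg_cong2[where f = "(*)"] table_count_cong) auto
      finally show ?thesis .
    qed
    then show ?thesis by (simp add: ssyt_count_branch[where mu = mu and r = r, OF Suc.prems(1) B(1)])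
  qed
  also have "\<dots> = (\<Sum>m\<in>{m \<in> ?I. \<forall>j<r. m j + int j \<ge> 0}. jt_sum r m ?B)"
  proof (rule sum.reindex_bij_witness[where i = ?nu and j = ?m])
    fix nu assume nu: "nu \<in> branches r mu (count B N)"
    show "?nu (?m nu) = nu" using nu by (auto simp: branches_def fun_eq_iff PiE_iff extensional_def)
    have "(\<Sum>j<r. ?l j - ?m nu j) = (\<Sum>j<r. int (mu j - nu j))"
      using nu by (intro sum.cong) (auto simp: branches_def)
    also have "\<dots> = int (\<Sum>j<r. mu j - nu j)" by (simp only: of_nat_sum)
    also have "\<dots> = int (count B N)" using nu by (simp add: branches_def del: of_nat_sum)
    finally show "?m nu \<in> {m \<in> ?I. \<forall>j<r. m j + int j \<ge> 0}"
      using nu by (auto simp: branches_def interlacing_def below_def)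
  next
    fix m assume m: "m \<in> {m \<in> ?I. \<forall>j<r. m j + int j \<ge> 0}"
    show "?m (?nu m) = m"
      using m by (auto simp: interlacing_def below_def fun_eq_iff PiE_iff extensional_def)
    have le: "nat (m j + int j) \<le> mu j" if "j < r" for j
      using m that by (auto simp: interlacing_def below_def algebra_simps)
    have "int (\<Sum>j<r. mu j - ?nu m j) = (\<Sum>j<r. ?l j - m j)"
      unfolding of_nat_sum using m le by (intro sum.cong) (auto simp: of_nat_diff)
    also have "\<dots> = int (count B N)" using m by (simp add: interlacing_def below_def)
    finally have "(\<Sum>j<r. mu j - ?nu m j) = count B N" by linarith
    moreover have "mu (Suc j) \<le> ?nu m j" if "Suc j < r" for j
    proof -
      have "int (mu (Suc j)) - int (Suc j) < m j" using m that by (auto simp: interlacing_def)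
      then show ?thesis using that by simp
    qed
    ultimately show "?nu m \<in> branches r mu (count B N)" using le by (simp add: branches_def)
  qed simp
  also have "\<dots> = (\<Sum>m\<in>?I. jt_sum r m ?B)"
  proof (rule sum.mono_neutral_left)
    show "\<forall>m\<in>?I - {m \<in> ?I. \<forall>j<r. m j + int j \<ge> 0}. jt_sum r m ?B = 0"
    proof
      fix m assume m: "m \<in> ?I - {m \<in> ?I. \<forall>j<r. m j + int j \<ge> 0}"
      then obtain j where j: "j < r" "m j + int j < 0" by force
      \<comment> \<open>Interlacing bounds \<open>m j + j\<close> below by \<open>mu (j + 1)\<close>
        except in the last row. A negative value can therefore occur only there, and then the last
        row of the determinant is zero.\<close>
      have "Suc j = r"
      proof (rule ccontr)
        assume "Suc j \<noteq> r"
        then have "int (mu (Suc j)) - int (Suc j) < m j" using m j by (auto simp: interlacing_def)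
        then show False using j by linarith
      qed
      then show "jt_sum r m ?B = 0" using j by (intro jt_eq_0[of j]) auto
    qed
  qed (auto simp: interlacing_def)
  also have "\<dots> = jt_sum r ?l B"
    by (rule jt_interlacing[symmetric]) (use Suc.prems(1) in force)
  finally show ?case .
qed

section \<open>Jacobi-Trudi characters\<close>

definition part_at :: "nat list \<Rightarrow> nat \<Rightarrow> nat" where
  "part_at \<mu> i = (if i < length \<mu> then \<mu> ! i else 0)"

definition fixed_vec :: "nat \<Rightarrow> (nat \<Rightarrow> int) \<Rightarrow> (nat \<Rightarrow> nat) \<Rightarrow> int" where
  "fixed_vec n k w = (if \<forall>j<n. k j \<ge> 0 then int (fixed_words n (vec_mset n k) w) else 0)"

text \<open>The Jacobi-Trudi determinant with permutation characters in place of the functions h;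
  classically the irreducible character of \<open>\<mu>\<close>. Since a partition of
  \<open>n\<close> has at most \<open>n\<close> parts, size \<open>n\<close> with zero padding
  serves all \<open>\<mu>\<close> at once.\<close>

definition schur_char :: "nat \<Rightarrow> nat list \<Rightarrow> (nat \<Rightarrow> nat) \<Rightarrow> int" where
  "schur_char n \<mu> w = (\<Sum>s\<in>perms n. sign s * fixed_vec n (\<lambda>j. int (part_at \<mu> j) - int j + int (s j)) w)"

lemma length_le_sum_list: "(\<forall>k\<in>set \<mu>. k > (0::nat)) \<Longrightarrow> length \<mu> \<le> sum_list \<mu>"
  by (induction \<mu>) auto

lemma partitions_ofD:
  assumes "\<mu> \<in> partitions_of n"
  shows "length \<mu> \<le> n" "sum_list \<mu> = n" "\<And>i. i < length \<mu> \<Longrightarrow> \<mu> ! i > 0"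
    "\<And>i j. i \<le> j \<Longrightarrow> part_at \<mu> j \<le> part_at \<mu> i" "(\<Sum>j<n. part_at \<mu> j) = n"
    "\<And>k. n \<le> k \<Longrightarrow> (\<Sum>j<k. part_at \<mu> j) = n"
proof -
  have mu: "sorted_wrt (\<ge>) \<mu>" "\<forall>k\<in>set \<mu>. k > 0" "sum_list \<mu> = n"
    using assms by (auto simp: partitions_of_def)
  show l: "length \<mu> \<le> n" using length_le_sum_list mu by blast
  show "sum_list \<mu> = n" by fact
  show "\<mu> ! i > 0" if "i < length \<mu>" for i using mu(2) that by simp
  show "part_at \<mu> j \<le> part_at \<mu> i" if "i \<le> j" for i j
    using sorted_wrt_nth_less[OF mu(1), of i j] that by (cases "i = j") (auto simp: part_at_def)
  show *: "(\<Sum>j<k. part_at \<mu> j) = n" if "n \<le> k" for k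
  proof -
    have "(\<Sum>j<k. part_at \<mu> j) = (\<Sum>j<length \<mu>. part_at \<mu> j)"
      using l that by (intro sum.mono_neutral_right) (auto simp: part_at_def)
    also have "\<dots> = sum_list \<mu>" by (simp add: part_at_def sum_list_sum_nth atLeast0LessThan)
    finally show ?thesis using mu(3) by simp
  qed
  then show "(\<Sum>j<n. part_at \<mu> j) = n" by simp
qed

lemma partitions_of_eqI:
  assumes "\<mu> \<in> partitions_of n" "\<nu> \<in> partitions_of n" "\<And>j. j < n \<Longrightarrow> part_at \<mu> j = part_at \<nu> j"
  shows "\<mu> = \<nu>"
proof -
  have "length \<mu> \<le> length \<nu>" if "\<mu> \<in> partitions_of n" "\<nu> \<in> partitions_of n" "\<And>j. j < n \<Longrightarrow> part_at \<mu> j = part_at \<nu> j" for \<mu> \<nu>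
  proof (rule ccontr)
    assume "\<not> ?thesis"
    then have l: "length \<nu> < length \<mu>" by simp
    then have "length \<nu> < n" using partitions_ofD(1)[OF that(1)] by simp
    then show False using that(3)[of "length \<nu>"] partitions_ofD(3)[OF that(1) l] l by (simp add: part_at_def)
  qed
  then have l: "length \<mu> = length \<nu>" using assms by (metis order_antisym)
  then show ?thesis
  proof (rule nth_equalityI)
    show "\<mu> ! i = \<nu> ! i" if "i < length \<mu>" for i
      using assms(3)[of i] partitions_ofD(1)[OF assms(1)] l that by (simp add: part_at_def)
  qed
qed

lemma cells_part_at:
  assumes "\<mu> \<in> partitions_of n" shows "cells (shape n (part_at \<mu>)) = cells \<mu>"
  using partitions_ofD(1)[OF assms] unfolding cells_shape by (auto simp: cells_def part_at_def split: if_splits)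

lemma ssyt_part_at: "\<mu> \<in> partitions_of n \<Longrightarrow> ssyt (shape n (part_at \<mu>)) = ssyt \<mu>"
  by (simp add: ssyt_def cells_part_at)

lemma ssyt_count_part_at: "\<mu> \<in> partitions_of n \<Longrightarrow> ssyt_count (shape n (part_at \<mu>)) B = ssyt_count \<mu> B"
  by (simp add: ssyt_count_def ssyt_part_at cells_part_at)

lemma card_cells_partition: "\<mu> \<in> partitions_of n \<Longrightarrow> card (cells \<mu>) = n"
  using card_cells_shape[of n "part_at \<mu>"] cells_part_at[of \<mu> n] partitions_ofD(5)[of \<mu> n] by simp

lemma fixed_vec_neg: "\<not> (\<forall>j<n. k j \<ge> 0) \<Longrightarrow> fixed_vec n k w = 0"
  unfolding fixed_vec_def by (rule if_not_P)

lemma sum_fixed_vec_nonzero: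
  assumes "(\<Sum>w\<in>perms n. X w * fixed_vec n k w) \<noteq> 0"
  shows "\<forall>j<n. k j \<ge> 0" "(\<Sum>w\<in>perms n. X w * int (fixed_words n (vec_mset n k) w)) \<noteq> 0"
proof -
  show *: "\<forall>j<n. k j \<ge> 0" using assms fixed_vec_neg[of n k] by (metis (no_types, lifting) mult_zero_right sum.neutral)
  then have "fixed_vec n k w = int (fixed_words n (vec_mset n k) w)" for w
    unfolding fixed_vec_def by (rule if_P)
  then show "(\<Sum>w\<in>perms n. X w * int (fixed_words n (vec_mset n k) w)) \<noteq> 0" using assms by simp
qed

lemma sum_fixed_vec:
  assumes "size B = n"
  shows "(\<Sum>w\<in>perms n. fixed_vec n k w * int (fixed_words n B w)) = fact n * table_count n k B"
proof (cases "\<forall>j<n. k j \<ge> 0")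
  case True
  have "(\<Sum>w\<in>perms n. fixed_words n (vec_mset n k) w * fixed_words n B w) = fact n * card (tables (vec_mset n k) B)"
  proof (cases "size (vec_mset n k) = n")
    case False
    then have "tables (vec_mset n k) B = {}"
      using assms by (auto simp: tables_def dest: arg_cong[of _ _ size])
    then show ?thesis using False by (simp add: fixed_words_eq_0)
  qed (rule sum_fixed_words_product)
  then have "int (\<Sum>w\<in>perms n. fixed_words n (vec_mset n k) w * fixed_words n B w) = int (fact n * card (tables (vec_mset n k) B))"
    by simp
  then show ?thesis using True by (simp add: fixed_vec_def table_count_def)
next
  case False
  then have "table_count n k B = 0" unfolding table_count_def by (rule if_not_P)
  then show ?thesis using fixed_vec_neg[OF False] by simp
qed

text \<open>Pairings of permutation characters count tables, so by linearity the pairing is a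
  \<open>jt_sum\<close>, which \<open>jacobi_trudi\<close> turns into a Kostka number.\<close>

lemma sum_schur_char_fixed_words:
  assumes \<mu>: "\<mu> \<in> partitions_of n" and B: "size B = n"
  shows "(\<Sum>w\<in>perms n. schur_char n \<mu> w * int (fixed_words n B w)) = fact n * int (ssyt_count \<mu> B)"
proof -
  obtain N where N: "set_mset B \<subseteq> {..<N}"
    using finite_nat_bounded[of "set_mset B"] by blast
  have "(\<Sum>w\<in>perms n. schur_char n \<mu> w * int (fixed_words n B w))
     = (\<Sum>s\<in>perms n. \<Sum>w\<in>perms n. sign s * (fixed_vec n (\<lambda>j. int (part_at \<mu> j) - int j + int (s j)) w * int (fixed_words n B w)))"
    unfolding schur_char_def sum_distrib_right by (subst sum.swap) (simp add: mult.assoc)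
  also have "\<dots> = fact n * jt_sum n (\<lambda>j. int (part_at \<mu> j) - int j) B"
    by (simp add: jt_sum_def sum_fixed_vec[OF B] sum_distrib_left mult.left_commute flip: sum_distrib_left)
  also have "jt_sum n (\<lambda>j. int (part_at \<mu> j) - int j) B = int (ssyt_count (shape n (part_at \<mu>)) B)"
    by (rule jacobi_trudi[symmetric, OF _ N]) (rule partitions_ofD(4)[OF \<mu>], simp)
  finally show ?thesis using ssyt_count_part_at[OF \<mu>] by simp
qed

section \<open>Dominance and orthonormality\<close>

lemma sum_card_le_sum:
  fixes A :: "nat set"
  assumes "finite A" shows "(\<Sum>j<card A. j) \<le> \<Sum>A"
  using assms
proof (induction "card A" arbitrary: A)
  case (Suc k)
  then have ne: "A \<noteq> {}" by auto
  define M where "M = Max A"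
  have M: "M \<in> A" using Suc.prems ne by (simp add: M_def)
  have c: "card (A - {M}) = k" using Suc.hyps(2) M Suc.prems by simp
  have "A \<subseteq> {..M}" using Suc.prems by (auto simp: M_def)
  then have "card A \<le> card {..M}" by (intro card_mono) auto
  then have "k \<le> M" using Suc.hyps(2) by simp
  moreover have "(\<Sum>j<k. j) \<le> \<Sum>(A - {M})" using Suc.hyps(1)[of "A - {M}"] c Suc.prems by simp
  moreover have "\<Sum>A = M + \<Sum>(A - {M})" using M Suc.prems by (simp add: sum.remove)
  ultimately show ?case by (simp flip: Suc.hyps(2))
qed simp

text \<open>The values are distinct. Consequently the weight \<open>\<nu> j - j + s j\<close> of
  each term of a Jacobi-Trudi determinant dominates \<open>\<nu>\<close>, with equality only for
  \<open>s = id\<close> by \<open>perm_eq_id_if_sums\<close>.\<close>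

lemma sum_perm_ge:
  assumes "s \<in> perms n" shows "(\<Sum>j<k. j) \<le> (\<Sum>j<k. s j)"
proof -
  have inj: "inj_on s {..<k}" using assms permutes_inj inj_on_subset by blast
  have "(\<Sum>j<card (s ` {..<k}). j) \<le> \<Sum>(s ` {..<k})" by (rule sum_card_le_sum) simp
  then show ?thesis using inj by (simp add: card_image sum.reindex)
qed

lemma perm_eq_id_if_sums:
  assumes "s \<in> perms n" "\<And>k. k \<le> n \<Longrightarrow> (\<Sum>j<k. s j) \<le> (\<Sum>j<k. j)"
  shows "s = id"
proof
  fix j
  have eq: "(\<Sum>j<k. s j) = (\<Sum>j<k. j)" if "k \<le> n" for k
    using sum_perm_ge[OF assms(1), of k] assms(2)[OF that] by simp
  show "s j = id j"
  proof (cases "j < n")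
    case True
    then show ?thesis using eq[of "Suc j"] eq[of j] by simp
  next
    case False
    then show ?thesis using permutes_not_in[of s "{..<n}" j] assms(1) by simp
  qed
qed

lemma size_filter_vec_mset:
  assumes "k \<le> n" shows "size (filter_mset (\<lambda>x. x < k) (vec_mset n v)) = (\<Sum>j<k. nat (v j))"
proof -
  have "filter_mset (\<lambda>x. x < k) (vec_mset n v) = vec_mset k v"
    using assms by (intro multiset_eqI) (auto simp: count_vec_mset)
  then show ?thesis by (simp add: size_vec_mset)
qed

text \<open>Dominance order of weights, phrased so that a weight is a multiset of letters.\<close>

definition dominated :: "nat multiset \<Rightarrow> nat list \<Rightarrow> bool" where
  "dominated B \<mu> \<longleftrightarrow> (\<forall>k. size (filter_mset (\<lambda>x. x < k) B) \<le> (\<Sum>j<k. part_at \<mu> j))"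

definition dominance :: "nat \<Rightarrow> nat list \<Rightarrow> nat list \<Rightarrow> bool" where
  "dominance n \<nu> \<mu> \<longleftrightarrow> (\<forall>k\<le>n. (\<Sum>j<k. part_at \<nu> j) \<le> (\<Sum>j<k. part_at \<mu> j))"

lemma dominance_antisym:
  assumes "dominance n \<nu> \<mu>" "dominance n \<mu> \<nu>" "\<mu> \<in> partitions_of n" "\<nu> \<in> partitions_of n"
  shows "\<mu> = \<nu>"
proof (rule partitions_of_eqI[OF assms(3,4)])
  fix j assume j: "j < n"
  have eq: "(\<Sum>j<k. part_at \<mu> j) = (\<Sum>j<k. part_at \<nu> j)" if "k \<le> n" for k
    using assms(1,2) that unfolding dominance_def by (metis order_antisym)
  show "part_at \<mu> j = part_at \<nu> j" using eq[of "Suc j"] eq[of j] j by simp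
qed

lemma shifted_dominated:
  assumes \<nu>: "\<nu> \<in> partitions_of n" and s: "s \<in> perms n"
    and pos: "\<And>j. j < n \<Longrightarrow> int (part_at \<nu> j) - int j + int (s j) \<ge> 0"
    and d: "dominated (vec_mset n (\<lambda>j. int (part_at \<nu> j) - int j + int (s j))) \<mu>" and k: "k \<le> n"
  shows "(\<Sum>j<k. part_at \<nu> j) + (\<Sum>j<k. s j) \<le> (\<Sum>j<k. part_at \<mu> j) + (\<Sum>j<k. j)"
proof -
  have "(\<Sum>j<k. nat (int (part_at \<nu> j) - int j + int (s j))) \<le> (\<Sum>j<k. part_at \<mu> j)"
    using d k size_filter_vec_mset[OF k] unfolding dominated_def by metis
  then have "int (\<Sum>j<k. nat (int (part_at \<nu> j) - int j + int (s j))) \<le> int (\<Sum>j<k. part_at \<mu> j)" by linarith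
  moreover have "int (\<Sum>j<k. nat (int (part_at \<nu> j) - int j + int (s j))) = (\<Sum>j<k. int (part_at \<nu> j) - int j + int (s j))"
    unfolding of_nat_sum using pos k by (intro sum.cong) auto
  ultimately have "(\<Sum>j<k. int (part_at \<nu> j)) + (\<Sum>j<k. int (s j)) \<le> (\<Sum>j<k. int (part_at \<mu> j)) + (\<Sum>j<k. int j)"
    by (simp add: sum.distrib sum_subtractf)
  then show ?thesis by (simp flip: of_nat_sum of_nat_add)
qed

lemma size_shifted:
  assumes \<nu>: "\<nu> \<in> partitions_of n" and s: "s \<in> perms n"
    and pos: "\<And>j. j < n \<Longrightarrow> int (part_at \<nu> j) - int j + int (s j) \<ge> 0"
  shows "size (vec_mset n (\<lambda>j. int (part_at \<nu> j) - int j + int (s j))) = n"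
proof -
  have "(\<Sum>j<n. int (s j)) = (\<Sum>j<n. int j)"
    using sum.permute[of s "{..<n}" int] s by (simp add: comp_def)
  then have "(\<Sum>j<n. int (part_at \<nu> j) - int j + int (s j)) = int (\<Sum>j<n. part_at \<nu> j)"
    by (simp add: sum.distrib sum_subtractf)
  moreover have "int (size (vec_mset n (\<lambda>j. int (part_at \<nu> j) - int j + int (s j)))) = (\<Sum>j<n. int (part_at \<nu> j) - int j + int (s j))"
    unfolding size_vec_mset of_nat_sum using pos by (intro sum.cong) auto
  ultimately show ?thesis using partitions_ofD(5)[OF \<nu>] by simp
qed

text \<open>Some term of the determinant pairs nontrivially with \<open>X\<close>; its weight is
  dominated by \<open>\<mu>\<close> by assumption and dominates \<open>\<nu>\<close> by
  \<open>sum_perm_ge\<close>. The general \<open>X\<close> allows both \<open>schur_char\<close> and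
  \<open>young_char\<close>.\<close>

lemma pairing_schur_char_nonzero:
  fixes X :: "(nat \<Rightarrow> nat) \<Rightarrow> int"
  assumes tri: "\<And>B. size B = n \<Longrightarrow> (\<Sum>w\<in>perms n. X w * int (fixed_words n B w)) \<noteq> 0 \<Longrightarrow> dominated B \<mu>"
    and \<nu>: "\<nu> \<in> partitions_of n"
    and nz: "(\<Sum>w\<in>perms n. X w * schur_char n \<nu> w) \<noteq> 0"
  shows "dominance n \<nu> \<mu>"
proof -
  let ?k = "\<lambda>s j. int (part_at \<nu> j) - int j + int (s j)"
  have "(\<Sum>w\<in>perms n. X w * schur_char n \<nu> w) = (\<Sum>s\<in>perms n. sign s * (\<Sum>w\<in>perms n. X w * fixed_vec n (?k s) w))"
    unfolding schur_char_def sum_distrib_left by (subst sum.swap) (simp add: mult.left_commute)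
  then obtain s where s: "s \<in> perms n" and nz0: "(\<Sum>w\<in>perms n. X w * fixed_vec n (?k s) w) \<noteq> 0"
    using nz by (metis (mono_tags, lifting) mult_zero_right sum.neutral)
  note nz' = sum_fixed_vec_nonzero[OF nz0]
  have pos: "\<And>j. j < n \<Longrightarrow> ?k s j \<ge> 0" using nz'(1) by blast
  have "dominated (vec_mset n (?k s)) \<mu>"
    using size_shifted[OF \<nu> s pos] nz'(2) by (rule tri)
  then have d: "(\<Sum>j<k. part_at \<nu> j) + (\<Sum>j<k. s j) \<le> (\<Sum>j<k. part_at \<mu> j) + (\<Sum>j<k. j)" if "k \<le> n" for k
    using shifted_dominated[OF \<nu> s pos, of \<mu> k] that by simp
  show ?thesis
    unfolding dominance_def
  proof (intro allI impI)
    show "(\<Sum>j<k. part_at \<nu> j) \<le> (\<Sum>j<k. part_at \<mu> j)" if "k \<le> n" for k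
      using d[OF that] sum_perm_ge[OF s, of k] by linarith
  qed
qed

lemma ssyt_entry_ge:
  assumes "T \<in> ssyt (shape r mu)" "\<And>i j. i \<le> j \<Longrightarrow> j < r \<Longrightarrow> mu j \<le> mu i" "i < r" "j < mu i"
  shows "i \<le> T (i, j)"
  using assms(3,4)
proof (induction i)
  case (Suc i)
  then have "mu (Suc i) \<le> mu i" using assms(2) by simp
  then have "T (i, j) < T (Suc i, j)" "i \<le> T (i, j)"
    using Suc ssyt_shapeD(2)[OF assms(1), of i "Suc i" j] by auto
  then show ?case by simp
qed simp

text \<open>Columns increase strictly from at least 0, so letters below \<open>k\<close> occur only
  in the first \<open>k\<close> rows.\<close>

lemma ssyt_count_nonzero_dominated:
  assumes \<mu>: "\<mu> \<in> partitions_of n" and nz: "ssyt_count \<mu> B \<noteq> 0"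
  shows "dominated B \<mu>"
  unfolding dominated_def
proof
  fix k
  have "{T \<in> ssyt (shape n (part_at \<mu>)). image_mset T (mset_set (cells (shape n (part_at \<mu>)))) = B} \<noteq> {}"
    using nz unfolding ssyt_count_part_at[OF \<mu>, symmetric] unfolding ssyt_count_def by (metis (no_types, lifting) card.empty)
  then obtain T where T: "T \<in> ssyt (shape n (part_at \<mu>))" and B: "B = image_mset T (mset_set (cells (shape n (part_at \<mu>))))"
    by blast
  let ?C = "cells (shape n (part_at \<mu>))"
  have "size (filter_mset (\<lambda>x. x < k) B) = card {c \<in> ?C. T c < k}"
    unfolding B filter_image_mset by (simp add: filter_mset_mset_set)
  also have "\<dots> \<le> card (cells (shape (min k n) (part_at \<mu>)))"
  proof (rule card_mono)
    show "{c \<in> ?C. T c < k} \<subseteq> cells (shape (min k n) (part_at \<mu>))"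
    proof
      fix c assume "c \<in> {c \<in> ?C. T c < k}"
      moreover obtain i j where "c = (i, j)" by force
      ultimately show "c \<in> cells (shape (min k n) (part_at \<mu>))"
        using ssyt_entry_ge[OF T, of i j] partitions_ofD(4)[OF \<mu>] by simp
    qed
  qed simp
  also have "\<dots> \<le> (\<Sum>j<k. part_at \<mu> j)"
    unfolding card_cells_shape by (rule sum_mono2) auto
  finally show "size (filter_mset (\<lambda>x. x < k) B) \<le> (\<Sum>j<k. part_at \<mu> j)" .
qed

lemma image_mset_fst_cells:
  "image_mset fst (mset_set (cells (shape n mu))) = vec_mset n (\<lambda>j. int (mu j))"
proof (rule multiset_eqI)
  fix i
  have "count (image_mset fst (mset_set (cells (shape n mu)))) i = card {c \<in> cells (shape n mu). fst c = i}"
    by (simp add: count_image_mset_eq_card_vimage vimage_def Int_def conj_commute)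
  also have "{c \<in> cells (shape n mu). fst c = i} = (if i < n then Pair i ` {..<mu i} else {})"
    by auto
  finally show "count (image_mset fst (mset_set (cells (shape n mu)))) i = count (vec_mset n (\<lambda>j. int (mu j))) i"
    by (simp add: count_vec_mset card_image inj_on_def split: if_splits)
qed

text \<open>Every entry is at least its row index, and equality of the total sums forces equality in
  each cell.\<close>

lemma ssyt_count_own_weight:
  assumes \<mu>: "\<mu> \<in> partitions_of n"
  shows "ssyt_count \<mu> (vec_mset n (\<lambda>j. int (part_at \<mu> j))) = 1"
proof -
  let ?C = "cells (shape n (part_at \<mu>))" and ?B = "vec_mset n (\<lambda>j. int (part_at \<mu> j))"
  note fstB = image_mset_fst_cells[of n "part_at \<mu>"]
  have "{T \<in> ssyt (shape n (part_at \<mu>)). image_mset T (mset_set ?C) = ?B} = {restrict fst ?C}"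
  proof (intro equalityI subsetI)
    fix T assume "T \<in> {T \<in> ssyt (shape n (part_at \<mu>)). image_mset T (mset_set ?C) = ?B}"
    then have T: "T \<in> ssyt (shape n (part_at \<mu>))" and B: "image_mset T (mset_set ?C) = ?B" by auto
    have ge: "fst c \<le> T c" if "c \<in> ?C" for c
      using that ssyt_entry_ge[OF T] partitions_ofD(4)[OF \<mu>] by (cases c) auto
    have "sum T ?C = sum_mset (image_mset T (mset_set ?C))" by (simp add: sum_unfold_sum_mset)
    also have "\<dots> = sum fst ?C" unfolding B fstB[symmetric] by (simp add: sum_unfold_sum_mset)
    finally have "T c = fst c" if "c \<in> ?C" for c
      using sum_mono_inv[of fst ?C T c] ge that by simp
    then show "T \<in> {restrict fst ?C}" using ssyt_shapeD(3)[OF T] by (auto simp: fun_eq_iff)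
  next
    fix T assume T: "T \<in> {restrict fst ?C}"
    have "T \<in> ssyt (shape n (part_at \<mu>))" by (rule ssyt_shapeI) (use T in auto)
    moreover have "image_mset T (mset_set ?C) = image_mset fst (mset_set ?C)"
      using T by (intro image_mset_cong) auto
    ultimately show "T \<in> {T \<in> ssyt (shape n (part_at \<mu>)). image_mset T (mset_set ?C) = ?B}"
      using fstB by simp
  qed
  then have "ssyt_count (shape n (part_at \<mu>)) ?B = 1" unfolding ssyt_count_def by simp
  then show ?thesis by (simp only: ssyt_count_part_at[OF \<mu>])
qed

text \<open>For distinct partitions a nonzero pairing would give dominance in both directions. For
  equal ones a term of the second determinant contributes only if its weight is dominated by
  \<open>\<mu>\<close>, which forces \<open>s = id\<close> and leaves the Kostka number 1.\<close>

theorem schur_char_orthonormal: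
  assumes \<mu>: "\<mu> \<in> partitions_of n" and \<nu>: "\<nu> \<in> partitions_of n"
  shows "(\<Sum>w\<in>perms n. schur_char n \<mu> w * schur_char n \<nu> w) = (if \<mu> = \<nu> then fact n else 0)"
proof (cases "\<mu> = \<nu>")
  case False
  have tri: "dominated B \<mu>" if "\<mu> \<in> partitions_of n" "size B = n"
    "(\<Sum>w\<in>perms n. schur_char n \<mu> w * int (fixed_words n B w)) \<noteq> 0" for \<mu> B
    using that sum_schur_char_fixed_words[OF that(1,2)] ssyt_count_nonzero_dominated by auto
  have "(\<Sum>w\<in>perms n. schur_char n \<mu> w * schur_char n \<nu> w) = 0"
  proof (rule ccontr)
    assume nz: "\<not> ?thesis"
    have "dominance n \<nu> \<mu>"
      by (rule pairing_schur_char_nonzero[where X = "schur_char n \<mu>", OF tri[OF \<mu>] \<nu> nz])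
    moreover have "dominance n \<mu> \<nu>"
      using nz by (intro pairing_schur_char_nonzero[where X = "schur_char n \<nu>", OF tri[OF \<nu>] \<mu>]) (simp_all add: mult.commute)
    ultimately show False using dominance_antisym \<mu> \<nu> False by blast
  qed
  then show ?thesis using False by simp
next
  case True
  let ?k = "\<lambda>s j. int (part_at \<mu> j) - int j + int (s j)"
  have "(\<Sum>w\<in>perms n. schur_char n \<mu> w * schur_char n \<mu> w)
      = (\<Sum>s\<in>perms n. sign s * (\<Sum>w\<in>perms n. schur_char n \<mu> w * fixed_vec n (?k s) w))"
    unfolding schur_char_def[of n \<mu>] sum_distrib_left
    by (subst (2) sum.swap) (simp add: mult.left_commute)
  also have "\<dots> = (\<Sum>s\<in>perms n. if s = id then fact n else 0)"
  proof (rule sum.cong[OF refl])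
    fix s assume s: "s \<in> perms n"
    let ?P = "\<Sum>w\<in>perms n. schur_char n \<mu> w * fixed_vec n (?k s) w"
    show "sign s * ?P = (if s = id then fact n else 0)"
    proof (cases "s = id")
      case True
      have "size (vec_mset n (?k s)) = n" using size_shifted[OF \<mu> s] True by simp
      then show ?thesis
        using True sum_schur_char_fixed_words[OF \<mu>, of "vec_mset n (?k s)"] ssyt_count_own_weight[OF \<mu>]
        by (simp add: fixed_vec_def)
    next
      case False
      have "?P = 0"
      proof (rule ccontr)
        assume "?P \<noteq> 0"
        note nz = sum_fixed_vec_nonzero[OF this]
        have pos: "\<And>j. j < n \<Longrightarrow> ?k s j \<ge> 0" using nz(1) by blast
        have "dominated (vec_mset n (?k s)) \<mu>"
          using nz(2) sum_schur_char_fixed_words[OF \<mu> size_shifted[OF \<mu> s pos]]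
          by (intro ssyt_count_nonzero_dominated[OF \<mu>]) auto
        then have "(\<Sum>j<k. s j) \<le> (\<Sum>j<k. j)" if "k \<le> n" for k
          using shifted_dominated[OF \<mu> s pos, of \<mu> k] that by simp
        then show False using perm_eq_id_if_sums[OF s] False by blast
      qed
      then show ?thesis using False by simp
    qed
  qed
  also have "\<dots> = fact n" by simp
  finally show ?thesis using True by simp
qed

section \<open>Cycle types\<close>

abbreviation orb :: "('a \<Rightarrow> 'a) \<Rightarrow> 'a \<Rightarrow> 'a set" where
  "orb w x \<equiv> range (\<lambda>i. (w ^^ i) x)"

lemma funpow_eq_iff:
  assumes "permutation w"
  shows "(w ^^ i) x = (w ^^ j) x \<longleftrightarrow> i mod least_power w x = j mod least_power w x"
proof -
  have *: "(w ^^ i) x = (w ^^ j) x \<longleftrightarrow> i mod least_power w x = j mod least_power w x" if "i \<le> j" for i j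
  proof -
    have inj: "inj w" using assms by (simp add: permutation bij_is_inj)
    have "(w ^^ j) x = (w ^^ i) ((w ^^ (j - i)) x)"
      using that by (metis add_diff_inverse_nat comp_apply funpow_add not_le)
    then have "(w ^^ i) x = (w ^^ j) x \<longleftrightarrow> (w ^^ (j - i)) x = x"
      using inj_fn[OF inj, of i] by (metis injD)
    also have "\<dots> \<longleftrightarrow> least_power w x dvd j - i" using least_power_dvd[OF assms] by simp
    also have "\<dots> \<longleftrightarrow> i mod least_power w x = j mod least_power w x"
      using mod_eq_dvd_iff_nat[OF that, of "least_power w x"] by metis
    finally show ?thesis .
  qed
  show ?thesis by (cases "i \<le> j") (use *[of i j] *[of j i] in auto)
qed

lemma orb_bij:
  assumes "permutation w"
  shows "bij_betw (\<lambda>i. (w ^^ i) x) {..<least_power w x} (orb w x)"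
proof (rule bij_betw_imageI)
  show "inj_on (\<lambda>i. (w ^^ i) x) {..<least_power w x}"
    by (rule inj_onI) (simp add: funpow_eq_iff[OF assms])
  show "(\<lambda>i. (w ^^ i) x) ` {..<least_power w x} = orb w x"
  proof
    show "orb w x \<subseteq> (\<lambda>i. (w ^^ i) x) ` {..<least_power w x}"
    proof
      fix y assume "y \<in> orb w x"
      then obtain i where "y = (w ^^ i) x" by blast
      then have "y = (w ^^ (i mod least_power w x)) x" by (simp add: funpow_eq_iff[OF assms])
      then show "y \<in> (\<lambda>i. (w ^^ i) x) ` {..<least_power w x}"
        using least_power_of_permutation(2)[OF assms] by auto
    qed
  qed auto
qed

lemma card_orb: "permutation w \<Longrightarrow> card (orb w x) = least_power w x"
  using bij_betw_same_card[OF orb_bij] by (metis card_lessThan)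

lemma finite_orb: "permutation w \<Longrightarrow> finite (orb w x)"
  using bij_betw_finite[OF orb_bij, of w x] by simp

lemma orb_self: "x \<in> orb w x" by (rule range_eqI[of _ _ 0]) simp

lemma orb_eq:
  assumes "permutation w" "y \<in> orb w x" shows "orb w y = orb w x"
proof -
  obtain i where y: "y = (w ^^ i) x" using assms by blast
  have sub: "orb w ((w ^^ i) x) \<subseteq> orb w x" for i x
    by (auto simp: image_iff) (metis comp_apply funpow_add)
  let ?L = "least_power w x"
  have "?L > 0" using least_power_of_permutation(2)[OF assms(1)] .
  then have "i \<le> ?L * i" by (cases ?L) auto
  \<comment> \<open>Orbits consist of forward iterates, so the way back from \<open>y\<close> to
    \<open>x\<close> completes a multiple of the period.\<close>
  then have "(w ^^ (?L * i - i)) y = (w ^^ (?L * i)) x"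
    unfolding y by (metis comp_apply funpow_add le_add_diff_inverse2)
  also have "\<dots> = x" using least_power_dvd[OF assms(1), of x "?L * i"] by simp
  finally have "x = (w ^^ (?L * i - i)) y" ..
  then show ?thesis using sub[of "?L * i - i" y] sub[of i x] y by (metis subset_antisym)
qed

lemma least_power_orb: "permutation w \<Longrightarrow> y \<in> orb w x \<Longrightarrow> least_power w y = least_power w x"
  using card_orb[of w] orb_eq[of w y x] by metis

lemma orb_subset:
  assumes "w \<in> perms n" "x < n" shows "orb w x \<subseteq> {..<n}"
proof
  fix y assume "y \<in> orb w x"
  then obtain i where "y = (w ^^ i) x" by blast
  then show "y \<in> {..<n}" using permutes_in_image[OF permutes_funpow[of w "{..<n}" i]] assms by simp
qed

lemma perms_less: "w \<in> perms n \<Longrightarrow> w x < n \<longleftrightarrow> x < n"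
  using permutes_in_image[of w "{..<n}" x] by simp

text \<open>A cycle type is witnessed by an enumeration of the points by the cells of the partition that
  turns the permutation into the cyclic shift of each row.\<close>

definition type_enum :: "nat \<Rightarrow> (nat \<Rightarrow> nat) \<Rightarrow> nat list \<Rightarrow> (nat \<times> nat \<Rightarrow> nat) \<Rightarrow> bool" where
  "type_enum n w \<mu> e \<longleftrightarrow> \<mu> \<in> partitions_of n \<and> bij_betw e (cells \<mu>) {..<n} \<and>
     (\<forall>a j. (a, j) \<in> cells \<mu> \<longrightarrow> w (e (a, j)) = e (a, Suc j mod \<mu> ! a))"

definition has_type :: "nat \<Rightarrow> (nat \<Rightarrow> nat) \<Rightarrow> nat list \<Rightarrow> bool" where
  "has_type n w \<mu> \<longleftrightarrow> w \<in> perms n \<and> (\<exists>e. type_enum n w \<mu> e)"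

lemma has_type_exists:
  assumes w: "w \<in> perms n" shows "\<exists>\<mu>. has_type n w \<mu>"
proof -
  have pw: "permutation w" using permutation_perms[OF w] .
  define Os where "Os = orb w ` {..<n}"
  have "finite Os" by (simp add: Os_def)
  then obtain l0 where l0: "set l0 = Os" "distinct l0" using finite_distinct_list by blast
  \<comment> \<open>Orbits in decreasing order of size, so that the list of their sizes is a
    partition.\<close>
  define l where "l = rev (sort_key card l0)"
  have l: "set l = Os" "distinct l" "sorted_wrt (\<ge>) (map card l)"
  proof -
    have "sorted (map card (sort_key card l0))" by simp
    then have "sorted_wrt (\<ge>) (rev (map card (sort_key card l0)))" by (simp add: sorted_wrt_rev)
    then show "sorted_wrt (\<ge>) (map card l)" by (simp add: l_def rev_map)
  qed (use l0 in \<open>auto simp: l_def\<close>)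
  define \<mu> where "\<mu> = map card l"
  have "\<exists>x. x < n \<and> l ! a = orb w x" if "a < length l" for a
    using that l(1) nth_mem[OF that] by (auto simp: Os_def)
  then obtain r where r: "\<And>a. a < length l \<Longrightarrow> r a < n \<and> l ! a = orb w (r a)" by metis
  have ml: "\<mu> ! a = least_power w (r a)" if "a < length l" for a
    using that r[OF that] card_orb[OF pw] by (simp add: \<mu>_def)
  define e where "e = (\<lambda>(a, j). (w ^^ j) (r a))"
  have cells: "cells \<mu> = {(a, j). a < length l \<and> j < least_power w (r a)}"
    using ml by (auto simp: cells_def) (auto simp: \<mu>_def)
  have bij: "bij_betw e (cells \<mu>) {..<n}"
  proof (rule bij_betw_imageI)
    show "inj_on e (cells \<mu>)"
    proof (rule inj_onI)
      fix p q assume p: "p \<in> cells \<mu>" and q: "q \<in> cells \<mu>" and eq: "e p = e q"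
      obtain a j b k where pq: "p = (a, j)" "q = (b, k)" by force
      have ab: "a < length l" "b < length l" "j < least_power w (r a)" "k < least_power w (r b)"
        using p q cells pq by auto
      have e: "(w ^^ j) (r a) = (w ^^ k) (r b)" using eq by (simp add: e_def pq)
      have "orb w ((w ^^ j) (r a)) = orb w (r a)" "orb w ((w ^^ k) (r b)) = orb w (r b)"
        by (rule orb_eq[OF pw]; blast)+
      then have "l ! a = l ! b" using e r ab by metis
      then have "a = b" using l(2) ab nth_eq_iff_index_eq by blast
      then show "p = q" using e ab funpow_eq_iff[OF pw, of j "r a" k] by (simp add: pq)
    qed
    show "e ` cells \<mu> = {..<n}"
    proof
      show "e ` cells \<mu> \<subseteq> {..<n}"
        using r orb_subset[OF w] by (fastforce simp: e_def cells)
      show "{..<n} \<subseteq> e ` cells \<mu>"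
      proof
        fix x assume x: "x \<in> {..<n}"
        then have "orb w x \<in> set l" using l(1) by (auto simp: Os_def)
        then obtain a where a: "a < length l" "l ! a = orb w x" by (auto simp: in_set_conv_nth)
        then have "x \<in> orb w (r a)" using r orb_self by metis
        then obtain j where "j < least_power w (r a)" "x = (w ^^ j) (r a)"
          using orb_bij[OF pw, of "r a"] by (auto simp: bij_betw_def)
        then show "x \<in> e ` cells \<mu>" using a by (intro image_eqI[where x = "(a, j)"]) (auto simp: e_def cells)
      qed
    qed
  qed
  have "(\<Sum>a<length \<mu>. \<mu> ! a) = card (cells \<mu>)"
  proof -
    have "cells \<mu> = (SIGMA a:{..<length \<mu>}. {..<\<mu> ! a})" by (auto simp: cells_def)
    then show ?thesis by simp
  qed
  then have "sum_list \<mu> = n" using bij_betw_same_card[OF bij] by (simp add: sum_list_sum_nth atLeast0LessThan)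
  moreover have "\<forall>k\<in>set \<mu>. k > 0"
    using ml least_power_of_permutation(2)[OF pw] by (auto simp: in_set_conv_nth \<mu>_def)
  ultimately have "\<mu> \<in> partitions_of n" using l(3) by (simp add: partitions_of_def \<mu>_def)
  moreover have "w (e (a, j)) = e (a, Suc j mod \<mu> ! a)" if "(a, j) \<in> cells \<mu>" for a j
  proof -
    have "w ((w ^^ j) (r a)) = (w ^^ Suc j) (r a)" by simp
    also have "\<dots> = (w ^^ (Suc j mod least_power w (r a))) (r a)"
      using funpow_eq_iff[OF pw, of "Suc j" "r a"] by simp
    finally show ?thesis using that ml by (simp add: e_def cells)
  qed
  ultimately show ?thesis using w bij unfolding has_type_def type_enum_def by blast
qed

lemma type_enum_pos:
  assumes "type_enum n w \<mu> e" "a < length \<mu>" shows "\<mu> ! a > 0" "(a, 0) \<in> cells \<mu>"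
  using assms partitions_ofD(3)[of \<mu> n a] by (auto simp: type_enum_def cells_def)

lemma type_enum_funpow:
  assumes "type_enum n w \<mu> e" "(a, j) \<in> cells \<mu>"
  shows "(w ^^ i) (e (a, j)) = e (a, (j + i) mod \<mu> ! a)"
proof (induction i)
  case 0
  then show ?case using assms(2) by (simp add: cells_def)
next
  case (Suc i)
  have "(a, (j + i) mod \<mu> ! a) \<in> cells \<mu>" using assms(2) by (auto simp: cells_def)
  then show ?case using Suc assms(1) by (simp add: type_enum_def mod_Suc_eq)
qed

lemma type_enum_orb:
  assumes "type_enum n w \<mu> e" "w \<in> perms n" "(a, j) \<in> cells \<mu>"
  shows "orb w (e (a, j)) = (\<lambda>i. e (a, i)) ` {..<\<mu> ! a}" "least_power w (e (a, j)) = \<mu> ! a"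
proof -
  have a: "a < length \<mu>" "j < \<mu> ! a" using assms(3) by (auto simp: cells_def)
  have inj: "inj_on e (cells \<mu>)" using assms(1) by (auto simp: type_enum_def bij_betw_def)
  have pw: "permutation w" using permutation_perms[OF assms(2)] .
  have "orb w (e (a, 0)) = (\<lambda>i. e (a, i)) ` {..<\<mu> ! a}"
  proof
    show "orb w (e (a, 0)) \<subseteq> (\<lambda>i. e (a, i)) ` {..<\<mu> ! a}"
      using type_enum_funpow[OF assms(1) type_enum_pos(2)[OF assms(1) a(1)]] a by auto
    show "(\<lambda>i. e (a, i)) ` {..<\<mu> ! a} \<subseteq> orb w (e (a, 0))"
    proof
      fix y assume "y \<in> (\<lambda>i. e (a, i)) ` {..<\<mu> ! a}"
      then obtain i where "i < \<mu> ! a" "y = e (a, i)" by blast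
      then have "y = (w ^^ i) (e (a, 0))"
        using type_enum_funpow[OF assms(1) type_enum_pos(2)[OF assms(1) a(1)], of i] by simp
      then show "y \<in> orb w (e (a, 0))" by blast
    qed
  qed
  moreover have "e (a, j) \<in> (\<lambda>i. e (a, i)) ` {..<\<mu> ! a}" using a by simp
  ultimately have "orb w (e (a, j)) = orb w (e (a, 0))"
    using orb_eq[OF pw] by metis
  then show o: "orb w (e (a, j)) = (\<lambda>i. e (a, i)) ` {..<\<mu> ! a}"
    using \<open>orb w (e (a, 0)) = _\<close> by simp
  have "inj_on (\<lambda>i. e (a, i)) {..<\<mu> ! a}"
    using inj a by (auto simp: inj_on_def cells_def)
  then show "least_power w (e (a, j)) = \<mu> ! a"
    unfolding card_orb[OF pw, symmetric] o by (simp add: card_image)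
qed

lemma has_type_count:
  assumes "has_type n w \<mu>"
  shows "card {x. x < n \<and> least_power w x = k} = k * count (mset \<mu>) k"
proof -
  obtain e where e: "type_enum n w \<mu> e" and w: "w \<in> perms n" using assms by (auto simp: has_type_def)
  have bij: "bij_betw e (cells \<mu>) {..<n}" using e by (simp add: type_enum_def)
  let ?D = "SIGMA a:{a. a < length \<mu> \<and> \<mu> ! a = k}. {..<k}"
  have im: "e ` ?D = {x. x < n \<and> least_power w x = k}"
  proof
    show "e ` ?D \<subseteq> {x. x < n \<and> least_power w x = k}"
    proof
      fix x assume "x \<in> e ` ?D"
      then obtain a j where aj: "a < length \<mu>" "\<mu> ! a = k" "j < k" "x = e (a, j)" by auto
      then have c: "(a, j) \<in> cells \<mu>" by (simp add: cells_def)
      then have "x < n" using bij aj(4) by (auto simp: bij_betw_def)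
      then show "x \<in> {x. x < n \<and> least_power w x = k}"
        using type_enum_orb(2)[OF e w c] aj by simp
    qed
    show "{x. x < n \<and> least_power w x = k} \<subseteq> e ` ?D"
    proof
      fix x assume x: "x \<in> {x. x < n \<and> least_power w x = k}"
      then have "x \<in> e ` cells \<mu>" using bij by (auto simp: bij_betw_def)
      then obtain a j where c: "(a, j) \<in> cells \<mu>" "x = e (a, j)" by force
      then show "x \<in> e ` ?D" using type_enum_orb(2)[OF e w c(1)] x by (auto simp: cells_def)
    qed
  qed
  have "?D \<subseteq> cells \<mu>" by (auto simp: cells_def)
  then have "inj_on e ?D" using bij inj_on_subset by (auto simp: bij_betw_def)
  then have "card {x. x < n \<and> least_power w x = k} = card ?D" by (simp only: im[symmetric] card_image)
  also have "\<dots> = k * card {a. a < length \<mu> \<and> \<mu> ! a = k}" by simp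
  also have "card {a. a < length \<mu> \<and> \<mu> ! a = k} = count (mset \<mu>) k"
    by (simp add: count_mset count_list_eq_length_filter length_filter_conv_card eq_commute[of k])
  finally show ?thesis .
qed

lemma has_type_unique:
  assumes "has_type n w \<mu>" "has_type n w \<nu>" shows "\<mu> = \<nu>"
proof -
  have p: "\<mu> \<in> partitions_of n" "\<nu> \<in> partitions_of n"
    using assms by (auto simp: has_type_def type_enum_def)
  have "count (mset \<mu>) k = count (mset \<nu>) k" for k
  \<comment> \<open>\<open>has_type_count\<close> carries no information at \<open>k = 0\<close>;
    there positivity of the parts decides.\<close>
  proof (cases "k = 0")
    case True
    have "0 \<notin> set \<mu>" "0 \<notin> set \<nu>" using p by (auto simp: partitions_of_def)
    then show ?thesis using True by (metis count_mset_0_iff)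
  next
    case False
    then show ?thesis using has_type_count[OF assms(1), of k] has_type_count[OF assms(2), of k] by simp
  qed
  then have m: "mset \<mu> = mset \<nu>" by (rule multiset_eqI)
  have "sorted (rev \<mu>)" "sorted (rev \<nu>)" using p by (auto simp: partitions_of_def sorted_wrt_rev)
  then have "rev \<mu> = rev \<nu>" using m by (metis mset_rev properties_for_sort)
  then show ?thesis by simp
qed

definition cycle_type :: "nat \<Rightarrow> (nat \<Rightarrow> nat) \<Rightarrow> nat list" where
  "cycle_type n w = (THE \<mu>. has_type n w \<mu>)"

lemma cycle_type_iff: "w \<in> perms n \<Longrightarrow> cycle_type n w = \<mu> \<longleftrightarrow> has_type n w \<mu>"
  using has_type_exists has_type_unique unfolding cycle_type_def by (metis theI')

lemma cycle_type_enum: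
  assumes "w \<in> perms n" obtains e where "type_enum n w (cycle_type n w) e"
  using cycle_type_iff[OF assms] assms unfolding has_type_def by metis

lemma cycle_type_partition: "w \<in> perms n \<Longrightarrow> cycle_type n w \<in> partitions_of n"
  using cycle_type_enum unfolding type_enum_def by metis

section \<open>Conjugacy classes and cycle types\<close>

lemma bij_betw_extend_perm:
  assumes "bij_betw f {..<n::nat} {..<n}"
  shows "(\<lambda>x. if x < n then f x else x) \<in> perms n"
proof -
  have "bij_betw (\<lambda>x. if x < n then f x else x) {..<n} {..<n}"
    using assms by (rule bij_betw_cong[THEN iffD1, rotated]) auto
  then have "(\<lambda>x. if x < n then f x else x) permutes {..<n}" by (rule bij_imp_permutes) simp
  then show ?thesis by simp
qed

text \<open>Each permutation is the cyclic row shift in its own labelling of the diagram, so the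
  relabelling \<open>g\<close> conjugates one into the other.\<close>

lemma conjugate_if_same_type:
  assumes w: "w \<in> perms n" and w': "w' \<in> perms n" and t: "cycle_type n w = cycle_type n w'"
  shows "\<exists>g\<in>perms n. g \<circ> w \<circ> inv g = w'"
proof -
  obtain e where e: "type_enum n w (cycle_type n w) e" using cycle_type_enum[OF w] .
  obtain e' where e': "type_enum n w' (cycle_type n w) e'" using cycle_type_enum[OF w'] t by metis
  let ?\<mu> = "cycle_type n w"
  have b: "bij_betw e (cells ?\<mu>) {..<n}" "bij_betw e' (cells ?\<mu>) {..<n}" using e e' by (auto simp: type_enum_def)
  define g where "g = (\<lambda>x. if x < n then (e' \<circ> inv_into (cells ?\<mu>) e) x else x)"
  have g: "g \<in> perms n"
    unfolding g_def by (intro bij_betw_extend_perm bij_betw_trans[OF bij_betw_inv_into[OF b(1)] b(2)])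
  have ge: "g (e c) = e' c" if "c \<in> cells ?\<mu>" for c
    using b(1) that by (auto simp: g_def bij_betw_def)
  have "g (w x) = w' (g x)" for x
  proof (cases "x < n")
    case True
    then have "x \<in> e ` cells ?\<mu>" using b(1) by (auto simp: bij_betw_def)
    then obtain a j where aj: "(a, j) \<in> cells ?\<mu>" "x = e (a, j)" by force
    then have "(a, Suc j mod ?\<mu> ! a) \<in> cells ?\<mu>" by (auto simp: cells_def)
    then show ?thesis using aj e e' ge by (simp add: type_enum_def)
  next
    case False
    then show ?thesis
      using w w' g permutes_not_in[of w "{..<n}" x] permutes_not_in[of w' "{..<n}" x] permutes_not_in[of g "{..<n}" x]
      by simp
  qed
  then have "g \<circ> w = w' \<circ> g" by (simp add: fun_eq_iff)
  then have "g \<circ> w \<circ> inv g = w' \<circ> (g \<circ> inv g)" by (simp add: comp_assoc)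
  then have "g \<circ> w \<circ> inv g = w'" using g by (simp add: permutes_inv_o)
  then show ?thesis using g by blast
qed

lemma cycle_type_conj:
  assumes w: "w \<in> perms n" and g: "g \<in> perms n"
  shows "cycle_type n (g \<circ> w \<circ> inv g) = cycle_type n w"
proof -
  have p: "g \<circ> w \<circ> inv g \<in> perms n" using w g by (auto intro!: permutes_compose permutes_inv)
  obtain e where e: "type_enum n w (cycle_type n w) e" using cycle_type_enum[OF w] .
  have "bij_betw g {..<n} {..<n}" using g by (auto intro: permutes_imp_bij)
  then have "bij_betw (g \<circ> e) (cells (cycle_type n w)) {..<n}"
    using e by (auto simp: type_enum_def intro: bij_betw_trans)
  then have "type_enum n (g \<circ> w \<circ> inv g) (cycle_type n w) (g \<circ> e)"
    using e g by (auto simp: type_enum_def permutes_inverses)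
  then show ?thesis using cycle_type_iff[OF p] p by (auto simp: has_type_def)
qed

text \<open>Label the diagram arbitrarily and transport the cyclic shift of its rows.\<close>

lemma exists_cycle_type:
  assumes \<mu>: "\<mu> \<in> partitions_of n" shows "\<exists>w\<in>perms n. cycle_type n w = \<mu>"
proof -
  have "card (cells \<mu>) = card {..<n}" using card_cells_partition[OF \<mu>] by simp
  then obtain e where e: "bij_betw e (cells \<mu>) {..<n}"
    using finite_same_card_bij[of "cells \<mu>" "{..<n}"] by auto
  define rot where "rot = (\<lambda>(a, j). (a, Suc j mod \<mu> ! a))"
  have rot: "rot c \<in> cells \<mu>" if "c \<in> cells \<mu>" for c using that by (auto simp: rot_def cells_def)
  have "inj_on rot (cells \<mu>)"
  proof (rule inj_onI)
    fix p q assume p: "p \<in> cells \<mu>" and q: "q \<in> cells \<mu>" and eq: "rot p = rot q"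
    obtain a j b k where pq: "p = (a, j)" "q = (b, k)" by force
    have ab: "a = b" and m: "Suc j mod \<mu> ! a = Suc k mod \<mu> ! a" using eq by (auto simp: rot_def pq)
    have jk: "j < \<mu> ! a" "k < \<mu> ! a" using p q ab by (auto simp: cells_def pq)
    then have "j = k" using m by (auto simp: mod_Suc split: if_splits)
    then show "p = q" using ab pq by simp
  qed
  then have "bij_betw rot (cells \<mu>) (cells \<mu>)"
    using rot endo_inj_surj[OF finite_cells, of rot \<mu>] by (simp add: bij_betw_def image_subset_iff)
  then have b: "bij_betw (e \<circ> rot \<circ> inv_into (cells \<mu>) e) {..<n} {..<n}"
    using e bij_betw_inv_into[OF e] by (metis bij_betw_trans)
  define w where "w = (\<lambda>x. if x < n then (e \<circ> rot \<circ> inv_into (cells \<mu>) e) x else x)"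
  have w: "w \<in> perms n" unfolding w_def by (rule bij_betw_extend_perm[OF b])
  have "type_enum n w \<mu> e"
    unfolding type_enum_def
  proof (intro conjI allI impI)
    show "w (e (a, j)) = e (a, Suc j mod \<mu> ! a)" if "(a, j) \<in> cells \<mu>" for a j
      using e that by (auto simp: w_def bij_betw_def rot_def)
  qed (use \<mu> e in auto)
  then show ?thesis using cycle_type_iff[OF w] w by (auto simp: has_type_def)
qed

lemma funpow_orbit_const:
  assumes "\<forall>x<n. v (w x) = v x" "w \<in> perms n" "x < n" shows "v ((w ^^ i) x) = v x"
proof (induction i)
  case (Suc i)
  have "(w ^^ i) x < n" using permutes_in_image[OF permutes_funpow[of w "{..<n}" i]] assms by simp
  then show ?case using Suc assms(1) by simp
qed simp

lemma sum_list_zip: "length cs = length \<mu> \<Longrightarrow>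
  (\<Sum>(c, k)\<leftarrow>zip cs \<mu>. f c k) = (\<Sum>a<length \<mu>. f (cs ! a) (\<mu> ! a))" for f :: "_ \<Rightarrow> _ \<Rightarrow> 'z :: comm_monoid_add"
  by (simp add: sum_list_sum_nth atLeast0LessThan)

text \<open>A word is fixed by a permutation iff it is constant on each cycle, hence given by one letter
  per part of the cycle type.\<close>

lemma fixed_words_eq_card:
  assumes e: "type_enum n w \<mu> e" and w: "w \<in> perms n"
  shows "fixed_words n A w = card {cs. length cs = length \<mu> \<and> (\<Sum>(c, k)\<leftarrow>zip cs \<mu>. replicate_mset k c) = A}"
proof -
  have bij: "bij_betw e (cells \<mu>) {..<n}" using e by (simp add: type_enum_def)
  let ?l = "\<lambda>v. map (\<lambda>a. v (e (a, 0))) [0..<length \<mu>]"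
  let ?v = "\<lambda>cs. \<lambda>x\<in>{..<n}. cs ! fst (inv_into (cells \<mu>) e x)"
  have lt: "e c < n" if "c \<in> cells \<mu>" for c using bij that by (auto simp: bij_betw_def)
  have inv: "inv_into (cells \<mu>) e (e c) = c" if "c \<in> cells \<mu>" for c
    using bij that by (auto simp: bij_betw_def)
  have cont: "image_mset v (mset_set {..<n}) = (\<Sum>a<length \<mu>. replicate_mset (\<mu> ! a) (c a))"
    if "\<And>a j. (a, j) \<in> cells \<mu> \<Longrightarrow> v (e (a, j)) = c a" for v :: "nat \<Rightarrow> 'a" and c
  proof (rule multiset_eqI)
    fix z
    have "count (image_mset v (mset_set {..<n})) z = card {x \<in> {..<n}. v x = z}"
      by (simp add: count_image_mset_eq_card_vimage vimage_def Int_def conj_commute)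
    also have "{x \<in> {..<n}. v x = z} = e ` (SIGMA a:{a. a < length \<mu> \<and> c a = z}. {..<\<mu> ! a})"
    proof
      show "{x \<in> {..<n}. v x = z} \<subseteq> e ` (SIGMA a:{a. a < length \<mu> \<and> c a = z}. {..<\<mu> ! a})"
      proof
        fix x assume x: "x \<in> {x \<in> {..<n}. v x = z}"
        then have "x \<in> e ` cells \<mu>" using bij by (simp add: bij_betw_def)
        then obtain a j where "(a, j) \<in> cells \<mu>" "x = e (a, j)" by force
        then show "x \<in> e ` (SIGMA a:{a. a < length \<mu> \<and> c a = z}. {..<\<mu> ! a})"
          using x that[of a j] by (intro image_eqI[where x = "(a, j)"]) (auto simp: cells_def)
      qed
      show "e ` (SIGMA a:{a. a < length \<mu> \<and> c a = z}. {..<\<mu> ! a}) \<subseteq> {x \<in> {..<n}. v x = z}"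
        using that lt by (auto simp: cells_def)
    qed
    also have "card \<dots> = card (SIGMA a:{a. a < length \<mu> \<and> c a = z}. {..<\<mu> ! a})"
    proof (rule card_image)
      have "(SIGMA a:{a. a < length \<mu> \<and> c a = z}. {..<\<mu> ! a}) \<subseteq> cells \<mu>" by (auto simp: cells_def)
      then show "inj_on e (SIGMA a:{a. a < length \<mu> \<and> c a = z}. {..<\<mu> ! a})"
        using bij inj_on_subset by (auto simp: bij_betw_def)
    qed
    also have "\<dots> = (\<Sum>a\<in>{a \<in> {..<length \<mu>}. c a = z}. \<mu> ! a)" by simp
    also have "\<dots> = (\<Sum>a<length \<mu>. if c a = z then \<mu> ! a else 0)" by (rule sum.inter_filter) simp
    also have "\<dots> = count (\<Sum>a<length \<mu>. replicate_mset (\<mu> ! a) (c a)) z"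
      by (simp add: count_sum eq_commute[of z])
    finally show "count (image_mset v (mset_set {..<n})) z = count (\<Sum>a<length \<mu>. replicate_mset (\<mu> ! a) (c a)) z" .
  qed
  have const: "v (e (a, j)) = v (e (a, 0))"
    if v: "\<forall>x<n. v (w x) = v x" and "(a, j) \<in> cells \<mu>" for v :: "nat \<Rightarrow> 'a" and a j
  proof -
    have a: "a < length \<mu>" "j < \<mu> ! a" using that by (auto simp: cells_def)
    have "e (a, j) = (w ^^ j) (e (a, 0))"
      using type_enum_funpow[OF e type_enum_pos(2)[OF e a(1)], of j] a by simp
    then show ?thesis using funpow_orbit_const[OF v w lt[OF type_enum_pos(2)[OF e a(1)]]] by simp
  qed
  have "bij_betw ?l {v \<in> words n A. \<forall>x<n. v (w x) = v x}
     {cs. length cs = length \<mu> \<and> (\<Sum>(c, k)\<leftarrow>zip cs \<mu>. replicate_mset k c) = A}"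
  proof (rule bij_betw_byWitness[where f' = ?v])
    show "\<forall>v\<in>{v \<in> words n A. \<forall>x<n. v (w x) = v x}. ?v (?l v) = v"
    proof
      fix v assume "v \<in> {v \<in> words n A. \<forall>x<n. v (w x) = v x}"
      then have v: "v \<in> words n A" "\<forall>x<n. v (w x) = v x" by auto
      show "?v (?l v) = v"
      proof
        fix x show "?v (?l v) x = v x"
        proof (cases "x < n")
          case True
          then have "x \<in> e ` cells \<mu>" using bij by (simp add: bij_betw_def)
          then obtain a j where aj: "(a, j) \<in> cells \<mu>" "x = e (a, j)" by force
          then have "a < length \<mu>" by (simp add: cells_def)
          then show ?thesis using const[OF v(2) aj(1)] aj True inv[OF aj(1)] by simp
        next
          case False
          then show ?thesis using words_undefined[OF v(1)] by simp
        qed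
      qed
    qed
    show "\<forall>cs\<in>{cs. length cs = length \<mu> \<and> (\<Sum>(c, k)\<leftarrow>zip cs \<mu>. replicate_mset k c) = A}. ?l (?v cs) = cs"
    proof
      fix cs assume "cs \<in> {cs. length cs = length \<mu> \<and> (\<Sum>(c, k)\<leftarrow>zip cs \<mu>. replicate_mset k c) = A}"
      then have l: "length cs = length \<mu>" by simp
      show "?l (?v cs) = cs"
      proof (rule nth_equalityI)
        fix a assume "a < length (?l (?v cs))"
        then have "a < length \<mu>" by simp
        then show "?l (?v cs) ! a = cs ! a"
          using inv[OF type_enum_pos(2)[OF e]] lt[OF type_enum_pos(2)[OF e]] by simp
      qed (simp add: l)
    qed
    show "?l ` {v \<in> words n A. \<forall>x<n. v (w x) = v x} \<subseteq> {cs. length cs = length \<mu> \<and> (\<Sum>(c, k)\<leftarrow>zip cs \<mu>. replicate_mset k c) = A}"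
    proof
      fix cs assume "cs \<in> ?l ` {v \<in> words n A. \<forall>x<n. v (w x) = v x}"
      then obtain v where v: "v \<in> words n A" "\<forall>x<n. v (w x) = v x" and cs: "cs = ?l v" by auto
      have "image_mset v (mset_set {..<n}) = (\<Sum>a<length \<mu>. replicate_mset (\<mu> ! a) (v (e (a, 0))))"
        using const[OF v(2)] by (intro cont) auto
      then show "cs \<in> {cs. length cs = length \<mu> \<and> (\<Sum>(c, k)\<leftarrow>zip cs \<mu>. replicate_mset k c) = A}"
        using words_mset[OF v(1)] by (simp add: cs sum_list_zip[of _ _ "\<lambda>c k. replicate_mset k c"])
    qed
    show "?v ` {cs. length cs = length \<mu> \<and> (\<Sum>(c, k)\<leftarrow>zip cs \<mu>. replicate_mset k c) = A} \<subseteq> {v \<in> words n A. \<forall>x<n. v (w x) = v x}"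
    proof
      fix v assume "v \<in> ?v ` {cs. length cs = length \<mu> \<and> (\<Sum>(c, k)\<leftarrow>zip cs \<mu>. replicate_mset k c) = A}"
      then obtain cs where l: "length cs = length \<mu>" and A: "(\<Sum>(c, k)\<leftarrow>zip cs \<mu>. replicate_mset k c) = A"
        and v: "v = ?v cs" by auto
      have ve: "v (e (a, j)) = cs ! a" if "(a, j) \<in> cells \<mu>" for a j
        using inv[OF that] lt[OF that] by (simp add: v)
      have "image_mset v (mset_set {..<n}) = (\<Sum>a<length \<mu>. replicate_mset (\<mu> ! a) (cs ! a))"
        by (rule cont) (rule ve)
      then have "image_mset v (mset_set {..<n}) = A"
        unfolding A[symmetric] using l by (simp add: sum_list_zip[of _ _ "\<lambda>c k. replicate_mset k c"])
      then have "v \<in> words n A" by (intro wordsI) (auto simp: v)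
      moreover have "v (w x) = v x" if "x < n" for x
      proof -
        have "x \<in> e ` cells \<mu>" using bij that by (simp add: bij_betw_def)
        then obtain a j where aj: "(a, j) \<in> cells \<mu>" "x = e (a, j)" by force
        then have "(a, Suc j mod \<mu> ! a) \<in> cells \<mu>" by (auto simp: cells_def)
        then show ?thesis using aj ve e by (simp add: type_enum_def)
      qed
      ultimately show "v \<in> {v \<in> words n A. \<forall>x<n. v (w x) = v x}" by blast
    qed
  qed
  then show ?thesis unfolding fixed_words_def by (rule bij_betw_same_card)
qed

section \<open>The sign in terms of the cycle type\<close>

lemma sign_cycle_of_list: "distinct cs \<Longrightarrow> sign (cycle_of_list cs) = (-1) ^ (length cs - 1)"
proof (induction cs rule: cycle_of_list.induct)
  case (1 i j cs)
  have "sign (cycle_of_list (i # j # cs)) = sign (transpose i j) * sign (cycle_of_list (j # cs))"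
    unfolding cycle_of_list.simps by (rule sign_compose[OF permutation_swap_id permutation_of_cycle])
  then show ?case using 1 by (simp add: sign_swap_id del: cycle_of_list.simps(1))
qed simp_all

lemma cycle_of_list_nth:
  assumes "distinct cs" "i < length cs" shows "cycle_of_list cs (cs ! i) = cs ! (Suc i mod length cs)"
proof -
  have "map (cycle_of_list cs) cs = rotate 1 cs" using cyclic_rotation[OF assms(1), of 1] by simp
  then have "map (cycle_of_list cs) cs ! i = rotate 1 cs ! i" by simp
  then show ?thesis using assms(2) by (simp add: nth_rotate del: rotate_Suc)
qed

lemma sign_cycle_type:
  assumes w: "w \<in> perms n" and e: "type_enum n w \<mu> e"
  shows "sign w = (-1) ^ (n - length \<mu>)"
proof -
  have bij: "bij_betw e (cells \<mu>) {..<n}" using e by (simp add: type_enum_def)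
  let ?cs = "\<lambda>a. map (\<lambda>j. e (a, j)) [0..<\<mu> ! a]"
  \<comment> \<open>\<open>u m\<close> composes the cycles of the first \<open>m\<close> rows: it
    agrees with \<open>w\<close> on them and fixes all other points, so
    \<open>u (length \<mu>) = w\<close> and the sign can be computed row by row.\<close>
  define u where "u = rec_nat id (\<lambda>a g. cycle_of_list (?cs a) \<circ> g)"
  have u: "u 0 = id" "u (Suc a) = cycle_of_list (?cs a) \<circ> u a" for a by (simp_all add: u_def)
  have inj: "e (a, j) = e (b, k) \<longleftrightarrow> a = b \<and> j = k" if "(a, j) \<in> cells \<mu>" "(b, k) \<in> cells \<mu>" for a b j k
    using bij that by (auto simp: bij_betw_def dest: inj_onD)
  have d: "distinct (?cs a)" if "a < length \<mu>" for a
    using inj that by (auto simp: distinct_map inj_on_def cells_def)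
  have notin: "e (b, j) \<notin> set (?cs a)" if "(b, j) \<in> cells \<mu>" "a < length \<mu>" "b \<noteq> a" for a b j
    using inj that by (auto simp: cells_def)
  have act: "u m (e (b, j)) = (if b < m then w (e (b, j)) else e (b, j))"
    if "m \<le> length \<mu>" "(b, j) \<in> cells \<mu>" for m b j
    using that(1)
  proof (induction m)
    case (Suc a)
    have wb: "w (e (b, j)) = e (b, Suc j mod \<mu> ! b)" "(b, Suc j mod \<mu> ! b) \<in> cells \<mu>"
      using e that(2) by (auto simp: type_enum_def cells_def)
    show ?case
    proof (cases "b = a")
      case True
      have "j < \<mu> ! a" using that(2) True by (simp add: cells_def)
      then have "cycle_of_list (?cs a) (e (a, j)) = e (a, Suc j mod \<mu> ! a)"
        using cycle_of_list_nth[OF d, of a j] Suc.prems by simp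
      then show ?thesis using Suc True wb by (simp add: u)
    next
      case False
      then have "cycle_of_list (?cs a) (e (b, i)) = e (b, i)" if "(b, i) \<in> cells \<mu>" for i
        using notin[OF that, of a] Suc.prems by (intro id_outside_supp) auto
      then show ?thesis using Suc False wb that(2) by (simp add: u)
    qed
  qed (simp add: u)
  have uperm: "u m \<in> perms n" if "m \<le> length \<mu>" for m
    using that
  proof (induction m)
    case (Suc a)
    have "set (?cs a) \<subseteq> {..<n}" using bij Suc.prems by (auto simp: bij_betw_def cells_def)
    then have "cycle_of_list (?cs a) permutes {..<n}" using cycle_permutes permutes_subset by blast
    moreover have "u a permutes {..<n}" using Suc by simp
    ultimately show ?case unfolding u(2) by (blast intro: permutes_compose)
  qed (simp add: u)
  have "u (length \<mu>) x = w x" for x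
  proof (cases "x < n")
    case True
    then have "x \<in> e ` cells \<mu>" using bij by (simp add: bij_betw_def)
    then obtain a j where aj: "(a, j) \<in> cells \<mu>" "x = e (a, j)" by force
    then have "a < length \<mu>" by (simp add: cells_def)
    then show ?thesis using act[OF _ aj(1), of "length \<mu>"] aj by simp
  next
    case False
    then show ?thesis
      using w uperm[of "length \<mu>"] permutes_not_in[of w "{..<n}" x] permutes_not_in[of "u (length \<mu>)" "{..<n}" x] by simp
  qed
  then have wu: "w = u (length \<mu>)" by auto
  have "sign (u m) = (-1) ^ (\<Sum>a<m. \<mu> ! a - 1)" if "m \<le> length \<mu>" for m
    using that
  proof (induction m)
    case (Suc a)
    have "sign (u (Suc a)) = sign (cycle_of_list (?cs a)) * sign (u a)"
      unfolding u(2) using uperm[of a] Suc.prems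
      by (intro sign_compose permutation_of_cycle permutation_perms) auto
    then show ?case using Suc d[of a] by (simp add: sign_cycle_of_list power_add)
  qed (simp add: u)
  moreover have "(\<Sum>a<length \<mu>. \<mu> ! a - 1) = n - length \<mu>"
  proof -
    have \<mu>: "\<mu> \<in> partitions_of n" using e by (simp add: type_enum_def)
    have "(\<Sum>a<length \<mu>. \<mu> ! a - 1) = (\<Sum>a<length \<mu>. \<mu> ! a) - (\<Sum>a<length \<mu>. 1)"
      using partitions_ofD(3)[OF \<mu>] by (intro sum_subtractf_nat) (auto simp: Suc_leI)
    then show ?thesis
      using partitions_ofD(2)[OF \<mu>] by (simp add: sum_list_sum_nth atLeast0LessThan)
  qed
  ultimately show ?thesis using wu by simp
qed

lemma cycle_type_parts:
  assumes w: "w \<in> perms n"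
  shows "set (cycle_type n w) = least_power w ` {..<n}"
proof -
  obtain e where e: "type_enum n w (cycle_type n w) e" using cycle_type_enum[OF w] .
  let ?\<mu> = "cycle_type n w"
  have bij: "bij_betw e (cells ?\<mu>) {..<n}" using e by (simp add: type_enum_def)
  show ?thesis
  proof
    show "set ?\<mu> \<subseteq> least_power w ` {..<n}"
    proof
      fix k assume "k \<in> set ?\<mu>"
      then obtain a where a: "a < length ?\<mu>" "k = ?\<mu> ! a" by (auto simp: in_set_conv_nth)
      have c: "(a, 0) \<in> cells ?\<mu>" by (rule type_enum_pos(2)[OF e a(1)])
      then have "e (a, 0) < n" using bij by (auto simp: bij_betw_def)
      then show "k \<in> least_power w ` {..<n}" using type_enum_orb(2)[OF e w c] a by (metis imageI lessThan_iff)
    qed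
    show "least_power w ` {..<n} \<subseteq> set ?\<mu>"
    proof
      fix k assume "k \<in> least_power w ` {..<n}"
      then obtain x where x: "x < n" "k = least_power w x" by auto
      then have "x \<in> e ` cells ?\<mu>" using bij by (simp add: bij_betw_def)
      then obtain a j where aj: "(a, j) \<in> cells ?\<mu>" "x = e (a, j)" by force
      then show "k \<in> set ?\<mu>" using type_enum_orb(2)[OF e w aj(1)] x by (auto simp: cells_def)
    qed
  qed
qed

section \<open>Young symmetrizers and class functions\<close>

text \<open>A one-sided inverse of a square matrix is two-sided: as many orthogonal class functions as there
  are classes span the class functions.\<close>

lemma orthogonal_complete:
  fixes f :: "'l \<Rightarrow> 'g \<Rightarrow> real" and ty :: "'g \<Rightarrow> 'l"
  assumes fin: "finite \<Lambda>" "finite G" and ty: "ty ` G \<subseteq> \<Lambda>"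
    and cls: "\<And>a w v. a \<in> \<Lambda> \<Longrightarrow> w \<in> G \<Longrightarrow> v \<in> G \<Longrightarrow> ty w = ty v \<Longrightarrow> f a w = f a v"
    and orth: "\<And>a b. a \<in> \<Lambda> \<Longrightarrow> b \<in> \<Lambda> \<Longrightarrow> (\<Sum>w\<in>G. f a w * f b w) = (if a = b then c else 0)"
    and c: "c \<noteq> 0"
    and h: "\<And>w v. w \<in> G \<Longrightarrow> v \<in> G \<Longrightarrow> ty w = ty v \<Longrightarrow> h w = h v"
    and w: "w \<in> G"
  shows "c * h w = (\<Sum>a\<in>\<Lambda>. (\<Sum>v\<in>G. h v * f a v) * f a w)"
proof -
  define k where "k = card \<Lambda>"
  obtain e where e: "bij_betw e {..<k} \<Lambda>"
    using ex_bij_betw_nat_finite[OF fin(1)] by (auto simp: k_def atLeast0LessThan)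
  define rp where "rp = (\<lambda>b. SOME v. v \<in> G \<and> ty v = b)"
  have rp: "rp (ty v) \<in> G \<and> ty (rp (ty v)) = ty v" if "v \<in> G" for v
    using someI[of "\<lambda>v'. v' \<in> G \<and> ty v' = ty v" v] that by (simp add: rp_def)
  have eL: "e i \<in> \<Lambda>" if "i < k" for i using e that by (auto simp: bij_betw_def)
  have frp: "f a (rp (ty v)) = f a v" if "v \<in> G" "a \<in> \<Lambda>" for a v
    using cls[OF that(2), of "rp (ty v)" v] rp[OF that(1)] that by simp
  define F where "F = (\<lambda>b. {v \<in> G. ty v = b})"
  \<comment> \<open>\<open>A\<close> is the character table with one representative per class;
    \<open>B\<close> is its transpose, weighted by class sizes and divided by \<open>c\<close>. Then
    \<open>A * B = 1\<close> is orthogonality of rows and \<open>B * A = 1\<close> orthogonality of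
    columns, which is completeness.\<close>
  define A where "A = mat k k (\<lambda>(i, j). f (e i) (rp (e j)))"
  define B where "B = mat k k (\<lambda>(j, i). (\<Sum>v\<in>F (e j). f (e i) v) / c)"
  have split: "(\<Sum>j<k. \<Sum>v\<in>F (e j). g v) = sum g G" for g :: "'g \<Rightarrow> real"
  proof -
    have "(\<Sum>j<k. \<Sum>v\<in>F (e j). g v) = (\<Sum>b\<in>\<Lambda>. sum g (F b))"
      by (rule sum.reindex_bij_betw[OF e])
    also have "\<dots> = sum g G" unfolding F_def by (rule sum.group) (use fin ty in auto)
    finally show ?thesis .
  qed
  have AB: "A * B = 1\<^sub>m k"
  proof (rule eq_matI)
    fix i i' assume ii: "i < dim_row (1\<^sub>m k :: real mat)" "i' < dim_col (1\<^sub>m k :: real mat)"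
    then have i: "i < k" "i' < k" by auto
    have "(A * B) $$ (i, i') = (\<Sum>j<k. f (e i) (rp (e j)) * ((\<Sum>v\<in>F (e j). f (e i') v) / c))"
      using i by (simp add: A_def B_def scalar_prod_def atLeast0LessThan)
    also have "\<dots> = (\<Sum>j<k. \<Sum>v\<in>F (e j). f (e i) v * f (e i') v / c)"
    proof (rule sum.cong[OF refl])
      fix j assume "j \<in> {..<k}"
      have "f (e i) (rp (e j)) = f (e i) v" if "v \<in> F (e j)" for v
        using frp[of v "e i"] that eL[OF i(1)] by (auto simp: F_def)
      then show "f (e i) (rp (e j)) * ((\<Sum>v\<in>F (e j). f (e i') v) / c) = (\<Sum>v\<in>F (e j). f (e i) v * f (e i') v / c)"
        by (simp add: sum_distrib_left sum_divide_distrib)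
    qed
    also have "\<dots> = (\<Sum>v\<in>G. f (e i) v * f (e i') v) / c" by (simp add: split sum_divide_distrib)
    also have "\<dots> = (if i = i' then 1 else 0)"
      using orth[OF eL[OF i(1)] eL[OF i(2)]] c e i by (auto simp: bij_betw_def dest: inj_onD)
    finally show "(A * B) $$ (i, i') = 1\<^sub>m k $$ (i, i')" using i by simp
  qed (simp_all add: A_def B_def)
  have BA: "B * A = 1\<^sub>m k"
    by (rule mat_mult_left_right_inverse[OF _ _ AB]) (simp_all add: A_def B_def)
  obtain j0 where j0: "j0 < k" "e j0 = ty w" using e ty w by (auto simp: bij_betw_def image_iff)
  have dual: "(\<Sum>i<k. (\<Sum>v\<in>F (e j). f (e i) v) * f (e i) w) = (if j = j0 then c else 0)" if j: "j < k" for j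
  proof -
    have "(\<Sum>i<k. (\<Sum>v\<in>F (e j). f (e i) v) * f (e i) w) = c * (\<Sum>i<k. (\<Sum>v\<in>F (e j). f (e i) v) / c * f (e i) (rp (e j0)))"
      using c frp[OF w eL] by (simp add: sum_distrib_left j0)
    also have "\<dots> = c * (B * A) $$ (j, j0)"
      using j j0 by (simp add: A_def B_def scalar_prod_def atLeast0LessThan)
    finally show ?thesis using j j0 by (simp add: BA)
  qed
  have "(\<Sum>a\<in>\<Lambda>. (\<Sum>v\<in>G. h v * f a v) * f a w) = (\<Sum>i<k. (\<Sum>v\<in>G. h v * f (e i) v) * f (e i) w)"
    by (rule sum.reindex_bij_betw[OF e, symmetric])
  also have "\<dots> = (\<Sum>i<k. (\<Sum>j<k. h (rp (e j)) * (\<Sum>v\<in>F (e j). f (e i) v)) * f (e i) w)"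
  proof (rule sum.cong[OF refl])
    fix i assume "i \<in> {..<k}"
    have "(\<Sum>v\<in>G. h v * f (e i) v) = (\<Sum>j<k. \<Sum>v\<in>F (e j). h v * f (e i) v)" by (simp add: split)
    also have "\<dots> = (\<Sum>j<k. h (rp (e j)) * (\<Sum>v\<in>F (e j). f (e i) v))"
    proof (rule sum.cong[OF refl])
      fix j
      have "h (rp (e j)) = h v" if "v \<in> F (e j)" for v
        using h[of "rp (ty v)" v] rp[of v] that by (auto simp: F_def)
      then show "(\<Sum>v\<in>F (e j). h v * f (e i) v) = h (rp (e j)) * (\<Sum>v\<in>F (e j). f (e i) v)"
        by (simp add: sum_distrib_left)
    qed
    finally show "(\<Sum>v\<in>G. h v * f (e i) v) * f (e i) w = (\<Sum>j<k. h (rp (e j)) * (\<Sum>v\<in>F (e j). f (e i) v)) * f (e i) w"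
      by simp
  qed
  also have "\<dots> = (\<Sum>j<k. h (rp (e j)) * (\<Sum>i<k. (\<Sum>v\<in>F (e j). f (e i) v) * f (e i) w))"
    unfolding sum_distrib_left sum_distrib_right by (subst sum.swap) (simp add: mult.assoc)
  also have "\<dots> = (\<Sum>j<k. if j = j0 then h (rp (e j)) * c else 0)"
    using dual by (intro sum.cong) auto
  also have "\<dots> = h w * c" using j0 h[of "rp (ty w)" w] rp[OF w] w by simp
  finally show ?thesis by simp
qed

lemma perms_inv_cancel:
  assumes "a \<in> perms n"
  shows "inv a \<circ> (a \<circ> b) = b" "a \<circ> (inv a \<circ> b) = b" "c \<circ> a \<circ> inv a = c" "c \<circ> inv a \<circ> a = c" "inv (inv a) = a"
    "inv a \<circ> a = id" "a \<circ> inv a = id"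
proof -
  have i: "inv a \<circ> a = id" "a \<circ> inv a = id" using assms by (auto simp: permutes_inv_o)
  then show "inv a \<circ> a = id" "a \<circ> inv a = id" by auto
  show "inv a \<circ> (a \<circ> b) = b" using i by (simp add: comp_assoc[symmetric] del: comp_apply)
  show "a \<circ> (inv a \<circ> b) = b" using i by (simp add: comp_assoc[symmetric] del: comp_apply)
  show "c \<circ> a \<circ> inv a = c" using i by (simp only: comp_assoc comp_id)
  show "c \<circ> inv a \<circ> a = c" using i by (simp only: comp_assoc comp_id)
  show "inv (inv a) = a" using assms by (auto intro: permutes_inv_inv)
qed

lemma fixed_words_conj:
  assumes w: "w \<in> perms n" and g: "g \<in> perms n"
  shows "fixed_words n A (g \<circ> w \<circ> inv g) = fixed_words n A w"
proof -
  have gi: "inv g \<in> perms n" using g by (auto intro: permutes_inv)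
  have p: "g \<circ> w \<circ> inv g \<in> perms n" using w g gi by (auto intro!: permutes_compose)
  have id: "inv g \<circ> g = id" "g \<circ> inv g = id" using g by (auto simp: permutes_inv_o)
  have "{v \<in> words n A. \<forall>x<n. v ((g \<circ> w \<circ> inv g) x) = v x} = {v \<in> words n A. v \<circ> (g \<circ> w \<circ> inv g) = v}"
    by (intro Collect_cong conj_cong refl words_fixed_iff) (rule CollectD[OF p])
  moreover have "{v \<in> words n A. \<forall>x<n. v (w x) = v x} = {v \<in> words n A. v \<circ> w = v}"
    by (intro Collect_cong conj_cong refl words_fixed_iff) (rule CollectD[OF w])
  moreover have "bij_betw (\<lambda>v. v \<circ> g) {v \<in> words n A. v \<circ> (g \<circ> w \<circ> inv g) = v} {v \<in> words n A. v \<circ> w = v}"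
  proof (rule bij_betw_byWitness[where f' = "\<lambda>v. v \<circ> inv g"])
    show "\<forall>v\<in>{v \<in> words n A. v \<circ> (g \<circ> w \<circ> inv g) = v}. v \<circ> g \<circ> inv g = v"
      using perms_inv_cancel(3)[OF g] by blast
    show "\<forall>v\<in>{v \<in> words n A. v \<circ> w = v}. v \<circ> inv g \<circ> g = v"
      using perms_inv_cancel(4)[OF g] by blast
    show "(\<lambda>v. v \<circ> g) ` {v \<in> words n A. v \<circ> (g \<circ> w \<circ> inv g) = v} \<subseteq> {v \<in> words n A. v \<circ> w = v}"
    proof
      fix v assume "v \<in> (\<lambda>v. v \<circ> g) ` {v \<in> words n A. v \<circ> (g \<circ> w \<circ> inv g) = v}"
      then obtain u where u: "u \<in> words n A" "u \<circ> (g \<circ> w \<circ> inv g) = u" "v = u \<circ> g" by blast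
      have "v \<circ> w = u \<circ> (g \<circ> w \<circ> inv g) \<circ> g" by (simp only: u(3) comp_assoc id comp_id)
      then show "v \<in> {v \<in> words n A. v \<circ> w = v}" using u words_comp[OF u(1) g] by simp
    qed
    show "(\<lambda>v. v \<circ> inv g) ` {v \<in> words n A. v \<circ> w = v} \<subseteq> {v \<in> words n A. v \<circ> (g \<circ> w \<circ> inv g) = v}"
    proof
      fix v assume "v \<in> (\<lambda>v. v \<circ> inv g) ` {v \<in> words n A. v \<circ> w = v}"
      then obtain u where u: "u \<in> words n A" "u \<circ> w = u" "v = u \<circ> inv g" by blast
      have "v \<circ> (g \<circ> w \<circ> inv g) = u \<circ> w \<circ> inv g" by (simp only: u(3) comp_assoc perms_inv_cancel(1)[OF g])
      then show "v \<in> {v \<in> words n A. v \<circ> (g \<circ> w \<circ> inv g) = v}" using u words_comp[OF u(1) gi] by simp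
    qed
  qed
  ultimately show ?thesis unfolding fixed_words_def by (simp only: bij_betw_same_card)
qed

lemma schur_char_conj:
  "w \<in> perms n \<Longrightarrow> g \<in> perms n \<Longrightarrow> schur_char n \<mu> (g \<circ> w \<circ> inv g) = schur_char n \<mu> w"
  unfolding schur_char_def fixed_vec_def by (simp only: fixed_words_conj)

definition class_function :: "nat \<Rightarrow> ((nat \<Rightarrow> nat) \<Rightarrow> 'a) \<Rightarrow> bool" where
  "class_function n X \<longleftrightarrow> (\<forall>w\<in>perms n. \<forall>g\<in>perms n. X (g \<circ> w \<circ> inv g) = X w)"

lemma class_function_type:
  "class_function n X \<Longrightarrow> w \<in> perms n \<Longrightarrow> v \<in> perms n \<Longrightarrow> cycle_type n w = cycle_type n v \<Longrightarrow> X w = X v"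
  using conjugate_if_same_type[of w n v] unfolding class_function_def by metis

lemma class_function_schur_char: "class_function n (schur_char n \<mu>)"
  using schur_char_conj by (auto simp: class_function_def)

text \<open>Partitions index both the orthonormal functions and, through \<open>cycle_type\<close>,
  the conjugacy classes, so these functions form a basis.\<close>

theorem schur_char_complete:
  fixes X :: "(nat \<Rightarrow> nat) \<Rightarrow> real"
  assumes X: "class_function n X" and w: "w \<in> perms n"
  shows "fact n * X w = (\<Sum>\<mu>\<in>partitions_of n. (\<Sum>v\<in>perms n. X v * schur_char n \<mu> v) * schur_char n \<mu> w)"
proof (rule orthogonal_complete[where ty = "cycle_type n" and G = "perms n"])
  show "(\<Sum>w\<in>perms n. real_of_int (schur_char n a w) * real_of_int (schur_char n b w)) = (if a = b then fact n else 0)"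
    if "a \<in> partitions_of n" "b \<in> partitions_of n" for a b
    using arg_cong[OF schur_char_orthonormal[OF that], of real_of_int] by auto
  show "real_of_int (schur_char n a w) = real_of_int (schur_char n a v)"
    if "w \<in> perms n" "v \<in> perms n" "cycle_type n w = cycle_type n v" for a w v
    using class_function_type[OF class_function_schur_char that] by simp
  show "X w = X v" if "w \<in> perms n" "v \<in> perms n" "cycle_type n w = cycle_type n v" for w v
    using class_function_type[OF X that] .
  show "cycle_type n ` perms n \<subseteq> partitions_of n" using cycle_type_partition by blast
qed (use w in auto)

section \<open>Subgroups and Young symmetrizers\<close>

definition perm_subgroup :: "nat \<Rightarrow> (nat \<Rightarrow> nat) set \<Rightarrow> bool" where
  "perm_subgroup n K \<longleftrightarrow> K \<subseteq> perms n \<and> id \<in> K \<and> (\<forall>a\<in>K. \<forall>b\<in>K. a \<circ> b \<in> K) \<and> (\<forall>a\<in>K. inv a \<in> K)"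

lemma perm_subgroupD:
  assumes "perm_subgroup n K"
  shows "K \<subseteq> perms n" "id \<in> K" "\<And>a b. a \<in> K \<Longrightarrow> b \<in> K \<Longrightarrow> a \<circ> b \<in> K" "\<And>a. a \<in> K \<Longrightarrow> inv a \<in> K" "finite K"
  using assms finite_subset[OF _ finite_perms[of n], of K] by (auto simp: perm_subgroup_def)

lemma inv_comp_perms: "a \<in> perms n \<Longrightarrow> b \<in> perms n \<Longrightarrow> inv (a \<circ> b) = inv b \<circ> inv a"
  by (auto intro!: o_inv_distrib permutes_bij)

lemma sum_subgroup_shift:
  assumes K: "perm_subgroup n K" and a: "a \<in> K"
  shows "(\<Sum>k\<in>K. h (k \<circ> a)) = sum h K" "(\<Sum>k\<in>K. h (a \<circ> k)) = sum h K"
proof -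
  note D = perm_subgroupD[OF K]
  have p: "a \<in> perms n" using D(1) a by blast
  show "(\<Sum>k\<in>K. h (k \<circ> a)) = sum h K"
    by (rule sum.reindex_bij_witness[where i = "\<lambda>k. k \<circ> inv a" and j = "\<lambda>k. k \<circ> a"])
      (use D(3,4) a perms_inv_cancel[OF p] in auto)
  show "(\<Sum>k\<in>K. h (a \<circ> k)) = sum h K"
    by (rule sum.reindex_bij_witness[where i = "\<lambda>k. inv a \<circ> k" and j = "\<lambda>k. a \<circ> k"])
      (use D(3,4) a perms_inv_cancel[OF p] in auto)
qed

definition stab :: "nat \<Rightarrow> (nat \<Rightarrow> 'b) \<Rightarrow> (nat \<Rightarrow> nat) set" where
  "stab n f = {w \<in> perms n. \<forall>x<n. f (w x) = f x}"

lemma perm_subgroup_stab: "perm_subgroup n (stab n f)"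
proof -
  have "inv a \<in> stab n f" if a: "a \<in> stab n f" for a
  proof -
    have p: "a \<in> perms n" and f: "\<And>x. x < n \<Longrightarrow> f (a x) = f x" using a by (auto simp: stab_def)
    have pi: "inv a \<in> perms n" using p by (auto intro: permutes_inv)
    have "f (inv a x) = f x" if "x < n" for x
      using f[of "inv a x"] perms_less[OF pi, of x] that permutes_inverses(1)[of a "{..<n}" x] p by simp
    then show ?thesis using pi by (simp add: stab_def)
  qed
  moreover have "a \<circ> b \<in> stab n f" if "a \<in> stab n f" "b \<in> stab n f" for a b
    using that perms_less by (auto simp: stab_def intro: permutes_compose)
  ultimately show ?thesis by (auto simp: perm_subgroup_def stab_def)
qed

text \<open>Sending the pair of \<open>r\<close> and \<open>c\<close> to \<open>f r\<close> and
  \<open>c \<circ> t\<close> is a sign-reversing involution. The summand stays the same because the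
  transposition is absorbed: by a word in one application, where \<open>f\<close> is the identity,
  and by the row group of another diagram in the other.\<close>

lemma sign_cancel:
  fixes K :: "'r \<Rightarrow> (nat \<Rightarrow> nat) \<Rightarrow> int"
  assumes R: "\<And>r. r \<in> R \<Longrightarrow> f r \<in> R \<and> f (f r) = r"
    and C: "\<And>c. c \<in> C \<Longrightarrow> c \<circ> t \<in> C \<and> permutation c" and t: "t \<circ> t = id" "permutation t" "sign t = -1"
    and K: "\<And>r c. r \<in> R \<Longrightarrow> c \<in> C \<Longrightarrow> K (f r) (c \<circ> t) = K r c"
  shows "(\<Sum>r\<in>R. \<Sum>c\<in>C. sign c * K r c) = 0"
proof -
  have tt: "c \<circ> t \<circ> t = c" for c using t(1) by (simp add: comp_assoc)
  let ?P = "\<Sum>(r, c)\<in>R \<times> C. sign c * K r c"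
  have "?P = (\<Sum>(r, c)\<in>R \<times> C. - (sign c * K r c))"
    by (rule sum.reindex_bij_witness[where i = "\<lambda>(r, c). (f r, c \<circ> t)" and j = "\<lambda>(r, c). (f r, c \<circ> t)"])
      (use R C K t tt in \<open>auto simp: sign_compose\<close>)
  also have "\<dots> = - ?P" by (simp add: split_def sum_negf)
  finally have "?P = 0" by linarith
  then show ?thesis by (simp add: sum.cartesian_product)
qed

text \<open>An arbitrary bijective filling of the diagram by the points; the row and column groups are the
  stabilizers of \<open>row_of\<close> and \<open>col_of\<close>.\<close>

definition placement :: "nat \<Rightarrow> nat list \<Rightarrow> nat \<Rightarrow> nat \<times> nat" where
  "placement n \<mu> = (SOME p. bij_betw p {..<n} (cells \<mu>))"

abbreviation row_of :: "nat \<Rightarrow> nat list \<Rightarrow> nat \<Rightarrow> nat" where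
  "row_of n \<mu> x \<equiv> fst (placement n \<mu> x)"

abbreviation col_of :: "nat \<Rightarrow> nat list \<Rightarrow> nat \<Rightarrow> nat" where
  "col_of n \<mu> x \<equiv> snd (placement n \<mu> x)"

lemma placement:
  assumes "\<mu> \<in> partitions_of n" shows "bij_betw (placement n \<mu>) {..<n} (cells \<mu>)"
proof -
  obtain p where "bij_betw p {..<n} (cells \<mu>)"
    using finite_same_card_bij[of "{..<n}" "cells \<mu>"] card_cells_partition[OF assms] by auto
  then show ?thesis unfolding placement_def by (rule someI[of "\<lambda>p. bij_betw p {..<n} (cells \<mu>)"])
qed

text \<open>The coefficient function of the Young symmetrizer, the group algebra element adding up
  \<open>sign c\<close> times \<open>r \<circ> c\<close>, summed over all conjugates. It is left
  unnormalized, as only the sign of its ratio to \<open>schur_char\<close> matters.\<close>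

definition young_char :: "nat \<Rightarrow> nat list \<Rightarrow> (nat \<Rightarrow> nat) \<Rightarrow> int" where
  "young_char n \<mu> w = (\<Sum>g\<in>perms n. \<Sum>r\<in>stab n (row_of n \<mu>). \<Sum>c\<in>stab n (col_of n \<mu>).
     sign c * (if g \<circ> w \<circ> inv g = r \<circ> c then 1 else 0))"

text \<open>The linear extension of \<open>X\<close> to the group algebra, evaluated at the Young
  symmetrizer.\<close>

definition young_sum :: "nat \<Rightarrow> nat list \<Rightarrow> ((nat \<Rightarrow> nat) \<Rightarrow> 'a) \<Rightarrow> 'a :: comm_ring_1" where
  "young_sum n \<mu> X = (\<Sum>r\<in>stab n (row_of n \<mu>). \<Sum>c\<in>stab n (col_of n \<mu>). of_int (sign c) * X (r \<circ> c))"

lemma stab_perms: "w \<in> stab n f \<Longrightarrow> w \<in> perms n"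
  by (simp add: stab_def)

lemma comp_perms: "a \<in> perms n \<Longrightarrow> b \<in> perms n \<Longrightarrow> a \<circ> b \<in> perms n"
  by (auto intro: permutes_compose)

lemma inv_perms: "a \<in> perms n \<Longrightarrow> inv a \<in> perms n"
  by (auto intro: permutes_inv)

lemma conj_eq_iff:
  assumes "g \<in> perms n"
  shows "g \<circ> w \<circ> inv g = u \<longleftrightarrow> w = inv g \<circ> u \<circ> g"
proof
  assume "g \<circ> w \<circ> inv g = u"
  then show "w = inv g \<circ> u \<circ> g"
    by (elim subst) (simp only: comp_assoc perms_inv_cancel[OF assms] comp_id)
next
  assume "w = inv g \<circ> u \<circ> g"
  then show "g \<circ> w \<circ> inv g = u"
    by (simp only: comp_assoc perms_inv_cancel[OF assms] comp_id)
qed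

lemma sum_rotate: "(\<Sum>w\<in>A. \<Sum>r\<in>B. \<Sum>c\<in>C. h w r c) = (\<Sum>r\<in>B. \<Sum>c\<in>C. \<Sum>w\<in>A. h w r c)"
proof -
  have "(\<Sum>w\<in>A. \<Sum>r\<in>B. \<Sum>c\<in>C. h w r c) = (\<Sum>r\<in>B. \<Sum>w\<in>A. \<Sum>c\<in>C. h w r c)" by (rule sum.swap)
  also have "\<dots> = (\<Sum>r\<in>B. \<Sum>c\<in>C. \<Sum>w\<in>A. h w r c)" by (rule sum.cong[OF refl]) (rule sum.swap)
  finally show ?thesis .
qed

text \<open>Each \<open>g\<close> and each pair \<open>r\<close>, \<open>c\<close> single out one
  conjugate of \<open>r \<circ> c\<close>, where a class function takes the same value; the choices
  of \<open>g\<close> give the factor \<open>fact n\<close>.\<close>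

lemma pairing_young_char:
  fixes X :: "(nat \<Rightarrow> nat) \<Rightarrow> 'a :: {comm_ring_1, ring_char_0}"
  assumes X: "class_function n X"
  shows "(\<Sum>w\<in>perms n. X w * of_int (young_char n \<mu> w)) = fact n * young_sum n \<mu> X"
proof -
  let ?R = "stab n (row_of n \<mu>)" and ?C = "stab n (col_of n \<mu>)"
  have inner: "(\<Sum>w\<in>perms n. X w * (of_int (sign c) * (if g \<circ> w \<circ> inv g = r \<circ> c then 1 else 0))) = of_int (sign c) * X (r \<circ> c)"
    if g: "g \<in> perms n" and r: "r \<in> ?R" and c: "c \<in> ?C" for g r c
  proof -
    have rc: "r \<circ> c \<in> perms n" using stab_perms[OF r] stab_perms[OF c] by (rule comp_perms)
    let ?w = "inv g \<circ> (r \<circ> c) \<circ> inv (inv g)"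
    have w: "?w \<in> perms n" using comp_perms[OF comp_perms[OF inv_perms[OF g] rc] inv_perms[OF inv_perms[OF g]]] .
    have Xw: "X ?w = X (r \<circ> c)" using X rc inv_perms[OF g] unfolding class_function_def by blast
    have "(\<Sum>w\<in>perms n. X w * (of_int (sign c) * (if g \<circ> w \<circ> inv g = r \<circ> c then 1 else 0)))
        = (\<Sum>w\<in>perms n. if w = ?w then X w * of_int (sign c) else 0)"
      using conj_eq_iff[OF g] perms_inv_cancel(5)[OF g] by (intro sum.cong refl) auto
    also have "\<dots> = of_int (sign c) * X (r \<circ> c)" using w Xw by (simp add: mult.commute)
    finally show ?thesis .
  qed
  have "(\<Sum>w\<in>perms n. X w * of_int (young_char n \<mu> w))
      = (\<Sum>w\<in>perms n. \<Sum>g\<in>perms n. \<Sum>r\<in>?R. \<Sum>c\<in>?C. X w * (of_int (sign c) * (if g \<circ> w \<circ> inv g = r \<circ> c then 1 else 0)))"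
    unfolding young_char_def of_int_sum sum_distrib_left by (intro sum.cong refl) auto
  also have "\<dots> = (\<Sum>g\<in>perms n. \<Sum>w\<in>perms n. \<Sum>r\<in>?R. \<Sum>c\<in>?C. X w * (of_int (sign c) * (if g \<circ> w \<circ> inv g = r \<circ> c then 1 else 0)))"
    by (rule sum.swap)
  also have "\<dots> = (\<Sum>g\<in>perms n. \<Sum>r\<in>?R. \<Sum>c\<in>?C. \<Sum>w\<in>perms n. X w * (of_int (sign c) * (if g \<circ> w \<circ> inv g = r \<circ> c then 1 else 0)))"
    by (intro sum.cong refl sum_rotate)
  also have "\<dots> = (\<Sum>g\<in>perms n. \<Sum>r\<in>?R. \<Sum>c\<in>?C. of_int (sign c) * X (r \<circ> c))"
    by (intro sum.cong refl inner)
  also have "\<dots> = fact n * young_sum n \<mu> X" by (simp add: young_sum_def card_permutations)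
  finally show ?thesis .
qed

lemma class_function_young_char: "class_function n (young_char n \<mu>)"
  unfolding class_function_def
proof (intro ballI)
  fix w h assume w: "w \<in> perms n" and h: "h \<in> perms n"
  have "young_char n \<mu> (h \<circ> w \<circ> inv h) = (\<Sum>g\<in>perms n. \<Sum>r\<in>stab n (row_of n \<mu>). \<Sum>c\<in>stab n (col_of n \<mu>).
     sign c * (if (g \<circ> h) \<circ> w \<circ> inv (g \<circ> h) = r \<circ> c then 1 else 0))"
    unfolding young_char_def
    by (intro sum.cong refl) (simp only: inv_comp_perms[OF _ h] comp_assoc)
  also have "\<dots> = young_char n \<mu> w"
    unfolding young_char_def
    by (rule sum.reindex_bij_witness[where i = "\<lambda>g. g \<circ> inv h" and j = "\<lambda>g. g \<circ> h"])
      (use h perms_inv_cancel[OF h] in \<open>auto intro!: permutes_compose permutes_inv\<close>)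
  finally show "young_char n \<mu> (h \<circ> w \<circ> inv h) = young_char n \<mu> w" .
qed

section \<open>Symmetrizers and dominance\<close>

lemma partition_columns:
  assumes \<mu>: "\<mu> \<in> partitions_of n" and b: "i' \<le> i" "(i, b) \<in> cells \<mu>"
  shows "(i', b) \<in> cells \<mu>"
proof -
  have "\<mu> ! i \<le> \<mu> ! i'" using partitions_ofD(4)[OF \<mu> b(1)] b by (auto simp: part_at_def cells_def)
  then show ?thesis using b by (auto simp: cells_def)
qed

text \<open>A column holds at most \<open>k\<close> distinct letters below \<open>k\<close> and at
  most as many as it has cells, hence no more than it has cells in the first \<open>k\<close> rows.
  Summing over the columns gives dominance.\<close>

lemma column_injective_dominated:
  assumes \<mu>: "\<mu> \<in> partitions_of n" and v: "v \<in> words n B"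
    and inj: "\<And>x y. x < n \<Longrightarrow> y < n \<Longrightarrow> x \<noteq> y \<Longrightarrow> col_of n \<mu> x = col_of n \<mu> y \<Longrightarrow> v x \<noteq> v y"
  shows "dominated B \<mu>"
  unfolding dominated_def
proof
  fix k
  have bij: "bij_betw (placement n \<mu>) {..<n} (cells \<mu>)" by (rule placement[OF \<mu>])
  define Col where "Col = (\<lambda>b. {x. x < n \<and> col_of n \<mu> x = b})"
  have fin: "finite (Col b)" for b by (simp add: Col_def)
  have le: "card {x \<in> Col b. v x < k} \<le> card {x \<in> Col b. row_of n \<mu> x < k}" for b
  proof -
    have ir: "inj_on (row_of n \<mu>) (Col b)"
    proof (rule inj_onI)
      fix x y assume x: "x \<in> Col b" and y: "y \<in> Col b" and e: "row_of n \<mu> x = row_of n \<mu> y"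
      then have "placement n \<mu> x = placement n \<mu> y" by (auto simp: Col_def prod_eq_iff)
      then show "x = y" using bij x y by (auto simp: bij_betw_def Col_def dest: inj_onD)
    qed
    \<comment> \<open>The rows met by a column form an initial segment, since the diagram is that of
      a partition.\<close>
    have down: "j \<in> row_of n \<mu> ` Col b" if "i \<in> row_of n \<mu> ` Col b" "j < i" for i j
    proof -
      from that(1) obtain x where "x \<in> Col b" "i = row_of n \<mu> x" by blast
      then have x: "x < n" "placement n \<mu> x = (i, b)" by (auto simp: Col_def prod_eq_iff)
      then have "(i, b) \<in> cells \<mu>" using bij by (metis bij_betwE lessThan_iff)
      then have "(j, b) \<in> cells \<mu>" using partition_columns[OF \<mu>] that(2) by (meson less_imp_le)
      then obtain y where "y < n" "placement n \<mu> y = (j, b)"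
        using bij by (metis bij_betw_def imageE lessThan_iff)
      then show ?thesis by (intro image_eqI[where x = y]) (auto simp: Col_def)
    qed
    have "row_of n \<mu> ` Col b = {..<card (row_of n \<mu> ` Col b)}"
      by (rule down_closed_nat) (use fin down in auto)
    then have rc: "row_of n \<mu> ` Col b = {..<card (Col b)}" using card_image[OF ir] by simp
    have "card {x \<in> Col b. row_of n \<mu> x < k} = card (row_of n \<mu> ` {x \<in> Col b. row_of n \<mu> x < k})"
      by (rule card_image[symmetric]) (rule inj_on_subset[OF ir], auto)
    also have "row_of n \<mu> ` {x \<in> Col b. row_of n \<mu> x < k} = row_of n \<mu> ` Col b \<inter> {..<k}" by auto
    also have "card \<dots> = min (card (Col b)) k"
    proof -
      have "row_of n \<mu> ` Col b \<inter> {..<k} = {..<min (card (Col b)) k}" unfolding rc by auto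
      then show ?thesis by simp
    qed
    finally have r: "card {x \<in> Col b. row_of n \<mu> x < k} = min (card (Col b)) k" .
    have "card {x \<in> Col b. v x < k} = card (v ` {x \<in> Col b. v x < k})"
     
    proof (rule card_image[symmetric], rule inj_onI)
      fix x y assume "x \<in> {x \<in> Col b. v x < k}" "y \<in> {x \<in> Col b. v x < k}" "v x = v y"
      then show "x = y" using inj[of x y] by (auto simp: Col_def)
    qed
    also have "\<dots> \<le> card {..<k}" by (rule card_mono) auto
    finally have "card {x \<in> Col b. v x < k} \<le> k" by simp
    moreover have "card {x \<in> Col b. v x < k} \<le> card (Col b)" by (rule card_mono) (use fin in auto)
    ultimately show ?thesis using r by simp
  qed
  have split: "card {x. x < n \<and> P x} = (\<Sum>b\<in>col_of n \<mu> ` {..<n}. card {x \<in> Col b. P x})" for P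
  proof -
    have "(\<Sum>b\<in>col_of n \<mu> ` {..<n}. sum (\<lambda>_. 1) {x \<in> {x. x < n \<and> P x}. col_of n \<mu> x = b}) = sum (\<lambda>_. 1 :: nat) {x. x < n \<and> P x}"
      by (rule sum.group) auto
    moreover have "{x \<in> {x. x < n \<and> P x}. col_of n \<mu> x = b} = {x \<in> Col b. P x}" for b
      by (auto simp: Col_def)
    ultimately show ?thesis by simp
  qed
  have "size (filter_mset (\<lambda>x. x < k) B) = card {x. x < n \<and> v x < k}"
    unfolding words_mset[OF v, symmetric] filter_image_mset by (simp add: filter_mset_mset_set)
  also have "\<dots> \<le> card {x. x < n \<and> row_of n \<mu> x < k}" unfolding split by (rule sum_mono) (rule le)
  also have "\<dots> = card {c \<in> cells \<mu>. fst c < k}"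
  proof (rule bij_betw_same_card[of "placement n \<mu>"])
    have im: "placement n \<mu> ` {..<n} = cells \<mu>" using bij by (simp add: bij_betw_def)
    have "placement n \<mu> ` {x. x < n \<and> row_of n \<mu> x < k} = {c \<in> cells \<mu>. fst c < k}"
      unfolding im[symmetric] by auto
    then show "bij_betw (placement n \<mu>) {x. x < n \<and> row_of n \<mu> x < k} {c \<in> cells \<mu>. fst c < k}"
      by (intro bij_betw_subset[OF bij]) auto
  qed
  also have "{c \<in> cells \<mu>. fst c < k} \<subseteq> cells (shape k (part_at \<mu>))"
    by (auto simp: cells_def part_at_def shape_def)
  then have "card {c \<in> cells \<mu>. fst c < k} \<le> card (cells (shape k (part_at \<mu>)))" by (intro card_mono) auto
  also have "\<dots> = (\<Sum>j<k. part_at \<mu> j)" by (rule card_cells_shape)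
  finally show "size (filter_mset (\<lambda>x. x < k) B) \<le> (\<Sum>j<k. part_at \<mu> j)" .
qed

text \<open>If \<open>B\<close> is not dominated, every word of content \<open>B\<close> repeats a
  letter within some column. The transposition of the two places fixes the word and lies in the
  column group, so the signs cancel word by word.\<close>

lemma young_sum_fixed_words_nonzero:
  assumes \<mu>: "\<mu> \<in> partitions_of n" and nz: "young_sum n \<mu> (\<lambda>w. int (fixed_words n B w)) \<noteq> 0"
  shows "dominated B \<mu>"
proof (rule ccontr)
  assume nd: "\<not> dominated B \<mu>"
  let ?R = "stab n (row_of n \<mu>)" and ?C = "stab n (col_of n \<mu>)"
  have z: "(\<Sum>r\<in>?R. \<Sum>c\<in>?C. sign c * (if v \<circ> (r \<circ> c) = v then 1 else 0)) = (0 :: int)" if v: "v \<in> words n B" for v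
  proof -
    obtain x y where xy: "x < n" "y < n" "x \<noteq> y" "col_of n \<mu> x = col_of n \<mu> y" "v x = v y"
      using column_injective_dominated[OF \<mu> v] nd by blast
    let ?t = "transpose x y"
    have t: "?t \<in> ?C"
      using xy permutes_swap_id[of x "{..<n}" y] by (auto simp: stab_def transpose_def)
    have vt: "v \<circ> ?t = v" using xy by (auto simp: fun_eq_iff transpose_def)
    show ?thesis
    proof (rule sign_cancel[where f = "\<lambda>r. r" and t = ?t])
      show "c \<circ> ?t \<in> ?C \<and> permutation c" if "c \<in> ?C" for c
        using perm_subgroupD(3)[OF perm_subgroup_stab that t] permutation_perms[OF stab_perms[OF that]] by blast
      show "(if v \<circ> (r \<circ> (c \<circ> ?t)) = v then 1 else 0) = (if v \<circ> (r \<circ> c) = v then 1 else (0 :: int))" for r c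
      proof -
        have "v \<circ> (r \<circ> (c \<circ> ?t)) = v \<longleftrightarrow> v \<circ> (r \<circ> c) \<circ> ?t = v \<circ> ?t" by (simp only: vt comp_assoc)
        also have "\<dots> \<longleftrightarrow> v \<circ> (r \<circ> c) = v"
        proof
          assume "v \<circ> (r \<circ> c) \<circ> ?t = v \<circ> ?t"
          then have "v \<circ> (r \<circ> c) \<circ> ?t \<circ> ?t = v \<circ> ?t \<circ> ?t" by simp
          then show "v \<circ> (r \<circ> c) = v" by (simp only: comp_assoc transpose_comp_involutory comp_id)
        qed simp
        finally show ?thesis by simp
      qed
    qed (use xy in \<open>auto simp: permutation_swap_id sign_swap_id\<close>)
  qed
  have "young_sum n \<mu> (\<lambda>w. int (fixed_words n B w))
      = (\<Sum>r\<in>?R. \<Sum>c\<in>?C. \<Sum>v\<in>words n B. sign c * (if v \<circ> (r \<circ> c) = v then 1 else 0))"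
    unfolding young_sum_def
  proof (intro sum.cong refl)
    fix r c assume "r \<in> ?R" "c \<in> ?C"
    then have p: "(r \<circ> c) permutes {..<n}" using comp_perms[OF stab_perms stab_perms] by blast
    have "int (fixed_words n B (r \<circ> c)) = (\<Sum>v\<in>words n B. if v \<circ> (r \<circ> c) = v then 1 else 0)"
      unfolding fixed_words_def words_fixed_iff[OF p] by (simp add: sum.If_cases Int_def)
    then show "of_int (sign c) * int (fixed_words n B (r \<circ> c)) = (\<Sum>v\<in>words n B. sign c * (if v \<circ> (r \<circ> c) = v then 1 else 0))"
      by (simp add: sum_distrib_left)
  qed
  also have "\<dots> = (\<Sum>v\<in>words n B. \<Sum>r\<in>?R. \<Sum>c\<in>?C. sign c * (if v \<circ> (r \<circ> c) = v then 1 else 0))"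
    by (rule sum_rotate[symmetric])
  also have "\<dots> = 0" using z by (intro sum.neutral) blast
  finally show False using nz by simp
qed

lemma content_row_of:
  assumes \<mu>: "\<mu> \<in> partitions_of n"
  shows "image_mset (row_of n \<mu>) (mset_set {..<n}) = vec_mset n (\<lambda>j. int (part_at \<mu> j))"
proof -
  have bij: "bij_betw (placement n \<mu>) {..<n} (cells \<mu>)" by (rule placement[OF \<mu>])
  have "image_mset (row_of n \<mu>) (mset_set {..<n}) = image_mset fst (image_mset (placement n \<mu>) (mset_set {..<n}))"
    by (simp add: multiset.map_comp comp_def)
  also have "image_mset (placement n \<mu>) (mset_set {..<n}) = mset_set (cells \<mu>)"
    using bij by (simp add: image_mset_mset_set bij_betw_def)
  also have "image_mset fst (mset_set (cells \<mu>)) = vec_mset n (\<lambda>j. int (part_at \<mu> j))"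
    using image_mset_fst_cells[of n "part_at \<mu>"] cells_part_at[OF \<mu>] by simp
  finally show ?thesis .
qed

text \<open>Von Neumann's lemma on two tableaux: if \<open>g\<close> sends two points of one row of
  \<open>\<mu>\<close> into one column of \<open>\<nu>\<close>, their transposition lies in the row
  group of \<open>\<mu>\<close>, its conjugate in the column group of \<open>\<nu>\<close>, and the
  signs cancel. So some \<open>g\<close> spreads every row of \<open>\<mu>\<close> over distinct
  columns of \<open>\<nu>\<close>, which yields dominance.\<close>

lemma pairing_young_chars_nonzero:
  assumes \<mu>: "\<mu> \<in> partitions_of n" and \<nu>: "\<nu> \<in> partitions_of n"
    and nz: "(\<Sum>w\<in>perms n. young_char n \<nu> w * young_char n \<mu> w) \<noteq> 0"
  shows "dominance n \<mu> \<nu>"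
proof -
  let ?R = "stab n (row_of n \<mu>)" and ?C = "stab n (col_of n \<mu>)"
  let ?R' = "stab n (row_of n \<nu>)" and ?C' = "stab n (col_of n \<nu>)"
  have "young_sum n \<mu> (young_char n \<nu>) \<noteq> 0"
    using nz pairing_young_char[OF class_function_young_char, of n \<nu> \<mu>] by auto
  \<comment> \<open>Conjugation by \<open>r\<close> turns \<open>r \<circ> c\<close> into
    \<open>c \<circ> r\<close>. Now \<open>r\<close> and \<open>c'\<close> are the rightmost
    summation variables on the two sides of
    \<open>g \<circ> (c \<circ> r) \<circ> inv g = r' \<circ> c'\<close>, so a transposition can be
    cancelled while \<open>c\<close>, \<open>g\<close> and \<open>r'\<close> are fixed.\<close>
  moreover have "young_sum n \<mu> (young_char n \<nu>) = (\<Sum>r\<in>?R. \<Sum>c\<in>?C. sign c * young_char n \<nu> (c \<circ> r))"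
    unfolding young_sum_def
  proof (intro sum.cong refl)
    fix r c assume rc: "r \<in> ?R" "c \<in> ?C"
    have "young_char n \<nu> (r \<circ> c) = young_char n \<nu> (r \<circ> (c \<circ> r) \<circ> inv r)"
      using perms_inv_cancel[OF stab_perms[OF rc(1)]] by (simp only: comp_assoc comp_id)
    also have "\<dots> = young_char n \<nu> (c \<circ> r)"
      using class_function_young_char[of n \<nu>] stab_perms[OF rc(1)] comp_perms[OF stab_perms[OF rc(2)] stab_perms[OF rc(1)]]
      unfolding class_function_def by blast
    finally show "of_int (sign c) * young_char n \<nu> (r \<circ> c) = sign c * young_char n \<nu> (c \<circ> r)" by simp
  qed
  moreover have "\<dots> = (\<Sum>r\<in>?R. \<Sum>c\<in>?C. \<Sum>g\<in>perms n. \<Sum>r'\<in>?R'. sign c * (\<Sum>c'\<in>?C'. sign c' * (if g \<circ> (c \<circ> r) \<circ> inv g = r' \<circ> c' then 1 else 0)))"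
    by (simp only: young_char_def sum_distrib_left)
  moreover have "\<dots> = (\<Sum>c\<in>?C. \<Sum>g\<in>perms n. \<Sum>r\<in>?R. \<Sum>r'\<in>?R'. sign c * (\<Sum>c'\<in>?C'. sign c' * (if g \<circ> (c \<circ> r) \<circ> inv g = r' \<circ> c' then 1 else 0)))"
    by (rule sum_rotate)
  moreover have "\<dots> = (\<Sum>c\<in>?C. \<Sum>g\<in>perms n. \<Sum>r'\<in>?R'. sign c * (\<Sum>r\<in>?R. \<Sum>c'\<in>?C'. sign c' * (if g \<circ> (c \<circ> r) \<circ> inv g = r' \<circ> c' then 1 else 0)))"
    by (rule sum.cong[OF refl], rule sum.cong[OF refl], subst sum.swap, simp only: sum_distrib_left)
  ultimately have "\<exists>c\<in>?C. \<exists>g\<in>perms n. \<exists>r'\<in>?R'. (\<Sum>r\<in>?R. \<Sum>c'\<in>?C'. sign c' * (if g \<circ> (c \<circ> r) \<circ> inv g = r' \<circ> c' then 1 else 0)) \<noteq> (0 :: int)"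
    by (metis (no_types, lifting) mult_zero_right sum.neutral)
  then obtain c g r' where g: "g \<in> perms n"
    and nz1: "(\<Sum>r\<in>?R. \<Sum>c'\<in>?C'. sign c' * (if g \<circ> (c \<circ> r) \<circ> inv g = r' \<circ> c' then 1 else 0)) \<noteq> (0 :: int)"
    by blast
  have gi: "inv g \<in> perms n" using g by (rule inv_perms)
  have inj: "row_of n \<mu> x \<noteq> row_of n \<mu> y"
    if xy: "x < n" "y < n" "x \<noteq> y" and col: "col_of n \<nu> (g x) = col_of n \<nu> (g y)" for x y
  proof
    assume row: "row_of n \<mu> x = row_of n \<mu> y"
    let ?t = "transpose x y" and ?u = "transpose (g x) (g y)"
    have gxy: "g x < n" "g y < n" using perms_less[OF g] xy by auto
    have gne: "g x \<noteq> g y" using g xy permutes_inj[of g "{..<n}"] by (auto dest: injD)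
    have t: "?t \<in> ?R" using xy row permutes_swap_id[of x "{..<n}" y] by (auto simp: stab_def transpose_def)
    have u: "?u \<in> ?C'" using gxy col permutes_swap_id[of "g x" "{..<n}" "g y"] by (auto simp: stab_def transpose_def)
    have gt: "g \<circ> ?t = ?u \<circ> g"
      using permutes_inj[of g "{..<n}"] g by (auto simp: fun_eq_iff transpose_def dest: injD)
    have "(\<Sum>r\<in>?R. \<Sum>c'\<in>?C'. sign c' * (if g \<circ> (c \<circ> r) \<circ> inv g = r' \<circ> c' then 1 else 0)) = (0 :: int)"
    proof (rule sign_cancel[where f = "\<lambda>r. r \<circ> ?t" and t = ?u])
      show "r \<circ> ?t \<in> ?R \<and> r \<circ> ?t \<circ> ?t = r" if "r \<in> ?R" for r
        using perm_subgroupD(3)[OF perm_subgroup_stab that t] by (simp only: comp_assoc transpose_comp_involutory comp_id)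
      show "k \<circ> ?u \<in> ?C' \<and> permutation k" if "k \<in> ?C'" for k
        using perm_subgroupD(3)[OF perm_subgroup_stab that u] permutation_perms[OF stab_perms[OF that]] by blast
      show "(if g \<circ> (c \<circ> (r \<circ> ?t)) \<circ> inv g = r' \<circ> (k \<circ> ?u) then 1 else 0) = (if g \<circ> (c \<circ> r) \<circ> inv g = r' \<circ> k then 1 else (0 :: int))" for r k
      proof -
        have ti: "?t \<circ> inv g = inv g \<circ> ?u"
        proof -
          have "?t \<circ> inv g = inv g \<circ> (g \<circ> ?t) \<circ> inv g" by (simp only: comp_assoc perms_inv_cancel[OF g])
          also have "\<dots> = inv g \<circ> ?u" unfolding gt by (simp only: comp_assoc perms_inv_cancel[OF g] comp_id)
          finally show ?thesis .
        qed
        have "g \<circ> (c \<circ> (r \<circ> ?t)) \<circ> inv g = g \<circ> (c \<circ> r) \<circ> inv g \<circ> ?u"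
          by (simp only: comp_assoc ti)
        moreover have "r' \<circ> (k \<circ> ?u) = r' \<circ> k \<circ> ?u" by (simp only: comp_assoc)
        moreover have "a \<circ> ?u = b \<circ> ?u \<longleftrightarrow> a = b" for a b :: "nat \<Rightarrow> nat"
        proof
          assume "a \<circ> ?u = b \<circ> ?u"
          then have "a \<circ> ?u \<circ> ?u = b \<circ> ?u \<circ> ?u" by simp
          then show "a = b" by (simp only: comp_assoc transpose_comp_involutory comp_id)
        qed simp
        ultimately show ?thesis by simp
      qed
    qed (use gne in \<open>auto simp: permutation_swap_id sign_swap_id\<close>)
    then show False using nz1 by simp
  qed
  \<comment> \<open>Labels a point by the row of \<open>\<mu>\<close> that it comes from under
    \<open>g\<close>; no label repeats within a column of \<open>\<nu>\<close>.\<close>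
  define v where "v = restrict (row_of n \<mu> \<circ> inv g) {..<n}"
  have "image_mset v (mset_set {..<n}) = image_mset (row_of n \<mu>) (image_mset (inv g) (mset_set {..<n}))"
    unfolding v_def by (simp add: multiset.map_comp) (intro image_mset_cong, simp)
  also have "image_mset (inv g) (mset_set {..<n}) = mset_set {..<n}"
    using gi by (intro permutes_image_mset) auto
  also have "image_mset (row_of n \<mu>) (mset_set {..<n}) = vec_mset n (\<lambda>j. int (part_at \<mu> j))"
    by (rule content_row_of[OF \<mu>])
  finally have "image_mset v (mset_set {..<n}) = vec_mset n (\<lambda>j. int (part_at \<mu> j))" .
  then have v: "v \<in> words n (vec_mset n (\<lambda>j. int (part_at \<mu> j)))"
    by (rule wordsI[rotated]) (simp add: v_def)
  have d: "dominated (vec_mset n (\<lambda>j. int (part_at \<mu> j))) \<nu>"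
  proof (rule column_injective_dominated[OF \<nu> v])
    fix x y assume xy: "x < n" "y < n" "x \<noteq> y" "col_of n \<nu> x = col_of n \<nu> y"
    have i: "inv g x < n" "inv g y < n" using perms_less[OF gi] xy by auto
    have gg: "g (inv g z) = z" for z using permutes_inverses(1)[of g "{..<n}" z] g by simp
    have "inv g x \<noteq> inv g y" using xy(3) gg by metis
    then have "row_of n \<mu> (inv g x) \<noteq> row_of n \<mu> (inv g y)" using inj[OF i] xy(4) gg by simp
    then show "v x \<noteq> v y" using xy by (simp add: v_def)
  qed
  have "(\<Sum>j<k. part_at \<mu> j) \<le> (\<Sum>j<k. part_at \<nu> j)" if "k \<le> n" for k
    using size_filter_vec_mset[OF that, of "\<lambda>j. int (part_at \<mu> j)"] d[unfolded dominated_def, rule_format, of k] by simp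
  then show ?thesis by (simp add: dominance_def)
qed

text \<open>The regular character. The value at \<open>id\<close> is read off from
  \<open>sum_fixed_words\<close>, since all other summands vanish.\<close>

lemma fixed_words_distinct:
  assumes "w \<in> perms n"
  shows "fixed_words n (mset_set {..<n}) w = (if w = id then fact n else 0)"
proof -
  have *: "fixed_words n (mset_set {..<n}) w = 0" if w: "w \<in> perms n" "w \<noteq> id" for w
  proof -
    have "\<not> (\<forall>x<n. v (w x) = v x)" if v: "v \<in> words n (mset_set {..<n})" for v
    proof
      assume f: "\<forall>x<n. v (w x) = v x"
      have im: "v ` {..<n} = {..<n}"
        using arg_cong[OF words_mset[OF v], of set_mset] by simp
      have inj: "inj_on v {..<n}" by (rule eq_card_imp_inj_on) (simp_all add: im)
      have "w x = x" for x
      proof (cases "x < n")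
        case True
        then show ?thesis using inj_onD[OF inj, of "w x" x] f perms_less[OF w(1), of x] by simp
      next
        case False
        then show ?thesis using permutes_not_in[of w "{..<n}" x] w by simp
      qed
      then show False using w(2) by auto
    qed
    then have "{v \<in> words n (mset_set {..<n}). \<forall>x<n. v (w x) = v x} = {}" by blast
    then show ?thesis by (simp only: fixed_words_def card.empty)
  qed
  have "fact n = (\<Sum>w\<in>perms n. fixed_words n (mset_set {..<n}) w)"
    by (rule sum_fixed_words[symmetric]) simp
  also have "\<dots> = (\<Sum>w\<in>perms n. if w = id then fixed_words n (mset_set {..<n}) id else 0)"
    using * by (intro sum.cong) auto
  also have "\<dots> = fixed_words n (mset_set {..<n}) id" by simp
  finally show ?thesis using * assms by simp
qed

text \<open>Pairing with the regular character shows the value at \<open>id\<close> to be the number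
  of standard tableaux. It decides the sign of the factor in
  \<open>young_char_proportional\<close>.\<close>

lemma schur_char_id_nonneg:
  assumes \<mu>: "\<mu> \<in> partitions_of n" shows "schur_char n \<mu> id \<ge> 0"
proof -
  have "fact n * int (ssyt_count \<mu> (mset_set {..<n})) = (\<Sum>w\<in>perms n. schur_char n \<mu> w * int (fixed_words n (mset_set {..<n}) w))"
    by (rule sum_schur_char_fixed_words[OF \<mu>, symmetric]) simp
  also have "\<dots> = (\<Sum>w\<in>perms n. if w = id then schur_char n \<mu> id * fact n else 0)"
    by (intro sum.cong) (auto simp: fixed_words_distinct)
  also have "\<dots> = fact n * schur_char n \<mu> id" by simp
  finally have "schur_char n \<mu> id = int (ssyt_count \<mu> (mset_set {..<n}))" by simp
  then show ?thesis by simp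
qed

text \<open>A cell is known by its row and column, so a row-preserving and a column-preserving
  permutation with product \<open>id\<close> are both trivial, and each \<open>g\<close> contributes
  1.\<close>

lemma young_char_id:
  assumes \<mu>: "\<mu> \<in> partitions_of n" shows "young_char n \<mu> id = fact n"
proof -
  let ?R = "stab n (row_of n \<mu>)" and ?C = "stab n (col_of n \<mu>)"
  have bij: "bij_betw (placement n \<mu>) {..<n} (cells \<mu>)" by (rule placement[OF \<mu>])
  have idR: "id \<in> ?R" "id \<in> ?C" using perm_subgroupD(2)[OF perm_subgroup_stab] by blast+
  have fin: "finite ?R" "finite ?C" using perm_subgroupD(5)[OF perm_subgroup_stab] by blast+
  have iff: "id = r \<circ> c \<longleftrightarrow> r = id \<and> c = id" if r: "r \<in> ?R" and c: "c \<in> ?C" for r c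
  proof
    assume e: "id = r \<circ> c"
    have cp: "c \<in> perms n" using stab_perms[OF c] .
    have "c x = x" if x: "x < n" for x
    proof -
      have cx: "c x < n" using perms_less[OF cp] x by simp
      have "row_of n \<mu> (r (c x)) = row_of n \<mu> (c x)" using r cx by (simp add: stab_def)
      moreover have "r (c x) = x" using e by (metis comp_apply id_apply)
      moreover have "col_of n \<mu> (c x) = col_of n \<mu> x" using c x by (simp add: stab_def)
      ultimately have "placement n \<mu> (c x) = placement n \<mu> x" by (simp add: prod_eq_iff)
      then show ?thesis using bij cx x by (auto simp: bij_betw_def dest: inj_onD)
    qed
    moreover have "c x = x" if "\<not> x < n" for x using permutes_not_in[of c "{..<n}" x] cp that by simp
    ultimately have "c = id" by (auto simp: fun_eq_iff)
    then show "r = id \<and> c = id" using e by simp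
  qed simp
  have inner: "(\<Sum>r\<in>?R. \<Sum>c\<in>?C. sign c * (if g \<circ> id \<circ> inv g = r \<circ> c then 1 else 0)) = 1"
    if g: "g \<in> perms n" for g
  proof -
    have gi: "g \<circ> id \<circ> inv g = id" using perms_inv_cancel(7)[OF g] by (simp only: comp_id)
    have "(\<Sum>r\<in>?R. \<Sum>c\<in>?C. sign c * (if g \<circ> id \<circ> inv g = r \<circ> c then 1 else 0))
        = (\<Sum>r\<in>?R. \<Sum>c\<in>?C. if c = id then (if r = id then 1 else 0) else 0)"
      unfolding gi by (intro sum.cong refl) (simp only: iff, auto)
    also have "\<dots> = 1" using idR fin by simp
    finally show ?thesis .
  qed
  have "young_char n \<mu> id = (\<Sum>g\<in>perms n. 1)"
    unfolding young_char_def by (rule sum.cong[OF refl]) (rule inner)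
  then show ?thesis by (simp add: card_permutations)
qed

text \<open>Both families are triangular with respect to dominance and orthogonal, so they agree up to
  normalization, as in the Gram-Schmidt process.\<close>

theorem young_char_proportional:
  assumes "\<mu> \<in> partitions_of n"
  shows "\<exists>c>0. \<forall>w\<in>perms n. real_of_int (young_char n \<mu> w) = c * real_of_int (schur_char n \<mu> w)"
  using assms
\<comment> \<open>The measure, the sum of all partial sums, is strictly monotone in the dominance
  order.\<close>
proof (induction "\<Sum>k\<le>n. \<Sum>j<k. part_at \<mu> j" arbitrary: \<mu> rule: less_induct)
  case (less \<mu>)
  let ?ip = "\<lambda>\<nu>. (\<Sum>v\<in>perms n. young_char n \<mu> v * schur_char n \<nu> v)"
  \<comment> \<open>Triangularity puts \<open>\<nu>\<close> strictly below \<open>\<mu>\<close>. By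
    induction \<open>young_char n \<nu>\<close> is then a multiple of
    \<open>schur_char n \<nu>\<close>, so \<open>young_char n \<mu>\<close> and
    \<open>young_char n \<nu>\<close> would pair nontrivially, forcing dominance the other
    way.\<close>
  have zero: "?ip \<nu> = 0" if \<nu>: "\<nu> \<in> partitions_of n" "\<nu> \<noteq> \<mu>" for \<nu>
  proof (rule ccontr)
    assume nz: "?ip \<nu> \<noteq> 0"
    have tri: "dominated B \<mu>" if "size B = n" "(\<Sum>w\<in>perms n. young_char n \<mu> w * int (fixed_words n B w)) \<noteq> 0" for B
    proof (rule young_sum_fixed_words_nonzero[OF less.prems])
      have "class_function n (\<lambda>w. int (fixed_words n B w))"
        unfolding class_function_def by (intro ballI) (simp only: fixed_words_conj)
      from pairing_young_char[OF this, of \<mu>] show "young_sum n \<mu> (\<lambda>w. int (fixed_words n B w)) \<noteq> 0"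
        using that(2) by (simp add: mult.commute)
    qed
    have d: "dominance n \<nu> \<mu>"
      by (rule pairing_schur_char_nonzero[where X = "young_char n \<mu>", OF tri \<nu>(1) nz])
    have "\<not> dominance n \<mu> \<nu>" using dominance_antisym[OF d _ less.prems \<nu>(1)] \<nu>(2) by blast
    then obtain k where k: "k \<le> n" "(\<Sum>j<k. part_at \<nu> j) < (\<Sum>j<k. part_at \<mu> j)"
      by (auto simp: dominance_def not_le)
    have "(\<Sum>k\<le>n. \<Sum>j<k. part_at \<nu> j) < (\<Sum>k\<le>n. \<Sum>j<k. part_at \<mu> j)"
      by (rule sum_strict_mono_ex1) (use d k in \<open>auto simp: dominance_def\<close>)
    then obtain c where c: "c > 0" "\<forall>w\<in>perms n. real_of_int (young_char n \<nu> w) = c * real_of_int (schur_char n \<nu> w)"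
      using less.hyps[OF _ \<nu>(1)] by blast
    have "c * real_of_int (?ip \<nu>) = real_of_int (\<Sum>v\<in>perms n. young_char n \<mu> v * young_char n \<nu> v)"
      using c(2) by (simp add: sum_distrib_left mult.left_commute)
    moreover have "(\<Sum>v\<in>perms n. young_char n \<mu> v * young_char n \<nu> v) = 0"
    proof (rule ccontr)
      assume "(\<Sum>v\<in>perms n. young_char n \<mu> v * young_char n \<nu> v) \<noteq> 0"
      then have "(\<Sum>v\<in>perms n. young_char n \<nu> v * young_char n \<mu> v) \<noteq> 0" by (simp add: mult.commute)
      then have "dominance n \<mu> \<nu>" by (rule pairing_young_chars_nonzero[OF less.prems \<nu>(1)])
      then show False using \<open>\<not> dominance n \<mu> \<nu>\<close> by blast
    qed
    ultimately have "c * real_of_int (?ip \<nu>) = 0" by (simp only: of_int_0)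
    then have "real_of_int (?ip \<nu>) = 0" using c(1) by (simp only: mult_eq_0_iff less_irrefl) auto
    then show False using nz by (simp only: of_int_eq_0_iff)
  qed
  have eq: "fact n * real_of_int (young_char n \<mu> w) = real_of_int (?ip \<mu>) * schur_char n \<mu> w" if w: "w \<in> perms n" for w
  proof -
    have "class_function n (\<lambda>w. real_of_int (young_char n \<mu> w))"
      using class_function_young_char[of n \<mu>] by (simp add: class_function_def)
    then have "fact n * real_of_int (young_char n \<mu> w)
        = (\<Sum>\<nu>\<in>partitions_of n. (\<Sum>v\<in>perms n. real_of_int (young_char n \<mu> v) * schur_char n \<nu> v) * schur_char n \<nu> w)"
      by (rule schur_char_complete[OF _ w])
    also have "\<dots> = (\<Sum>\<nu>\<in>partitions_of n. if \<nu> = \<mu> then real_of_int (?ip \<mu>) * schur_char n \<mu> w else 0)"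
    proof (rule sum.cong[OF refl])
      fix \<nu> assume "\<nu> \<in> partitions_of n"
      then show "(\<Sum>v\<in>perms n. real_of_int (young_char n \<mu> v) * schur_char n \<nu> v) * schur_char n \<nu> w
          = (if \<nu> = \<mu> then real_of_int (?ip \<mu>) * schur_char n \<mu> w else 0)"
        using arg_cong[OF zero[of \<nu>], of real_of_int] by auto
    qed
    also have "\<dots> = real_of_int (?ip \<mu>) * schur_char n \<mu> w" using less.prems by simp
    finally show ?thesis .
  qed
  \<comment> \<open>At \<open>id\<close> the product is positive and \<open>schur_char\<close> is
    nonnegative, so the factor is positive.\<close>
  have "real_of_int (?ip \<mu>) * schur_char n \<mu> id = fact n * fact n"
    using eq[of id] young_char_id[OF less.prems] by simp
  then have "real_of_int (?ip \<mu>) * schur_char n \<mu> id > 0" by simp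
  then have pos: "real_of_int (?ip \<mu>) > 0"
    using schur_char_id_nonneg[OF less.prems] by (simp add: zero_less_mult_iff)
  show ?case
  proof (intro exI conjI ballI)
    show "real_of_int (?ip \<mu>) / fact n > 0" using pos by simp
    show "real_of_int (young_char n \<mu> w) = real_of_int (?ip \<mu>) / fact n * schur_char n \<mu> w" if "w \<in> perms n" for w
      using eq[OF that] by (simp add: field_simps)
  qed
qed

section \<open>Positive definiteness\<close>

lemma sum_schur_char_nonneg:
  fixes X :: "(nat \<Rightarrow> nat) \<Rightarrow> real"
  assumes \<mu>: "\<mu> \<in> partitions_of n" and X: "class_function n X" and pos: "young_sum n \<mu> X \<ge> 0"
  shows "(\<Sum>w\<in>perms n. X w * schur_char n \<mu> w) \<ge> 0"
proof -
  obtain c where c: "c > 0" "\<forall>w\<in>perms n. real_of_int (young_char n \<mu> w) = c * real_of_int (schur_char n \<mu> w)"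
    using young_char_proportional[OF \<mu>] by blast
  have "c * (\<Sum>w\<in>perms n. X w * schur_char n \<mu> w) = (\<Sum>w\<in>perms n. X w * of_int (young_char n \<mu> w))"
    using c(2) by (simp add: sum_distrib_left mult.left_commute)
  also have "\<dots> = fact n * young_sum n \<mu> X" by (rule pairing_young_char[OF X])
  finally show ?thesis using c(1) pos by (metis fact_ge_zero mult_nonneg_nonneg zero_le_mult_iff not_less)
qed

text \<open>Extended by zero, \<open>ch\<close> reproduces itself under convolution: the sum over
  \<open>g\<close> of \<open>ch (a \<circ> g) * cnj (ch (b \<circ> g))\<close> is
  \<open>card K * ch (a \<circ> inv b)\<close>. Hence \<open>card K\<close> times the quadratic form
  is a sum of squared absolute values.\<close>

lemma linear_character_positive_definite:
  fixes ch :: "(nat \<Rightarrow> nat) \<Rightarrow> complex" and s :: "'p \<Rightarrow> real"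
  assumes K: "perm_subgroup n K" and out: "\<And>w. w \<in> perms n \<Longrightarrow> w \<notin> K \<Longrightarrow> ch w = 0"
    and hom: "\<And>v w. v \<in> K \<Longrightarrow> w \<in> K \<Longrightarrow> ch (v \<circ> w) = ch v * ch w"
    and unit: "\<And>w. w \<in> K \<Longrightarrow> ch w * cnj (ch w) = 1"
    and P: "finite P" and y: "\<And>p. p \<in> P \<Longrightarrow> y p \<in> perms n"
  shows "Re (\<Sum>p\<in>P. \<Sum>q\<in>P. of_real (s p * s q) * ch (y p \<circ> inv (y q))) \<ge> 0"
proof -
  note KD = perm_subgroupD[OF K]
  have conv: "(\<Sum>g\<in>perms n. ch (a \<circ> g) * cnj (ch (b \<circ> g))) = of_nat (card K) * ch (a \<circ> inv b)"
    if a: "a \<in> perms n" and b: "b \<in> perms n" for a b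
  proof -
    have bi: "inv b \<in> perms n" using b by (rule inv_perms)
    have "(\<Sum>g\<in>perms n. ch (a \<circ> g) * cnj (ch (b \<circ> g))) = (\<Sum>k\<in>perms n. ch (a \<circ> inv b \<circ> k) * cnj (ch k))"
    proof (rule sum.reindex_bij_witness[where i = "\<lambda>k. inv b \<circ> k" and j = "\<lambda>g. b \<circ> g"])
      fix g assume g: "g \<in> perms n"
      show "inv b \<circ> (b \<circ> g) = g" "b \<circ> (inv b \<circ> g) = g" by (rule perms_inv_cancel[OF b])+
      show "b \<circ> g \<in> perms n" "inv b \<circ> g \<in> perms n" by (rule comp_perms[OF b g], rule comp_perms[OF bi g])
      show "ch (a \<circ> inv b \<circ> (b \<circ> g)) * cnj (ch (b \<circ> g)) = ch (a \<circ> g) * cnj (ch (b \<circ> g))"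
        by (simp only: comp_assoc perms_inv_cancel[OF b])
    qed
    also have "\<dots> = (\<Sum>k\<in>K. ch (a \<circ> inv b \<circ> k) * cnj (ch k))"
      using KD(1) out by (intro sum.mono_neutral_right) auto
    also have "\<dots> = (\<Sum>k\<in>K. ch (a \<circ> inv b))"
    proof (rule sum.cong[OF refl])
      fix k assume k: "k \<in> K"
      show "ch (a \<circ> inv b \<circ> k) * cnj (ch k) = ch (a \<circ> inv b)"
      proof (cases "a \<circ> inv b \<in> K")
        case True
        then show ?thesis using hom[OF True k] unit[OF k] by (simp add: mult.assoc)
      next
        case False
        \<comment> \<open>Multiplication by \<open>k\<close> does not lead back into the subgroup,
          so both sides are zero.\<close>
        have "a \<circ> inv b \<circ> k \<notin> K"
        proof
          assume "a \<circ> inv b \<circ> k \<in> K"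
          then have "a \<circ> inv b \<circ> k \<circ> inv k \<in> K" using KD(3,4) k by blast
          then show False using False perms_inv_cancel(3)[of k n "a \<circ> inv b"] KD(1) k by auto
        qed
        moreover have "a \<circ> inv b \<circ> k \<in> perms n" using KD(1) k comp_perms[OF comp_perms[OF a bi]] by blast
        ultimately show ?thesis using out[of "a \<circ> inv b"] out[of "a \<circ> inv b \<circ> k"] False comp_perms[OF a bi] by simp
      qed
    qed
    finally show ?thesis by simp
  qed
  let ?S = "\<Sum>p\<in>P. \<Sum>q\<in>P. of_real (s p * s q) * ch (y p \<circ> inv (y q))"
  let ?v = "\<lambda>g. \<Sum>p\<in>P. of_real (s p) * ch (y p \<circ> g)"
  have "of_nat (card K) * ?S = (\<Sum>p\<in>P. \<Sum>q\<in>P. \<Sum>g\<in>perms n. (of_real (s p) * ch (y p \<circ> g)) * (of_real (s q) * cnj (ch (y q \<circ> g))))"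
    unfolding sum_distrib_left
  proof (intro sum.cong refl)
    fix p q assume pq: "p \<in> P" "q \<in> P"
    have "of_nat (card K) * (of_real (s p * s q) * ch (y p \<circ> inv (y q)))
        = of_real (s p * s q) * (\<Sum>g\<in>perms n. ch (y p \<circ> g) * cnj (ch (y q \<circ> g)))"
      unfolding conv[OF y[OF pq(1)] y[OF pq(2)]] by (rule mult.left_commute)
    also have "\<dots> = (\<Sum>g\<in>perms n. (of_real (s p) * ch (y p \<circ> g)) * (of_real (s q) * cnj (ch (y q \<circ> g))))"
      unfolding sum_distrib_left by (intro sum.cong refl) (simp add: mult_ac)
    finally show "of_nat (card K) * (of_real (s p * s q) * ch (y p \<circ> inv (y q)))
        = (\<Sum>g\<in>perms n. (of_real (s p) * ch (y p \<circ> g)) * (of_real (s q) * cnj (ch (y q \<circ> g))))" .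
  qed
  also have "\<dots> = (\<Sum>g\<in>perms n. \<Sum>p\<in>P. \<Sum>q\<in>P. (of_real (s p) * ch (y p \<circ> g)) * (of_real (s q) * cnj (ch (y q \<circ> g))))"
    by (rule sum_rotate[symmetric])
  also have "\<dots> = (\<Sum>g\<in>perms n. ?v g * cnj (?v g))"
    by (simp add: sum_product cnj_sum)
  also have "\<dots> = (\<Sum>g\<in>perms n. of_real ((cmod (?v g))\<^sup>2))"
    by (simp only: complex_norm_square)
  finally have "of_nat (card K) * ?S = of_real (\<Sum>g\<in>perms n. (cmod (?v g))\<^sup>2)" by simp
  then have "Re (of_nat (card K) * ?S) = (\<Sum>g\<in>perms n. (cmod (?v g))\<^sup>2)" by (simp only: Re_complex_of_real)
  then have "real (card K) * Re ?S = (\<Sum>g\<in>perms n. (cmod (?v g))\<^sup>2)" by simp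
  also have "\<dots> \<ge> 0" by (intro sum_nonneg) simp
  finally have "real (card K) * Re ?S \<ge> 0" .
  moreover have "card K > 0" using KD(2,5) by (auto simp: card_gt_0_iff)
  ultimately show ?thesis by (simp add: zero_le_mult_iff)
qed

text \<open>Conjugation by \<open>inv r'\<close> turns
  \<open>(r \<circ> c) \<circ> inv (r' \<circ> c')\<close> into
  \<open>(inv r' \<circ> r) \<circ> (c \<circ> inv c')\<close>. Shifting both group sums then makes
  the sum over \<open>r\<close> and \<open>c\<close> equal to \<open>young_sum n \<mu> X\<close>,
  whatever \<open>r'\<close> and \<open>c'\<close> are.\<close>

lemma young_sum_positive_definite:
  fixes X :: "(nat \<Rightarrow> nat) \<Rightarrow> real"
  assumes X: "class_function n X"
  shows "real (card (stab n (row_of n \<mu>)) * card (stab n (col_of n \<mu>))) * young_sum n \<mu> X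
    = (\<Sum>p\<in>stab n (row_of n \<mu>) \<times> stab n (col_of n \<mu>). \<Sum>q\<in>stab n (row_of n \<mu>) \<times> stab n (col_of n \<mu>).
        real_of_int (sign (snd p)) * real_of_int (sign (snd q)) * X ((fst p \<circ> snd p) \<circ> inv (fst q \<circ> snd q)))"
proof -
  let ?R = "stab n (row_of n \<mu>)" and ?C = "stab n (col_of n \<mu>)"
  have inner: "(\<Sum>p\<in>?R \<times> ?C. real_of_int (sign (snd p)) * real_of_int (sign (snd q)) * X ((fst p \<circ> snd p) \<circ> inv (fst q \<circ> snd q)))
      = young_sum n \<mu> X" if q: "q \<in> ?R \<times> ?C" for q
  proof -
    obtain r' c' where rc: "q = (r', c')" "r' \<in> ?R" "c' \<in> ?C" using q by blast
    have rp: "r' \<in> perms n" and cp: "c' \<in> perms n" using rc stab_perms by blast+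
    have ri: "inv r' \<in> ?R" and ci: "inv c' \<in> ?C" using rc perm_subgroupD(4)[OF perm_subgroup_stab] by blast+
    have "(\<Sum>p\<in>?R \<times> ?C. real_of_int (sign (snd p)) * real_of_int (sign (snd q)) * X ((fst p \<circ> snd p) \<circ> inv (fst q \<circ> snd q)))
        = (\<Sum>r\<in>?R. \<Sum>c\<in>?C. real_of_int (sign c) * real_of_int (sign c') * X ((r \<circ> c) \<circ> inv (r' \<circ> c')))"
      by (simp only: rc(1) sum.cartesian_product split_def fst_conv snd_conv)
    also have "\<dots> = (\<Sum>r\<in>?R. \<Sum>c\<in>?C. real_of_int (sign (c \<circ> inv c')) * X ((inv r' \<circ> r) \<circ> (c \<circ> inv c')))"
    proof (intro sum.cong refl)
      fix r c assume r: "r \<in> ?R" and c: "c \<in> ?C"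
      have rcp: "r \<in> perms n" "c \<in> perms n" using r c stab_perms by blast+
      have p: "r \<circ> c \<circ> inv (r' \<circ> c') \<in> perms n" using rp cp rcp by (intro comp_perms inv_perms)
      have "X (r \<circ> c \<circ> inv (r' \<circ> c')) = X (inv r' \<circ> (r \<circ> c \<circ> inv (r' \<circ> c')) \<circ> inv (inv r'))"
        using X p inv_perms[OF rp] unfolding class_function_def by metis
      also have "inv r' \<circ> (r \<circ> c \<circ> inv (r' \<circ> c')) \<circ> inv (inv r') = (inv r' \<circ> r) \<circ> (c \<circ> inv c')"
        by (simp only: inv_comp_perms[OF rp cp] comp_assoc perms_inv_cancel[OF rp] comp_id)
      finally have "X (r \<circ> c \<circ> inv (r' \<circ> c')) = X ((inv r' \<circ> r) \<circ> (c \<circ> inv c'))" .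
      moreover have "sign (c \<circ> inv c') = sign c * sign c'"
        using sign_compose[OF permutation_perms[OF rcp(2)] permutation_perms[OF inv_perms[OF cp]]]
          sign_inverse[OF permutation_perms[OF cp]] by simp
      ultimately show "real_of_int (sign c) * real_of_int (sign c') * X ((r \<circ> c) \<circ> inv (r' \<circ> c'))
          = real_of_int (sign (c \<circ> inv c')) * X ((inv r' \<circ> r) \<circ> (c \<circ> inv c'))"
        by (simp only: of_int_mult)
    qed
    also have "\<dots> = (\<Sum>r\<in>?R. \<Sum>c\<in>?C. real_of_int (sign c) * X ((inv r' \<circ> r) \<circ> c))"
      by (intro sum.cong refl sum_subgroup_shift(1)[OF perm_subgroup_stab ci, where h = "\<lambda>c. real_of_int (sign c) * X (_ \<circ> c)"])
    also have "\<dots> = (\<Sum>r\<in>?R. \<Sum>c\<in>?C. real_of_int (sign c) * X (r \<circ> c))"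
      by (rule sum_subgroup_shift(2)[OF perm_subgroup_stab ri, where h = "\<lambda>r. \<Sum>c\<in>?C. real_of_int (sign c) * X (r \<circ> c)"])
    also have "\<dots> = young_sum n \<mu> X" by (simp add: young_sum_def)
    finally show ?thesis .
  qed
  have "(\<Sum>p\<in>?R \<times> ?C. \<Sum>q\<in>?R \<times> ?C. real_of_int (sign (snd p)) * real_of_int (sign (snd q)) * X ((fst p \<circ> snd p) \<circ> inv (fst q \<circ> snd q)))
      = (\<Sum>q\<in>?R \<times> ?C. young_sum n \<mu> X)"
    by (subst sum.swap) (intro sum.cong refl inner)
  then show ?thesis by (simp add: card_cartesian_product)
qed

text \<open>That the total \<open>X\<close> is a class function turns the pairing into a quadratic
  form. This form splits over \<open>u\<close>, and each summand is nonnegative because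
  \<open>ch u\<close> is positive definite.\<close>

theorem sum_linear_characters_pairing_nonneg:
  fixes X :: "(nat \<Rightarrow> nat) \<Rightarrow> real" and ch :: "'u \<Rightarrow> (nat \<Rightarrow> nat) \<Rightarrow> complex"
  assumes \<mu>: "\<mu> \<in> partitions_of n" and X: "class_function n X"
    and Xch: "\<And>w. w \<in> perms n \<Longrightarrow> complex_of_real (X w) = (\<Sum>u\<in>U. ch u w)"
    and K: "\<And>u. u \<in> U \<Longrightarrow> perm_subgroup n (K u)"
    and out: "\<And>u w. u \<in> U \<Longrightarrow> w \<in> perms n \<Longrightarrow> w \<notin> K u \<Longrightarrow> ch u w = 0"
    and hom: "\<And>u v w. u \<in> U \<Longrightarrow> v \<in> K u \<Longrightarrow> w \<in> K u \<Longrightarrow> ch u (v \<circ> w) = ch u v * ch u w"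
    and unit: "\<And>u w. u \<in> U \<Longrightarrow> w \<in> K u \<Longrightarrow> ch u w * cnj (ch u w) = 1"
  shows "(\<Sum>w\<in>perms n. X w * schur_char n \<mu> w) \<ge> 0"
proof (rule sum_schur_char_nonneg[OF \<mu> X])
  let ?R = "stab n (row_of n \<mu>)" and ?C = "stab n (col_of n \<mu>)"
  let ?P = "?R \<times> ?C" and ?s = "\<lambda>p. real_of_int (sign (snd p))" and ?y = "\<lambda>p. fst p \<circ> snd p"
  have fin: "finite ?R" "finite ?C" using perm_subgroupD(5)[OF perm_subgroup_stab] by blast+
  have y: "?y p \<in> perms n" if "p \<in> ?P" for p using that stab_perms comp_perms by (metis mem_Times_iff)
  have "complex_of_real (\<Sum>p\<in>?P. \<Sum>q\<in>?P. ?s p * ?s q * X (?y p \<circ> inv (?y q)))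
      = (\<Sum>p\<in>?P. \<Sum>q\<in>?P. \<Sum>u\<in>U. of_real (?s p * ?s q) * ch u (?y p \<circ> inv (?y q)))"
    unfolding of_real_sum
  proof (intro sum.cong refl)
    fix p q assume "p \<in> ?P" "q \<in> ?P"
    then have "?y p \<circ> inv (?y q) \<in> perms n" using y comp_perms inv_perms by metis
    then show "complex_of_real (?s p * ?s q * X (?y p \<circ> inv (?y q))) = (\<Sum>u\<in>U. of_real (?s p * ?s q) * ch u (?y p \<circ> inv (?y q)))"
      by (simp only: of_real_mult Xch sum_distrib_left)
  qed
  also have "\<dots> = (\<Sum>u\<in>U. \<Sum>p\<in>?P. \<Sum>q\<in>?P. of_real (?s p * ?s q) * ch u (?y p \<circ> inv (?y q)))"
    by (rule sum_rotate[symmetric])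
  finally have "(\<Sum>p\<in>?P. \<Sum>q\<in>?P. ?s p * ?s q * X (?y p \<circ> inv (?y q)))
      = Re (\<Sum>u\<in>U. \<Sum>p\<in>?P. \<Sum>q\<in>?P. of_real (?s p * ?s q) * ch u (?y p \<circ> inv (?y q)))"
    by (metis Re_complex_of_real)
  also have "\<dots> = (\<Sum>u\<in>U. Re (\<Sum>p\<in>?P. \<Sum>q\<in>?P. of_real (?s p * ?s q) * ch u (?y p \<circ> inv (?y q))))"
    by (rule Re_sum)
  also have "\<dots> \<ge> 0"
  proof (rule sum_nonneg)
    fix u assume u: "u \<in> U"
    show "Re (\<Sum>p\<in>?P. \<Sum>q\<in>?P. of_real (?s p * ?s q) * ch u (?y p \<circ> inv (?y q))) \<ge> 0"
      by (rule linear_character_positive_definite[OF K[OF u] out[OF u] hom[OF u] unit[OF u] finite_cartesian_product[OF fin] y])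
  qed
  finally have "real (card ?R * card ?C) * young_sum n \<mu> X \<ge> 0"
    unfolding young_sum_positive_definite[OF X] .
  moreover have "real (card ?R * card ?C) > 0"
  proof -
    have "?R \<noteq> {}" "?C \<noteq> {}" using perm_subgroupD(2)[OF perm_subgroup_stab] by blast+
    then have "card ?R > 0" "card ?C > 0" using fin by (auto simp only: card_gt_0_iff)
    then show ?thesis by simp
  qed
  ultimately show "young_sum n \<mu> X \<ge> 0" by (metis mult_pos_neg not_less)
qed

section \<open>Linear characters of centralizers\<close>

definition centralizer :: "nat \<Rightarrow> (nat \<Rightarrow> nat) \<Rightarrow> (nat \<Rightarrow> nat) set" where
  "centralizer n u = {w \<in> perms n. w \<circ> u = u \<circ> w}"

lemma centralizerD:
  assumes "w \<in> centralizer n u" shows "w \<in> perms n" "w (u x) = u (w x)"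
  using assms by (auto simp: centralizer_def fun_eq_iff)

lemma perm_subgroup_centralizer:
  assumes u: "u \<in> perms n" shows "perm_subgroup n (centralizer n u)"
proof -
  have "a \<circ> b \<in> centralizer n u" if "a \<in> centralizer n u" "b \<in> centralizer n u" for a b
  proof -
    have "a \<circ> b \<in> perms n" using that comp_perms centralizerD(1) by blast
    moreover have "a \<circ> b \<circ> u = u \<circ> (a \<circ> b)" by (rule ext) (simp add: centralizerD(2)[OF that(1)] centralizerD(2)[OF that(2)])
    ultimately show ?thesis by (simp only: centralizer_def mem_Collect_eq)
  qed
  moreover have "inv a \<in> centralizer n u" if a: "a \<in> centralizer n u" for a
  proof -
    have p: "a \<in> perms n" using a by (rule centralizerD)
    have e: "a \<circ> u = u \<circ> a" using a by (simp add: centralizer_def)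
    have "inv a \<circ> u = inv a \<circ> (u \<circ> a) \<circ> inv a" by (simp only: comp_assoc perms_inv_cancel[OF p] comp_id)
    also have "\<dots> = u \<circ> inv a" unfolding e[symmetric] by (simp only: comp_assoc perms_inv_cancel[OF p] comp_id)
    finally show ?thesis using inv_perms[OF p] by (simp only: centralizer_def mem_Collect_eq)
  qed
  moreover have "id \<in> centralizer n u" by (simp add: centralizer_def)
  moreover have "centralizer n u \<subseteq> perms n" by (auto simp: centralizer_def)
  ultimately show ?thesis unfolding perm_subgroup_def by blast
qed

lemma centralizer_sym: "u \<in> perms n \<Longrightarrow> w \<in> centralizer n u \<Longrightarrow> u \<in> centralizer n w"
  by (simp add: centralizer_def)

lemma funpow_comm:
  assumes "\<And>x. w (u x) = u (w x)" shows "w ((u ^^ i) x) = (u ^^ i) (w x)"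
  by (induction i) (simp_all add: assms)

lemma funpow_comm2:
  assumes "\<And>x. w (u x) = u (w x)" shows "(w ^^ j) ((u ^^ i) x) = (u ^^ i) ((w ^^ j) x)"
proof (induction j)
  case (Suc j)
  have "w ((u ^^ i) y) = (u ^^ i) (w y)" for y by (rule funpow_comm) (rule assms)
  then show ?case using Suc by simp
qed simp

lemma centralizer_least_power:
  assumes u: "u \<in> perms n" and w: "w \<in> centralizer n u" shows "least_power u (w x) = least_power u x"
proof -
  have inj: "inj w" using permutes_inj centralizerD(1)[OF w] by blast
  have "(u ^^ i) (w x) = w x \<longleftrightarrow> (u ^^ i) x = x" for i
  proof -
    have "(u ^^ i) (w x) = w ((u ^^ i) x)" by (rule funpow_comm[symmetric]) (rule centralizerD(2)[OF w])
    then show ?thesis using inj by (simp add: inj_eq)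
  qed
  then show ?thesis by (simp add: least_power_def)
qed

lemma centralizer_orb:
  assumes w: "w \<in> centralizer n u" shows "orb u (w x) = w ` orb u x"
proof -
  have "(u ^^ i) (w x) = w ((u ^^ i) x)" for i by (rule funpow_comm[symmetric]) (rule centralizerD(2)[OF w])
  then show ?thesis by (simp add: image_image)
qed

section \<open>Characters of centralizers from phases along cycles\<close>

definition zeta :: "nat \<Rightarrow> nat \<Rightarrow> complex" where
  "zeta M L = cis (2 * pi * real M / real L)"

lemma zeta_power: "zeta M L ^ p = cis (2 * pi * real M * real p / real L)"
  by (simp add: zeta_def DeMoivre mult_ac)

lemma cis_2pi_nat: "cis (2 * pi * real m) = 1"
  using cis_multiple_2pi[of "real m"] by simp

lemma zeta_power_self: "L > 0 \<Longrightarrow> zeta M L ^ L = 1"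
  unfolding zeta_power using cis_2pi_nat[of M] by simp

lemma zeta_power_mod: "L > 0 \<Longrightarrow> zeta M L ^ (p mod L) = zeta M L ^ p"
  using zeta_power_self[of L M] by (metis div_mult_mod_eq mult.commute mult_1 power_add power_mult power_one)

lemma norm_zeta: "cmod (zeta M L) = 1"
  by (simp add: zeta_def)

text \<open>\<open>phase M u\<close> is multiplied by \<open>zeta M L\<close> along each step of a cycle of \<open>u\<close> of length \<open>L\<close>; the
  cycles are based at their least points.\<close>

definition phase :: "nat \<Rightarrow> (nat \<Rightarrow> nat) \<Rightarrow> nat \<Rightarrow> complex" where
  "phase M u x = zeta M (least_power u x) ^ (LEAST i. (u ^^ i) (Min (orb u x)) = x)"

lemma norm_phase: "cmod (phase M u x) = 1"
  by (simp add: phase_def norm_power norm_zeta)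

lemma phase_nonzero: "phase M u x \<noteq> 0"
  using norm_phase[of M u x] by auto

lemma phase_step:
  assumes pu: "permutation u" shows "phase M u (u x) = zeta M (least_power u x) * phase M u x"
proof -
  define b where "b = Min (orb u x)"
  define pos where "pos = (\<lambda>y. LEAST i. (u ^^ i) b = y)"
  have "b \<in> orb u x" unfolding b_def using finite_orb[OF pu] by (intro Min_in) auto
  then have ob: "orb u b = orb u x" and lb: "least_power u b = least_power u x"
    using orb_eq[OF pu] least_power_orb[OF pu] by blast+
  have ux: "u x \<in> orb u x" by (rule range_eqI[of _ _ 1]) simp
  then have oux: "orb u (u x) = orb u x" and lux: "least_power u (u x) = least_power u x"
    using orb_eq[OF pu] least_power_orb[OF pu] by blast+
  have pos: "(u ^^ pos y) b = y" if "y \<in> orb u x" for y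
  proof -
    have "\<exists>i. (u ^^ i) b = y" using that unfolding ob[symmetric] by blast
    then show ?thesis unfolding pos_def by (rule LeastI_ex)
  qed
  have "(u ^^ pos (u x)) b = (u ^^ Suc (pos x)) b" using pos[OF ux] pos[OF orb_self] by simp
  then have "pos (u x) mod least_power u x = Suc (pos x) mod least_power u x"
    using funpow_eq_iff[OF pu, of "pos (u x)" b "Suc (pos x)"] lb by simp
  then have "zeta M (least_power u x) ^ pos (u x) = zeta M (least_power u x) ^ Suc (pos x)"
    using zeta_power_mod[of "least_power u x" M] least_power_of_permutation(2)[OF pu] by metis
  then show ?thesis unfolding phase_def oux lux by (simp add: pos_def b_def)
qed

lemma phase_funpow:
  assumes pu: "permutation u" shows "phase M u ((u ^^ i) x) = zeta M (least_power u x) ^ i * phase M u x"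
proof (induction i)
  case (Suc i)
  have "least_power u ((u ^^ i) x) = least_power u x" by (rule least_power_orb[OF pu]) blast
  then show ?case using Suc phase_step[OF pu, of M "(u ^^ i) x"] by simp
qed simp

text \<open>A commuting \<open>w\<close> maps the cycle of \<open>x\<close> to a cycle of the same
  length \<open>L\<close>; the ratio is \<open>zeta M L ^ j\<close>, where \<open>j\<close> is the
  shift of \<open>w\<close> relative to the base points of the two cycles.\<close>

definition cycle_shift :: "nat \<Rightarrow> (nat \<Rightarrow> nat) \<Rightarrow> (nat \<Rightarrow> nat) \<Rightarrow> nat \<Rightarrow> complex" where
  "cycle_shift M u w x = phase M u (w x) / phase M u x"

text \<open>The centralizer of \<open>u\<close> is a product of wreath products of cyclic with
  symmetric groups; this linear character multiplies up the cyclic coordinates. \<open>Min Q\<close>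
  stands for any point of the cycle, by \<open>cycle_shift_invariant\<close>.\<close>

definition cyc_char :: "nat \<Rightarrow> nat \<Rightarrow> (nat \<Rightarrow> nat) \<Rightarrow> (nat \<Rightarrow> nat) \<Rightarrow> complex" where
  "cyc_char n M u w = (\<Prod>Q\<in>orb u ` {..<n}. cycle_shift M u w (Min Q))"

lemma cycle_shift_invariant:
  assumes u: "u \<in> perms n" and w: "w \<in> centralizer n u" shows "y \<in> orb u x \<Longrightarrow> cycle_shift M u w y = cycle_shift M u w x"
proof -
  assume "y \<in> orb u x"
  then obtain i where y: "y = (u ^^ i) x" by blast
  have pu: "permutation u" using permutation_perms[OF u] .
  have "w y = (u ^^ i) (w x)" unfolding y by (rule funpow_comm) (rule centralizerD(2)[OF w])
  then have "phase M u (w y) = zeta M (least_power u x) ^ i * phase M u (w x)"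
    using phase_funpow[OF pu, of M i "w x"] centralizer_least_power[OF u w] by simp
  moreover have "phase M u y = zeta M (least_power u x) ^ i * phase M u x"
    unfolding y by (rule phase_funpow[OF pu])
  moreover have "zeta M (least_power u x) ^ i \<noteq> 0"
    using norm_zeta[of M "least_power u x"] by (intro power_not_zero) auto
  ultimately obtain z where "z \<noteq> 0" "phase M u (w y) = z * phase M u (w x)" "phase M u y = z * phase M u x"
    by blast
  then show ?thesis by (simp add: cycle_shift_def)
qed

lemma Min_orb: "permutation u \<Longrightarrow> Min (orb u x) \<in> orb u x" for x :: nat
  using finite_orb[of u x] by (intro Min_in) auto

text \<open>Shifts are constant on cycles, so any transversal may replace the minima: their images
  under a commuting permutation, or the points \<open>(w ^^ i) x0\<close>.\<close>

lemma prod_shift_transversal: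
  assumes u: "u \<in> perms n" and w: "w \<in> centralizer n u" and B: "bij_betw (\<lambda>b. orb u (f b)) B Os"
  shows "(\<Prod>Q\<in>Os. cycle_shift M u w (Min Q)) = (\<Prod>b\<in>B. cycle_shift M u w (f b))"
proof -
  have "(\<Prod>Q\<in>Os. cycle_shift M u w (Min Q)) = (\<Prod>b\<in>B. cycle_shift M u w (Min (orb u (f b))))"
    by (rule prod.reindex_bij_betw[OF B, symmetric])
  also have "\<dots> = (\<Prod>b\<in>B. cycle_shift M u w (f b))"
    by (intro prod.cong refl cycle_shift_invariant[OF u w] Min_orb permutation_perms[OF u])
  finally show ?thesis .
qed

text \<open>The shift of \<open>v \<circ> w\<close> at \<open>x\<close> is that of \<open>v\<close>
  at \<open>w x\<close> times that of \<open>w\<close> at \<open>x\<close>. As \<open>w\<close>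
  permutes the cycles of \<open>u\<close>, the points \<open>w (Min Q)\<close> form a transversal,
  so the first factors multiply to the value at \<open>v\<close>.\<close>

lemma cyc_char_hom:
  assumes u: "u \<in> perms n" and v: "v \<in> centralizer n u" and w: "w \<in> centralizer n u"
  shows "cyc_char n M u (v \<circ> w) = cyc_char n M u v * cyc_char n M u w"
proof -
  let ?Os = "orb u ` {..<n}"
  have pu: "permutation u" using permutation_perms[OF u] .
  have wp: "w \<in> perms n" using centralizerD(1)[OF w] .
  have injw: "inj w" using wp permutes_inj by blast
  have om: "orb u (Min Q) = Q" if "Q \<in> ?Os" for Q
  proof -
    from that obtain x where Q: "Q = orb u x" by blast
    show ?thesis unfolding Q by (rule orb_eq[OF pu Min_orb[OF pu]])
  qed
  have ow: "orb u (w (Min Q)) = w ` Q" if "Q \<in> ?Os" for Q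
    using centralizer_orb[OF w, of "Min Q"] om[OF that] by simp
  have bij: "bij_betw (\<lambda>Q. orb u (w (Min Q))) ?Os ?Os"
  proof (rule bij_betw_imageI)
    show "inj_on (\<lambda>Q. orb u (w (Min Q))) ?Os"
    proof (rule inj_onI)
      fix Q R assume Q: "Q \<in> ?Os" and R: "R \<in> ?Os" and e: "orb u (w (Min Q)) = orb u (w (Min R))"
      have "w ` Q = w ` R" using e unfolding ow[OF Q] ow[OF R] .
      then show "Q = R" unfolding inj_image_eq_iff[OF injw] .
    qed
    show "(\<lambda>Q. orb u (w (Min Q))) ` ?Os = ?Os"
    proof (rule endo_inj_surj)
      show "(\<lambda>Q. orb u (w (Min Q))) ` ?Os \<subseteq> ?Os"
      proof
        fix Q' assume "Q' \<in> (\<lambda>Q. orb u (w (Min Q))) ` ?Os"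
        then obtain x where x: "x < n" "Q' = orb u (w (Min (orb u x)))" by blast
        have "Min (orb u x) < n" using Min_orb[OF pu, of x] orb_subset[OF u x(1)] by auto
        then show "Q' \<in> ?Os" using x(2) perms_less[OF wp] by blast
      qed
    qed (simp, fact)
  qed
  have "cyc_char n M u (v \<circ> w) = (\<Prod>Q\<in>?Os. cycle_shift M u v (w (Min Q)) * cycle_shift M u w (Min Q))"
    unfolding cyc_char_def cycle_shift_def using phase_nonzero by (intro prod.cong refl) simp
  also have "\<dots> = (\<Prod>Q\<in>?Os. cycle_shift M u v (w (Min Q))) * cyc_char n M u w"
    by (simp add: prod.distrib cyc_char_def)
  also have "(\<Prod>Q\<in>?Os. cycle_shift M u v (w (Min Q))) = cyc_char n M u v"
    unfolding cyc_char_def by (rule prod_shift_transversal[OF u v bij, symmetric])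
  finally show ?thesis .
qed

lemma norm_shift: "cmod (cycle_shift M u w x) = 1"
  by (simp add: cycle_shift_def norm_divide norm_phase)

lemma cyc_char_unit: "cyc_char n M u w * cnj (cyc_char n M u w) = 1"
proof -
  have "cmod (cyc_char n M u w) = 1" unfolding cyc_char_def prod_norm[symmetric]
    by (simp add: norm_shift)
  then show ?thesis using complex_norm_square[of "cyc_char n M u w"] by simp
qed

lemma cyc_char_id: "cyc_char n M u id = 1"
  by (simp add: cyc_char_def cycle_shift_def phase_nonzero)

lemma cyc_char_power:
  assumes u: "u \<in> perms n" and w: "w \<in> centralizer n u"
  shows "cyc_char n M u (w ^^ m) = cyc_char n M u w ^ m"
proof -
  have "w ^^ m \<in> centralizer n u \<and> cyc_char n M u (w ^^ m) = cyc_char n M u w ^ m"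
  proof (induction m)
    case 0
    have "w ^^ 0 = id" by auto
    then show ?case
      using perm_subgroupD(2)[OF perm_subgroup_centralizer[OF u]] cyc_char_id[of n M u] by (metis power_0)
  next
    case (Suc m)
    have "w ^^ Suc m = w \<circ> w ^^ m" by simp
    then show ?case
      using Suc cyc_char_hom[OF u w, of "w ^^ m" M] perm_subgroupD(3)[OF perm_subgroup_centralizer[OF u] w, of "w ^^ m"]
      by (metis power_Suc)
  qed
  then show ?thesis ..
qed

section \<open>Roots of unity of order prime to S\<close>

lemma coprime_powers_one:
  fixes z :: complex
  assumes "z ^ a = 1" "z ^ b = 1" "coprime a b" shows "z = 1"
proof (cases "a = 0")
  case True
  then show ?thesis using assms by simp
next
  case False
  obtain x y where "a * x = b * y + 1" using assms(3) False coprime_bezout_strong[of a b] bezout_nat[of a b] by auto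
  then have "z ^ (a * x) = z ^ (b * y + 1)" by simp
  then show ?thesis using assms by (simp add: power_mult power_add)
qed

text \<open>The plain product gives both directions of the divisibility criterion: each
  \<open>k \<le> n\<close> in \<open>P_in S\<close> is a factor, and a prime dividing the product
  divides some factor, hence lies in \<open>S\<close>.\<close>

definition bounded_prod :: "nat set \<Rightarrow> nat \<Rightarrow> nat" where
  "bounded_prod S n = \<Prod>{k \<in> P_in S. k \<le> n}"

lemma dvd_bounded_prod: "k \<in> P_in S \<Longrightarrow> k \<le> n \<Longrightarrow> k dvd bounded_prod S n"
  unfolding bounded_prod_def by (rule dvd_prodI[where f = "\<lambda>k. k"]) auto

lemma P_in_if_dvd_bounded_prod:
  assumes "k dvd bounded_prod S n" "k > 0" shows "k \<in> P_in S"
proof -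
  have "p \<in> S" if p: "prime p" "p dvd k" for p
  proof -
    have "p dvd \<Prod>{k \<in> P_in S. k \<le> n}" using p assms(1) dvd_trans unfolding bounded_prod_def by blast
    then obtain j where "j \<in> {k \<in> P_in S. k \<le> n}" "p dvd j"
      using prime_dvd_prod_iff[of "{k \<in> P_in S. k \<le> n}" p "\<lambda>k. k"] p(1) by auto
    then show ?thesis using p(1) by (auto simp: P_in_def)
  qed
  then show ?thesis using assms(2) by (auto simp: P_in_def)
qed

text \<open>The full power of \<open>p\<close> in \<open>L\<close> lies in \<open>P_in S\<close> and
  is at most \<open>n\<close>, so it divides \<open>bounded_prod S n\<close> and hence the gcd. The
  cofactor is the order of \<open>zeta (bounded_prod S n) L\<close>, which is therefore prime to
  \<open>S\<close>.\<close>

lemma S_prime_not_dvd_cofactor: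
  assumes p: "prime p" "p \<in> S" and L: "0 < L" "L \<le> n"
  shows "\<not> p dvd L div gcd (bounded_prod S n) L"
proof
  let ?g = "gcd (bounded_prod S n) L"
  assume d: "p dvd L div ?g"
  define a where "a = multiplicity p L"
  have pa: "p ^ a dvd L" by (simp add: a_def multiplicity_dvd)
  have "p ^ a \<in> P_in S"
  proof -
    have "q \<in> S" if q: "prime q" "q dvd p ^ a" for q
      using prime_dvd_power[OF q] primes_dvd_imp_eq[OF q(1) p(1)] p(2) by blast
    then show ?thesis using prime_gt_0_nat[OF p(1)] by (simp add: P_in_def)
  qed
  moreover have "p ^ a \<le> n" using pa L dvd_imp_le[of "p ^ a" L] by simp
  ultimately have "p ^ a dvd ?g" using pa dvd_bounded_prod by simp
  then have "p ^ a * p dvd ?g * (L div ?g)" using d by (rule mult_dvd_mono)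
  then have "p ^ Suc a dvd L" by (simp add: mult.commute)
  then have "Suc a \<le> multiplicity p L"
    using L p(1) by (intro multiplicity_geI) (auto simp: prime_gt_1_nat)
  then show False by (simp add: a_def)
qed

lemma zeta_power_cofactor:
  assumes "L > 0" shows "zeta M L ^ (L div gcd M L) = 1"
proof -
  have "real M * real (L div gcd M L) / real L = real (M div gcd M L)"
    using assms by (simp add: real_of_nat_div field_simps)
  moreover have "2 * pi * real M * real (L div gcd M L) / real L = 2 * pi * (real M * real (L div gcd M L) / real L)"
    by simp
  ultimately have "zeta M L ^ (L div gcd M L) = cis (2 * pi * real (M div gcd M L))"
    unfolding zeta_power by (simp only:)
  then show ?thesis by (simp only: cis_2pi_nat)
qed

text \<open>The values of \<open>cyc_char\<close> are roots of unity of order prime to \<open>S\<close>, so they are trivial on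
  permutations whose order is an \<open>S\<close>-number.\<close>

lemma cyc_char_trivial:
  assumes u: "u \<in> perms n" and w: "w \<in> centralizer n u"
    and S: "\<And>x. x < n \<Longrightarrow> least_power w x \<in> P_in S"
  shows "cyc_char n (bounded_prod S n) u w = 1"
proof -
  let ?M = "bounded_prod S n"
  have wp: "w \<in> perms n" using centralizerD(1)[OF w] .
  have pu: "permutation u" by (rule permutation_perms[OF u])
  have pw: "permutation w" by (rule permutation_perms[OF wp])
  \<comment> \<open>\<open>m\<close> is a multiple of the order of \<open>w\<close> with all prime
    factors in \<open>S\<close>; \<open>m'\<close> is an exponent annihilating the phases, with no
    prime factor in \<open>S\<close>.\<close>
  define m where "m = (\<Prod>x<n. least_power w x)"
  define m' where "m' = (\<Prod>x<n. least_power u x div gcd ?M (least_power u x))"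
  have "(w ^^ m) x = x" for x
  proof (cases "x < n")
    case True
    then have "least_power w x dvd m" unfolding m_def by (intro dvd_prodI) auto
    then show ?thesis using least_power_dvd[OF pw] by blast
  next
    case False
    then show ?thesis using permutes_not_in[OF permutes_funpow[of w "{..<n}" m], of x] wp by simp
  qed
  then have "w ^^ m = id" by (simp add: fun_eq_iff)
  then have 1: "cyc_char n ?M u w ^ m = 1" using cyc_char_power[OF u w, of ?M m] cyc_char_id by simp
  have Lpos: "least_power u x > 0" for x using least_power_of_permutation(2)[OF pu] .
  have ph: "phase ?M u x ^ m' = 1" if "x < n" for x
  proof -
    let ?L = "least_power u x"
    have "?L div gcd ?M ?L dvd m'" unfolding m'_def using that by (intro dvd_prodI[where f = "\<lambda>x. least_power u x div gcd ?M (least_power u x)"]) auto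
    then obtain q where "m' = ?L div gcd ?M ?L * q" by blast
    then have "zeta ?M ?L ^ m' = 1" using zeta_power_cofactor[OF Lpos, of ?M x] by (simp add: power_mult)
    moreover have "(zeta ?M ?L ^ k) ^ m' = (zeta ?M ?L ^ m') ^ k" for k
      by (simp only: power_mult[symmetric] mult.commute)
    ultimately show ?thesis unfolding phase_def by simp
  qed
  have "cycle_shift ?M u w (Min Q) ^ m' = 1" if Q: "Q \<in> orb u ` {..<n}" for Q
  proof -
    obtain x where x: "x < n" "Q = orb u x" using Q by blast
    then have "Min Q < n" using Min_orb[OF pu, of x] orb_subset[OF u x(1)] by auto
    then show ?thesis using ph perms_less[OF wp] by (simp add: cycle_shift_def power_divide)
  qed
  then have 2: "cyc_char n ?M u w ^ m' = 1" unfolding cyc_char_def prod_power_distrib by (intro prod.neutral ballI)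
  have "coprime m m'"
  proof (rule ccontr)
    assume "\<not> coprime m m'"
    then obtain p where p: "prime p" "p dvd m" "p dvd m'"
      by (metis coprime_def dvd_refl dvd_trans prime_factor_nat is_unit_gcd gcd_greatest_iff gcd_eq_1_imp_coprime coprime_iff_gcd_eq_1 not_prime_1 gcd_dvd1 gcd_dvd2)
    obtain x where x: "x < n" "p dvd least_power w x"
      using p unfolding m_def by (auto simp: prime_dvd_prod_iff)
    then have "p \<in> S" using S[OF x(1)] p(1) by (auto simp: P_in_def)
    obtain y where y: "y < n" "p dvd least_power u y div gcd ?M (least_power u y)"
      using p unfolding m'_def by (auto simp: prime_dvd_prod_iff)
    have "least_power u y \<le> n"
      using card_mono[OF _ orb_subset[OF u y(1)]] card_orb[OF pu, of y] by simp
    then show False using S_prime_not_dvd_cofactor[OF p(1) \<open>p \<in> S\<close> Lpos, of y n] y(2) by blast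
  qed
  then show ?thesis using coprime_powers_one[OF 1 2] by blast
qed

text \<open>On the orbit of \<open>x0\<close> under commuting \<open>u\<close> and \<open>w\<close>, let \<open>u ^ s\<close> be the first power of \<open>u\<close> that
  returns \<open>x0\<close> to its \<open>w\<close>-cycle, where it acts as \<open>w ^ t\<close>. The cycles of \<open>u\<close> on this orbit are
  represented by \<open>w ^ i x0\<close> for \<open>i < gcd t k\<close>, so the product of the shifts telescopes.\<close>

lemma orbit_shift_product:
  fixes x0 :: nat
  assumes u: "u \<in> perms n" and w: "w \<in> centralizer n u"
    and k: "k = least_power w x0"
    and s: "s > 0" "(u ^^ s) x0 = (w ^^ t) x0" "\<And>a. 0 < a \<Longrightarrow> a < s \<Longrightarrow> (u ^^ a) x0 \<notin> orb w x0"
    and z: "[z * t = gcd t k] (mod k)"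
    and X: "X = {(u ^^ a) ((w ^^ b) x0) |a b. True}"
  shows "(\<Prod>Q\<in>orb u ` X. cycle_shift M u w (Min Q)) = zeta M k ^ (z * gcd t k)"
proof -
  define g where "g = gcd t k"
  have wp: "w \<in> perms n" using centralizerD(1)[OF w] .
  have pu: "permutation u" by (rule permutation_perms[OF u])
  have pw: "permutation w" by (rule permutation_perms[OF wp])
  have kpos: "k > 0" using least_power_of_permutation(2)[OF pw] by (simp add: k)
  then have gpos: "g > 0" by (simp add: g_def)
  have gk: "g dvd k" "g dvd t" by (simp_all add: g_def)
  have wk: "(w ^^ i) x0 = (w ^^ j) x0 \<longleftrightarrow> [i = j] (mod k)" for i j
    using funpow_eq_iff[OF pw] by (simp add: k cong_def)
  have comm: "(w ^^ j) ((u ^^ i) x) = (u ^^ i) ((w ^^ j) x)" for i j x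
    by (rule funpow_comm2) (rule centralizerD(2)[OF w])
  have usc: "(u ^^ (s * c)) x0 = (w ^^ (t * c)) x0" for c
  proof (induction c)
    case (Suc c)
    have "(u ^^ (s * Suc c)) x0 = (u ^^ s) ((u ^^ (s * c)) x0)" by (simp add: funpow_add)
    also have "\<dots> = (w ^^ (t * c)) ((u ^^ s) x0)" by (simp only: Suc comm)
    also have "\<dots> = (w ^^ (t * c + t)) x0" by (simp only: s(2) funpow_add comp_apply)
    also have "t * c + t = t * Suc c" by simp
    finally show ?case .
  qed simp
  have inD: "(u ^^ a) x0 \<in> orb w x0 \<longleftrightarrow> s dvd a" for a
  proof
    assume a: "(u ^^ a) x0 \<in> orb w x0"
    have "(u ^^ a) x0 = (u ^^ (a mod s)) ((u ^^ (s * (a div s))) x0)"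
      by (metis comp_apply funpow_add mod_mult_div_eq)
    also have "\<dots> = (w ^^ (t * (a div s))) ((u ^^ (a mod s)) x0)" by (simp only: usc comm)
    finally have e: "(u ^^ a) x0 = (w ^^ (t * (a div s))) ((u ^^ (a mod s)) x0)" .
    then have "(u ^^ a) x0 \<in> orb w ((u ^^ (a mod s)) x0)" by blast
    then have "orb w ((u ^^ (a mod s)) x0) = orb w x0" using orb_eq[OF pw] a by metis
    then have "(u ^^ (a mod s)) x0 \<in> orb w x0" using orb_self[of "(u ^^ (a mod s)) x0" w] by simp
    then have "a mod s = 0" using s(1) s(3)[of "a mod s"] by auto
    then show "s dvd a" by auto
  next
    assume "s dvd a"
    then obtain c where "a = s * c" by blast
    then show "(u ^^ a) x0 \<in> orb w x0" using usc by auto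
  qed
  have fixed: "(u ^^ a) x0 = x0 \<longleftrightarrow> s * (k div g) dvd a" for a
  proof -
    have "(u ^^ a) x0 = x0 \<longleftrightarrow> (\<exists>c. a = s * c \<and> k dvd t * c)"
    proof
      assume e: "(u ^^ a) x0 = x0"
      then have "(u ^^ a) x0 \<in> orb w x0" using orb_self[of x0 w] by simp
      then have "s dvd a" using inD by blast
      then obtain c where c: "a = s * c" by blast
      have "(w ^^ (t * c)) x0 = (w ^^ 0) x0" using usc[of c] e c by simp
      then show "\<exists>c. a = s * c \<and> k dvd t * c" using wk[of "t * c" 0] c by (auto simp: cong_0_iff)
    next
      assume "\<exists>c. a = s * c \<and> k dvd t * c"
      then obtain c where c: "a = s * c" "k dvd t * c" by blast
      then have "(w ^^ (t * c)) x0 = (w ^^ 0) x0" using wk[of "t * c" 0] by (simp add: cong_0_iff)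
      then show "(u ^^ a) x0 = x0" using usc[of c] c by simp
    qed
    also have "\<dots> \<longleftrightarrow> (\<exists>c. a = s * c \<and> k div g dvd c)"
    proof -
      have "k dvd t * c \<longleftrightarrow> k div g dvd c" for c
      proof -
        have kt: "k = g * (k div g)" "t = g * (t div g)" using gk by simp_all
        have cop: "coprime (k div g) (t div g)"
          unfolding g_def using kpos by (simp add: div_gcd_coprime coprime_commute gcd.commute)
        have "k dvd t * c \<longleftrightarrow> g * (k div g) dvd g * ((t div g) * c)" using kt by (metis mult.assoc)
        also have "\<dots> \<longleftrightarrow> k div g dvd (t div g) * c" using gpos by simp
        also have "\<dots> \<longleftrightarrow> k div g dvd c" using cop by (rule coprime_dvd_mult_right_iff)
        finally show ?thesis .
      qed
      then show ?thesis by simp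
    qed
    also have "\<dots> \<longleftrightarrow> s * (k div g) dvd a" using s(1) by (auto simp: dvd_def mult.assoc)
    finally show ?thesis .
  qed
  \<comment> \<open>Every \<open>s\<close> steps \<open>u\<close> returns to the
    \<open>w\<close>-cycle, rotated by \<open>t\<close>, and this rotation has order
    \<open>k div g\<close>.\<close>
  have L: "least_power u x0 = s * (k div g)"
    by (rule dvd_antisym) (metis fixed least_power_dvd[OF pu] dvd_refl)+
  have z': "[z * t = g] (mod k)" using z by (simp add: g_def)
  \<comment> \<open>By the choice of \<open>z\<close>, \<open>s * z\<close> steps of
    \<open>u\<close> lead from \<open>x0\<close> to \<open>(w ^^ g) x0\<close>, so the
    \<open>u\<close>-cycle of \<open>(w ^^ b) x0\<close> depends only on
    \<open>b mod g\<close>.\<close>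
  have reach: "(w ^^ b) x0 \<in> orb u ((w ^^ (b mod g)) x0)" for b
  proof -
    have "[b mod g + t * (z * (b div g)) = b mod g + g * (b div g)] (mod k)"
      using cong_scalar_right[OF z', of "b div g"] by (intro cong_add) (simp_all add: mult_ac)
    then have "(w ^^ b) x0 = (w ^^ (b mod g + t * (z * (b div g)))) x0"
      using wk[of b "b mod g + t * (z * (b div g))"] by (simp add: cong_sym)
    also have "\<dots> = (w ^^ (b mod g)) ((u ^^ (s * (z * (b div g)))) x0)" by (simp add: funpow_add usc)
    also have "\<dots> = (u ^^ (s * (z * (b div g)))) ((w ^^ (b mod g)) x0)" by (rule comm)
    finally show ?thesis by blast
  qed
  have bij: "bij_betw (\<lambda>i. orb u ((w ^^ i) x0)) {..<g} (orb u ` X)"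
  proof (rule bij_betw_imageI)
    show "inj_on (\<lambda>i. orb u ((w ^^ i) x0)) {..<g}"
    proof (rule inj_onI)
      fix i j assume ij: "i \<in> {..<g}" "j \<in> {..<g}" and e: "orb u ((w ^^ i) x0) = orb u ((w ^^ j) x0)"
      have "(w ^^ j) x0 \<in> orb u ((w ^^ i) x0)" unfolding e by (rule orb_self)
      then obtain a where a: "(w ^^ j) x0 = (u ^^ a) ((w ^^ i) x0)" by blast
      then have a': "(w ^^ j) x0 = (w ^^ i) ((u ^^ a) x0)" by (simp only: comm)
      have "orb w ((w ^^ j) x0) = orb w x0" by (rule orb_eq[OF pw]) blast
      moreover have "orb w ((w ^^ j) x0) = orb w ((u ^^ a) x0)" unfolding a' by (rule orb_eq[OF pw]) blast
      ultimately have "orb w ((u ^^ a) x0) = orb w x0" by simp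
      then have "(u ^^ a) x0 \<in> orb w x0" using orb_self[of "(u ^^ a) x0" w] by simp
      then have "s dvd a" using inD by blast
      then obtain c where "a = s * c" by blast
      then have "(w ^^ j) x0 = (w ^^ (i + t * c)) x0" using a' usc by (simp add: funpow_add)
      then have "[j = i + t * c] (mod k)" using wk by blast
      then have "[j = i + t * c] (mod g)" using gk(1) by (rule cong_dvd_modulus_nat)
      moreover have "[i + t * c = i + 0] (mod g)"
        using gk(2) by (intro cong_add) (auto simp: cong_0_iff)
      ultimately have "[j = i] (mod g)" using cong_trans by fastforce
      then show "i = j" using ij by (simp add: cong_def)
    qed
    show "(\<lambda>i. orb u ((w ^^ i) x0)) ` {..<g} = orb u ` X"
    proof
      show "(\<lambda>i. orb u ((w ^^ i) x0)) ` {..<g} \<subseteq> orb u ` X"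
      proof
        fix Q assume "Q \<in> (\<lambda>i. orb u ((w ^^ i) x0)) ` {..<g}"
        then obtain i where Q: "Q = orb u ((w ^^ i) x0)" by blast
        have "(w ^^ i) x0 = (u ^^ 0) ((w ^^ i) x0)" by simp
        then have "(w ^^ i) x0 \<in> X" unfolding X by blast
        then show "Q \<in> orb u ` X" unfolding Q by blast
      qed
      show "orb u ` X \<subseteq> (\<lambda>i. orb u ((w ^^ i) x0)) ` {..<g}"
      proof
        fix Q assume "Q \<in> orb u ` X"
        then obtain a b where Q: "Q = orb u ((u ^^ a) ((w ^^ b) x0))" unfolding X by blast
        have "Q = orb u ((w ^^ b) x0)" unfolding Q by (rule orb_eq[OF pu]) blast
        also have "\<dots> = orb u ((w ^^ (b mod g)) x0)" by (rule orb_eq[OF pu reach])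
        finally show "Q \<in> (\<lambda>i. orb u ((w ^^ i) x0)) ` {..<g}" using gpos by auto
      qed
    qed
  qed
  have "(\<Prod>Q\<in>orb u ` X. cycle_shift M u w (Min Q)) = (\<Prod>i<g. cycle_shift M u w ((w ^^ i) x0))"
    by (rule prod_shift_transversal[OF u w bij])
  also have "\<dots> = phase M u ((w ^^ g) x0) / phase M u x0"
  proof (induction g)
    case (Suc g)
    then show ?case using phase_nonzero by (simp add: cycle_shift_def)
  qed (simp add: phase_nonzero)
  \<comment> \<open>The telescoped ratio compares two points of one \<open>u\<close>-cycle,
    \<open>s * z\<close> steps apart; as its length is \<open>s * (k div g)\<close>, the factor
    \<open>s\<close> cancels in the exponent.\<close>
  also have "(w ^^ g) x0 = (u ^^ (s * z)) x0"
    using wk[of g "t * z"] z' by (simp add: usc cong_sym mult.commute)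
  also have "phase M u ((u ^^ (s * z)) x0) = zeta M (s * (k div g)) ^ (s * z) * phase M u x0"
    using phase_funpow[OF pu] L by simp
  also have "zeta M (s * (k div g)) ^ (s * z) = zeta M k ^ (z * g)"
  proof -
    obtain kk where kk: "k = g * kk" using gk(1) by blast
    have kd: "k div g = kk" "kk > 0" using gpos kpos kk by auto
    have "2 * pi * real M * real (s * z) / real (s * kk) = 2 * pi * real M * real (z * g) / real (g * kk)"
      using s(1) gpos kd(2) by (simp add: field_simps)
    then show ?thesis unfolding zeta_power kd(1) by (simp only: kk)
  qed
  finally show ?thesis by (simp add: phase_nonzero g_def)
qed

text \<open>On \<open>{0..<k}\<close>, replaces the unit part of a residue by its inverse.\<close>

definition unit_inverse :: "nat \<Rightarrow> nat \<Rightarrow> nat" where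
  "unit_inverse k t = ((SOME z. [z * t = gcd t k] (mod k)) * gcd t k) mod k"

lemma cong_mult_left_iff: "g > 0 \<Longrightarrow> [g * a = g * b] (mod (g * n)) \<longleftrightarrow> [a = b] (mod n)" for g :: nat
  by (simp add: cong_def flip: mult_mod_right)

lemma gcd_cong_witness: "\<exists>z. [z * t = gcd t k] (mod k)" for t k :: nat
proof (cases "t = 0")
  case True
  then show ?thesis by (auto simp: cong_def)
next
  case False
  then show ?thesis using cong_solve_nat[of t k] by (auto simp: mult.commute)
qed

text \<open>The multiplier \<open>z\<close> is invertible modulo \<open>k div g\<close>, so the
  value has the same gcd \<open>g\<close> with \<open>k\<close> as \<open>t\<close> has. Equal
  values thus have equal \<open>g\<close> and congruent multipliers, and \<open>t div g\<close> is
  recovered as the inverse of \<open>z\<close> modulo \<open>k div g\<close>.\<close>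

lemma unit_inverse_inj:
  assumes k: "k > 0" shows "inj_on (unit_inverse k) {..<k}"
proof (rule inj_onI)
  fix t t' assume t: "t \<in> {..<k}" "t' \<in> {..<k}" and e: "unit_inverse k t = unit_inverse k t'"
  define z where "z = (\<lambda>t. SOME z. [z * t = gcd t k] (mod k))"
  have z: "[z t * t = gcd t k] (mod k)" for t
    unfolding z_def using gcd_cong_witness[of t k] by (rule someI_ex)
  have unit: "[z t * (t div gcd t k) = 1] (mod (k div gcd t k))" for t
  proof -
    let ?g = "gcd t k"
    have g: "?g > 0" using k by simp
    have "[?g * (z t * (t div ?g)) = ?g * 1] (mod (?g * (k div ?g)))"
      using z[of t] by (simp add: mult.left_commute)
    then show ?thesis by (simp only: cong_mult_left_iff[OF g])
  qed
  have gcd: "gcd (unit_inverse k t) k = gcd t k" for t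
  proof -
    let ?g = "gcd t k"
    have "coprime (z t) (k div ?g)"
      using unit[of t] unfolding coprime_iff_invertible_nat by auto
    then have "gcd (z t * ?g) (?g * (k div ?g)) = ?g"
      by (metis coprime_iff_gcd_eq_1 gcd_mult_distrib_nat mult.commute mult.right_neutral)
    moreover have "gcd (unit_inverse k t) k = gcd (z t * ?g) k"
      unfolding unit_inverse_def z_def by (metis gcd.commute gcd_red_nat)
    ultimately show ?thesis by simp
  qed
  let ?g = "gcd t k"
  have g: "gcd t' k = ?g" using gcd[of t] gcd[of t'] e by simp
  have gpos: "?g > 0" using k by simp
  let ?k = "k div ?g" and ?a = "t div ?g" and ?a' = "t' div ?g"
  have "[?g * z t = ?g * z t'] (mod (?g * ?k))"
    using e g by (simp add: unit_inverse_def cong_def z_def mult.commute)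
  then have zz: "[z t = z t'] (mod ?k)" by (simp only: cong_mult_left_iff[OF gpos])
  have u1: "[z t * ?a = 1] (mod ?k)" and u2: "[z t' * ?a' = 1] (mod ?k)" using unit[of t] unit[of t'] g by auto
  have "[?a = ?a * (z t' * ?a')] (mod ?k)" using cong_scalar_left[OF cong_sym[OF u2], of ?a] by simp
  also have "[?a * (z t' * ?a') = ?a * (z t * ?a')] (mod ?k)"
    by (intro cong_scalar_left cong_scalar_right cong_sym[OF zz])
  also have "?a * (z t * ?a') = (z t * ?a) * ?a'" by simp
  also have "[(z t * ?a) * ?a' = ?a'] (mod ?k)" using cong_scalar_right[OF u1, of ?a'] by simp
  finally have a: "[?a = ?a'] (mod ?k)" .
  have "t div ?g < ?k" "t' div ?g < ?k"
    using t g by (auto simp: div_less_iff_less_mult gpos dvd_div_mult_self)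
  then have "?a = ?a'" using a by (simp add: cong_def)
  then show "t = t'" using g by (metis dvd_div_mult_self gcd_dvd1)
qed

section \<open>Cancellation by twisting along one cycle\<close>

lemma sum_zeta_zero:
  assumes "k > 0" "\<not> k dvd M" shows "(\<Sum>j<k. zeta M k ^ j) = 0"
proof -
  have "zeta M k \<noteq> 1"
  proof
    assume "zeta M k = 1"
    then have "cos (2 * pi * real M / real k) = 1" by (simp add: zeta_def complex_eq_iff)
    then obtain m :: int where "2 * pi * real M / real k = of_int m * 2 * pi"
      by (auto simp: cos_one_2pi_int)
    then have "real M = of_int m * real k" using assms(1) by (simp add: field_simps)
    then have "int M = m * int k" by (metis of_int_eq_iff of_int_mult of_int_of_nat_eq)
    then have "int k dvd int M" by simp
    then show False using assms(2) by (simp only: int_dvd_int_iff)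
  qed
  then show ?thesis using zeta_power_self[OF assms(1), of M] by (simp add: geometric_sum)
qed

text \<open>The powers of a single cycle of \<open>w\<close>. They form a cyclic subgroup of the
  centralizer of \<open>w\<close>, and the characters cancel within each of its cosets.\<close>

definition local_pow :: "(nat \<Rightarrow> nat) \<Rightarrow> nat \<Rightarrow> nat \<Rightarrow> nat \<Rightarrow> nat" where
  "local_pow w x0 t x = (if x \<in> orb w x0 then (w ^^ t) x else x)"

lemma local_pow:
  assumes w: "w \<in> perms n" and x0: "x0 < n"
  shows "local_pow w x0 t \<circ> local_pow w x0 t' = local_pow w x0 (t + t')"
    and "local_pow w x0 (least_power w x0 * m) = id"
    and "local_pow w x0 t \<in> centralizer n w"
proof -
  have pw: "permutation w" by (rule permutation_perms[OF w])
  have D: "(w ^^ i) x \<in> orb w x0 \<longleftrightarrow> x \<in> orb w x0" for i x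
  proof -
    have e: "orb w ((w ^^ i) x) = orb w x" by (rule orb_eq[OF pw]) blast
    have "y \<in> orb w x0 \<longleftrightarrow> orb w y = orb w x0" for y
      using orb_eq[OF pw, of y x0] orb_self[of y w] by auto
    then show ?thesis using e by simp
  qed
  show comp: "local_pow w x0 t \<circ> local_pow w x0 t' = local_pow w x0 (t + t')" for t t'
    by (rule ext) (simp add: local_pow_def D funpow_add)
  show one: "local_pow w x0 (least_power w x0 * m) = id" for m
  proof
    fix x
    have "(w ^^ (least_power w x0 * m)) x = x" if "x \<in> orb w x0"
      using least_power_orb[OF pw that] least_power_dvd[OF pw, of x "least_power w x0 * m"] by simp
    then show "local_pow w x0 (least_power w x0 * m) x = id x" by (simp add: local_pow_def)
  qed
  have "bij (local_pow w x0 t)"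
  proof (rule o_bij)
    let ?m = "least_power w x0 * t - t"
    have "least_power w x0 > 0" by (rule least_power_of_permutation(2)[OF pw])
    then have "t \<le> least_power w x0 * t" by (cases "least_power w x0") auto
    then have m: "?m + t = least_power w x0 * t" "t + ?m = least_power w x0 * t" by auto
    show "local_pow w x0 ?m \<circ> local_pow w x0 t = id" by (simp only: comp m one)
    show "local_pow w x0 t \<circ> local_pow w x0 ?m = id" by (simp only: comp m one)
  qed
  moreover have "local_pow w x0 t x = x" if "x \<notin> {..<n}" for x
    using orb_subset[OF w x0] that by (auto simp: local_pow_def)
  ultimately have p: "local_pow w x0 t \<in> perms n"
    unfolding mem_Collect_eq permutes_def by (metis bij_pointE)
  have "w x \<in> orb w x0 \<longleftrightarrow> x \<in> orb w x0" for x using D[of 1 x] by simp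
  then have "local_pow w x0 t (w x) = w (local_pow w x0 t x)" for x
    by (simp add: local_pow_def funpow_swap1)
  then have "local_pow w x0 t \<circ> w = w \<circ> local_pow w x0 t" by (simp only: fun_eq_iff comp_apply) simp
  then show "local_pow w x0 t \<in> centralizer n w" using p unfolding centralizer_def by blast
qed

lemma joint_orbit_closed:
  assumes wu: "\<And>x. w (u x) = u (w x)" and X: "X = {(u ^^ a) ((w ^^ b) x0) |a b. True}"
  shows "x \<in> X \<Longrightarrow> u x \<in> X" "x \<in> X \<Longrightarrow> w x \<in> X" "x0 \<in> X" "orb w x0 \<subseteq> X"
proof -
  show "u x \<in> X" if "x \<in> X"
  proof -
    from that obtain a b where "x = (u ^^ a) ((w ^^ b) x0)" unfolding X by blast
    then have "u x = (u ^^ Suc a) ((w ^^ b) x0)" by simp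
    then show ?thesis unfolding X by blast
  qed
  show "w x \<in> X" if "x \<in> X"
  proof -
    from that obtain a b where "x = (u ^^ a) ((w ^^ b) x0)" unfolding X by blast
    then have "w x = (u ^^ a) ((w ^^ Suc b) x0)" using funpow_comm[of w u a] wu by simp
    then show ?thesis unfolding X by blast
  qed
  have w0: "(w ^^ b) x0 \<in> X" for b
  proof -
    have "(w ^^ b) x0 = (u ^^ 0) ((w ^^ b) x0)" by simp
    then show ?thesis unfolding X by blast
  qed
  then show "orb w x0 \<subseteq> X" by blast
  show "x0 \<in> X" using w0[of 0] by simp
qed

text \<open>Powers of \<open>w\<close> do not lead out of the joint orbit. One inclusion is enough,
  because \<open>u\<close> is in turn a twist of \<open>v\<close>.\<close>

lemma joint_orbit_twist:
  assumes wu: "\<And>x. w (u x) = u (w x)" and v: "v = u \<circ> local_pow w x0 t"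
  shows "{(v ^^ a) ((w ^^ b) x0) |a b. True} \<subseteq> {(u ^^ a) ((w ^^ b) x0) |a b. True}"
proof -
  let ?X = "{(u ^^ a) ((w ^^ b) x0) |a b. True}"
  note C = joint_orbit_closed[of w u ?X x0, OF wu refl]
  have wX: "(w ^^ i) x \<in> ?X" if "x \<in> ?X" for i x using that C(2) by (induction i) auto
  have vX: "v x \<in> ?X" if "x \<in> ?X" for x
    using C(1)[OF that] C(1)[OF wX[OF that, of t]] by (simp add: v local_pow_def)
  have "(v ^^ a) ((w ^^ b) x0) \<in> ?X" for a b
  proof (induction a)
    case 0
    then show ?case using wX[OF C(3), of b] by simp
  next
    case (Suc a)
    then show ?case using vX by simp
  qed
  then show ?thesis by blast
qed

text \<open>The twists of \<open>u\<close> differ only on the joint orbit of \<open>x0\<close>, where their characters run through all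
  powers of a nontrivial root of unity.\<close>

lemma sum_cyc_char_twists:
  assumes u: "u \<in> centralizer n w" and w: "w \<in> perms n" and x0: "x0 < n"
    and M: "\<not> least_power w x0 dvd M"
  shows "(\<Sum>t<least_power w x0. cyc_char n M (u \<circ> local_pow w x0 t) w) = 0"
proof -
  define k where "k = least_power w x0"
  have pw: "permutation w" by (rule permutation_perms[OF w])
  have up: "u \<in> perms n" by (rule centralizerD(1)[OF u])
  have pu: "permutation u" by (rule permutation_perms[OF up])
  have kpos: "k > 0" unfolding k_def by (rule least_power_of_permutation(2)[OF pw])
  let ?v = "\<lambda>t. u \<circ> local_pow w x0 t"
  have vc: "?v t \<in> centralizer n w" for t
    by (rule perm_subgroupD(3)[OF perm_subgroup_centralizer[OF w] u local_pow(3)[OF w x0]])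
  have vp: "?v t \<in> perms n" for t by (rule centralizerD(1)[OF vc])
  have pv: "permutation (?v t)" for t by (rule permutation_perms[OF vp])
  have wv: "w \<in> centralizer n (?v t)" for t by (rule centralizer_sym[OF w vc])
  have wcomm: "w (?v t x) = ?v t (w x)" for t x by (rule centralizerD(2)[OF wv])
  have ucomm: "w (u x) = u (w x)" for x by (rule centralizerD(2)[OF u, symmetric])
  define X where "X = {(u ^^ a) ((w ^^ b) x0) |a b. True}"
  note C = joint_orbit_closed[of w u X x0, OF ucomm X_def]
  have Xv: "X = {((?v t) ^^ a) ((w ^^ b) x0) |a b. True}" for t
  proof
    show "{((?v t) ^^ a) ((w ^^ b) x0) |a b. True} \<subseteq> X"
      unfolding X_def by (rule joint_orbit_twist[where w = w and u = u, OF ucomm refl])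
    have "t \<le> k * t" using kpos by (cases k) auto
    then have "t + (k * t - t) = k * t" by simp
    then have "u = ?v t \<circ> local_pow w x0 (k * t - t)"
      by (simp only: comp_assoc local_pow(1)[OF w x0] k_def local_pow(2)[OF w x0] comp_id)
    then show "X \<subseteq> {((?v t) ^^ a) ((w ^^ b) x0) |a b. True}"
      unfolding X_def by (rule joint_orbit_twist[where w = w and u = "?v t", OF wcomm])
  qed
  have Xn: "X \<subseteq> {..<n}"
  proof
    fix x assume "x \<in> X"
    then obtain a b where "x = (u ^^ a) ((w ^^ b) x0)" unfolding X_def by blast
    then show "x \<in> {..<n}"
      using permutes_in_image[OF permutes_funpow[of u "{..<n}" a]] permutes_in_image[OF permutes_funpow[of w "{..<n}" b]] up w x0
      by simp
  qed
  have finX: "finite X" by (rule finite_subset[OF Xn]) simp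
  have inv_closed: "f x \<in> X \<longleftrightarrow> x \<in> X" if f: "inj f" "\<And>x. x \<in> X \<Longrightarrow> f x \<in> X" for f x
  proof
    have "f ` X = X" by (rule endo_inj_surj[OF finX]) (use f in \<open>auto simp: inj_on_def dest: injD\<close>)
    then show "f x \<in> X \<Longrightarrow> x \<in> X" using f(1) by (metis imageE injD)
  qed (rule f(2))
  have wX: "w x \<in> X \<longleftrightarrow> x \<in> X" for x
    by (rule inv_closed) (use C(2) permutes_inj[of w "{..<n}"] w in auto)
  have uX: "u x \<in> X \<longleftrightarrow> x \<in> X" for x
    by (rule inv_closed) (use C(1) permutes_inj[of u "{..<n}"] up in auto)
  have off: "((?v t) ^^ i) x = (u ^^ i) x \<and> (u ^^ i) x \<notin> X" if x: "x \<notin> X" for t i x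
  proof (induction i)
    case (Suc i)
    then have "(u ^^ i) x \<notin> orb w x0" using C(4) by blast
    then show ?case using Suc uX by (simp add: local_pow_def)
  qed (simp add: x)
  have offorb: "orb (?v t) x = orb u x" if "x \<notin> X" for t x using off[OF that] by auto
  have offphase: "phase M (?v t) x = phase M u x" if x: "x \<notin> X" for t x
  proof -
    have "Min (orb u x) \<notin> X" using Min_orb[OF pu, of x] off[OF x] by auto
    then have "((?v t) ^^ i) (Min (orb u x)) = (u ^^ i) (Min (orb u x))" for i using off by blast
    moreover have "least_power (?v t) x = least_power u x"
      using offorb[OF x] card_orb[OF pu] card_orb[OF pv] by metis
    ultimately show ?thesis unfolding phase_def offorb[OF x] by simp
  qed
  \<comment> \<open>The cycles off the joint orbit \<open>X\<close>, where \<open>?v t\<close>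
    agrees with \<open>u\<close>: their contribution is independent of \<open>t\<close> and factors
    out of the sum.\<close>
  define K where "K = (\<Prod>Q\<in>orb u ` ({..<n} - X). cycle_shift M u w (Min Q))"
  have split: "cyc_char n M (?v t) w = K * (\<Prod>Q\<in>orb (?v t) ` X. cycle_shift M (?v t) w (Min Q))" for t
  proof -
    have "orb (?v t) ` {..<n} = orb (?v t) ` ({..<n} - X) \<union> orb (?v t) ` X" using Xn by auto
    moreover have "orb (?v t) ` ({..<n} - X) \<inter> orb (?v t) ` X = {}"
    proof -
      have "orb (?v t) x \<noteq> orb (?v t) y" if xy: "x \<notin> X" "y \<in> X" for x y
      proof
        assume "orb (?v t) x = orb (?v t) y"
        then have "y \<in> orb (?v t) x" using orb_self[of y "?v t"] by simp
        then have "y \<in> orb u x" using offorb[OF xy(1)] by simp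
        then show False using off[OF xy(1)] xy(2) by auto
      qed
      then show ?thesis by blast
    qed
    ultimately have "cyc_char n M (?v t) w
        = (\<Prod>Q\<in>orb (?v t) ` ({..<n} - X). cycle_shift M (?v t) w (Min Q)) * (\<Prod>Q\<in>orb (?v t) ` X. cycle_shift M (?v t) w (Min Q))"
      unfolding cyc_char_def using finX by (simp add: prod.union_disjoint)
    moreover have "(\<Prod>Q\<in>orb (?v t) ` ({..<n} - X). cycle_shift M (?v t) w (Min Q)) = K"
    proof -
      have "orb (?v t) ` ({..<n} - X) = orb u ` ({..<n} - X)" by (rule image_cong[OF refl]) (rule offorb, simp)
      moreover have "cycle_shift M (?v t) w (Min Q) = cycle_shift M u w (Min Q)" if Q: "Q \<in> orb u ` ({..<n} - X)" for Q
      proof -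
        obtain x where x: "x \<notin> X" "Q = orb u x" using Q by blast
        then have "Min Q \<notin> X" using Min_orb[OF pu, of x] off[OF x(1)] by auto
        then show ?thesis using offphase wX by (simp add: cycle_shift_def)
      qed
      ultimately show ?thesis unfolding K_def by (intro prod.cong) auto
    qed
    ultimately show ?thesis by simp
  qed
  \<comment> \<open>The first return of \<open>x0\<close> to its \<open>w\<close>-cycle under
    \<open>u\<close>; all twists share this return time.\<close>
  define s where "s = (LEAST a. a > 0 \<and> (u ^^ a) x0 \<in> orb w x0)"
  have "least_power u x0 > 0 \<and> (u ^^ least_power u x0) x0 \<in> orb w x0"
    using least_power_of_permutation[OF pu, of x0] orb_self[of x0 w] by simp
  then have s: "s > 0 \<and> (u ^^ s) x0 \<in> orb w x0" unfolding s_def by (rule LeastI)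
  have smin: "(u ^^ a) x0 \<notin> orb w x0" if "0 < a" "a < s" for a
    using not_less_Least[of a "\<lambda>a. a > 0 \<and> (u ^^ a) x0 \<in> orb w x0"] that unfolding s_def by blast
  obtain t0 where t0: "(u ^^ s) x0 = (w ^^ t0) x0" using s by blast
  have comm: "(w ^^ j) ((u ^^ i) x) = (u ^^ i) ((w ^^ j) x)" for i j x
    by (rule funpow_comm2) (rule ucomm)
  have wD: "(w ^^ t) y \<in> orb w x0 \<longleftrightarrow> y \<in> orb w x0" for t y
  proof -
    have e: "orb w ((w ^^ t) y) = orb w y" by (rule orb_eq[OF pw]) blast
    have "y \<in> orb w x0 \<longleftrightarrow> orb w y = orb w x0" for y
      using orb_eq[OF pw, of y x0] orb_self[of y w] by auto
    then show ?thesis using e by simp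
  qed
  \<comment> \<open>The twist acts only on the \<open>w\<close>-cycle of \<open>x0\<close>, so
    exactly one factor \<open>w ^^ t\<close> is picked up until the next return.\<close>
  have vpow: "((?v t) ^^ Suc a) x0 = (w ^^ t) ((u ^^ Suc a) x0)" if "a < s" for a t
    using that
  proof (induction a)
    case 0
    have "x0 \<in> orb w x0" by (rule orb_self)
    then show ?case using comm[of t 1 x0] by (simp add: local_pow_def)
  next
    case (Suc a)
    have "(u ^^ Suc a) x0 \<notin> orb w x0" using Suc.prems by (intro smin) auto
    then have "(w ^^ t) ((u ^^ Suc a) x0) \<notin> orb w x0" using wD by blast
    then have l: "local_pow w x0 t ((w ^^ t) ((u ^^ Suc a) x0)) = (w ^^ t) ((u ^^ Suc a) x0)"
      by (simp only: local_pow_def if_False)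
    have e: "((?v t) ^^ Suc a) x0 = (w ^^ t) ((u ^^ Suc a) x0)" by (rule Suc.IH) (use Suc.prems in simp)
    have "((?v t) ^^ Suc (Suc a)) x0 = ?v t (((?v t) ^^ Suc a) x0)" by (simp only: funpow.simps comp_apply)
    also have "\<dots> = u ((w ^^ t) ((u ^^ Suc a) x0))" unfolding e comp_apply l ..
    also have "\<dots> = (w ^^ t) ((u ^^ Suc (Suc a)) x0)" using comm[of t 1 "(u ^^ Suc a) x0"] by simp
    finally show ?case .
  qed
  have inside: "(\<Prod>Q\<in>orb (?v t) ` X. cycle_shift M (?v t) w (Min Q)) = zeta M k ^ unit_inverse k ((t0 + t) mod k)" for t
  proof -
    let ?t = "(t0 + t) mod k"
    define z where "z = (SOME z. [z * ?t = gcd ?t k] (mod k))"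
    have z: "[z * ?t = gcd ?t k] (mod k)" unfolding z_def by (rule someI_ex[OF gcd_cong_witness])
    obtain s' where s': "s = Suc s'" using s by (cases s) auto
    have "((?v t) ^^ s) x0 = (w ^^ t) ((w ^^ t0) x0)" using vpow[of s' t] s' t0 by simp
    also have "\<dots> = (w ^^ (t0 + t)) x0" by (simp only: add.commute[of t0 t] funpow_add comp_apply)
    also have "\<dots> = (w ^^ ?t) x0" using funpow_eq_iff[OF pw, of "t0 + t" x0 ?t] by (simp add: k_def)
    finally have vs: "((?v t) ^^ s) x0 = (w ^^ ?t) x0" .
    have vmin: "((?v t) ^^ a) x0 \<notin> orb w x0" if a: "0 < a" "a < s" for a
    proof -
      obtain a' where a': "a = Suc a'" using a by (cases a) auto
      then show ?thesis using vpow[of a' t] a smin[OF a] wD by simp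
    qed
    have "(\<Prod>Q\<in>orb (?v t) ` X. cycle_shift M (?v t) w (Min Q)) = zeta M k ^ (z * gcd ?t k)"
      by (rule orbit_shift_product[OF vp wv k_def conjunct1[OF s] vs vmin z Xv])
    also have "\<dots> = zeta M k ^ unit_inverse k ?t"
      unfolding unit_inverse_def z_def[symmetric] by (rule zeta_power_mod[OF kpos, symmetric])
    finally show ?thesis .
  qed
  have "(\<Sum>t<k. cyc_char n M (?v t) w) = K * (\<Sum>t<k. zeta M k ^ unit_inverse k ((t0 + t) mod k))"
    by (simp only: split inside sum_distrib_left)
  \<comment> \<open>Adding \<open>t0\<close> and applying \<open>unit_inverse k\<close> both permute
    the residues modulo \<open>k\<close>, so each power of \<open>zeta M k\<close> occurs
    once.\<close>
  also have "(\<Sum>t<k. zeta M k ^ unit_inverse k ((t0 + t) mod k)) = (\<Sum>j<k. zeta M k ^ j)"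
  proof -
    have inj: "inj_on (\<lambda>t. unit_inverse k ((t0 + t) mod k)) {..<k}"
    proof (rule inj_onI)
      fix a b assume ab: "a \<in> {..<k}" "b \<in> {..<k}" and e: "unit_inverse k ((t0 + a) mod k) = unit_inverse k ((t0 + b) mod k)"
      have "(t0 + a) mod k = (t0 + b) mod k"
        by (rule inj_onD[OF unit_inverse_inj[OF kpos] e]) (use kpos in auto)
      then have "[t0 + a = t0 + b] (mod k)" by (simp only: cong_def)
      then have "[a = b] (mod k)" by (simp only: cong_add_lcancel_nat)
      then show "a = b" using ab by (simp add: cong_def)
    qed
    have "(\<lambda>t. unit_inverse k ((t0 + t) mod k)) ` {..<k} = {..<k}"
      by (rule endo_inj_surj[OF _ _ inj]) (use kpos in \<open>auto simp: unit_inverse_def\<close>)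
    then have "bij_betw (\<lambda>t. unit_inverse k ((t0 + t) mod k)) {..<k} {..<k}" using inj by (simp add: bij_betw_def)
    then show ?thesis by (rule sum.reindex_bij_betw)
  qed
  also have "\<dots> = 0" by (rule sum_zeta_zero[OF kpos]) (use M in \<open>simp add: k_def\<close>)
  finally show ?thesis by (simp only: mult_zero_right k_def)
qed

text \<open>The sum is over the index \<open>u\<close> for a fixed argument \<open>w\<close>, which
  is possible because commuting is symmetric. Either every term is 1, or some cycle length of
  \<open>w\<close> does not divide \<open>bounded_prod S n\<close> and averaging over the twists
  along that cycle gives 0.\<close>

theorem sum_cyc_char:
  assumes w: "w \<in> perms n"
  shows "(\<Sum>u\<in>centralizer n w. cyc_char n (bounded_prod S n) u w)
    = (if set (cycle_type n w) \<subseteq> P_in S then of_nat (card (centralizer n w)) else 0)"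
proof (cases "set (cycle_type n w) \<subseteq> P_in S")
  case True
  then have "least_power w x \<in> P_in S" if "x < n" for x
    using that unfolding cycle_type_parts[OF w] by blast
  then have "cyc_char n (bounded_prod S n) u w = 1" if "u \<in> centralizer n w" for u
    using cyc_char_trivial[OF centralizerD(1)[OF that] centralizer_sym[OF w that]] by blast
  then show ?thesis using True by simp
next
  case False
  then obtain x0 where x0: "x0 < n" "least_power w x0 \<notin> P_in S" unfolding cycle_type_parts[OF w] by blast
  let ?M = "bounded_prod S n" and ?k = "least_power w x0"
  have kpos: "?k > 0" by (rule least_power_of_permutation(2)[OF permutation_perms[OF w]])
  have M: "\<not> ?k dvd ?M" using P_in_if_dvd_bounded_prod[OF _ kpos] x0(2) by blast
  let ?s = "\<Sum>u\<in>centralizer n w. cyc_char n ?M u w"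
  \<comment> \<open>Each twist translates the centralizer into itself and so leaves the sum
    unchanged; \<open>?k\<close> copies are added.\<close>
  have "of_nat ?k * ?s = (\<Sum>t<?k. \<Sum>u\<in>centralizer n w. cyc_char n ?M (u \<circ> local_pow w x0 t) w)"
    using sum_subgroup_shift(1)[OF perm_subgroup_centralizer[OF w] local_pow(3)[OF w x0(1)], where h = "\<lambda>u. cyc_char n ?M u w"]
    by simp
  also have "\<dots> = (\<Sum>u\<in>centralizer n w. \<Sum>t<?k. cyc_char n ?M (u \<circ> local_pow w x0 t) w)" by (rule sum.swap)
  also have "\<dots> = 0" by (rule sum.neutral) (use sum_cyc_char_twists[OF _ w x0(1) M] in blast)
  finally show ?thesis using kpos False by simp
qed

section \<open>Schur positivity\<close>

text \<open>Identifies monomials with multisets of variables, so that coefficients become numbers of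
  words and of tableaux.\<close>

definition exponents :: "nat multiset \<Rightarrow> (nat \<Rightarrow>\<^sub>0 nat)" where
  "exponents A = (\<Sum>x\<in>#A. Poly_Mapping.single x 1)"

lemma lookup_exponents: "Poly_Mapping.lookup (exponents A) i = count A i"
  by (induction A) (auto simp: exponents_def lookup_add lookup_single when_def)

lemma exponents_inject: "exponents A = exponents B \<longleftrightarrow> A = B"
  by (metis lookup_exponents multiset_eqI)

lemma exponents_add: "exponents (A + B) = exponents A + exponents B"
  by (simp add: exponents_def)

lemma exponents_replicate: "exponents (replicate_mset k i) = Poly_Mapping.single i k"
  by (rule poly_mapping_eqI) (simp add: lookup_exponents lookup_single when_def)

lemma exponents_surj: obtains A where "m = exponents A"
proof -
  have "finite {i. Poly_Mapping.lookup m i > 0}"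
    by (rule finite_subset[OF _ finite_keys[of m]]) (auto simp: in_keys_iff)
  then have "count (Abs_multiset (Poly_Mapping.lookup m)) = Poly_Mapping.lookup m"
    by (rule count_Abs_multiset)
  then have "m = exponents (Abs_multiset (Poly_Mapping.lookup m))"
    by (intro poly_mapping_eqI) (simp add: lookup_exponents)
  then show ?thesis using that by blast
qed

lemma content_exponents: "Defs.content \<mu> T = exponents (image_mset T (mset_set (cells \<mu>)))"
  by (simp add: Defs.content_def exponents_def sum_unfold_sum_mset multiset.map_comp comp_def)

lemma mcoeff_schur: "mcoeff (schur \<mu>) (exponents B) = of_nat (ssyt_count \<mu> B)"
  by (simp add: schur.rep_eq ssyt_count_def content_exponents exponents_inject)

text \<open>For \<open>k > 0\<close> the monomials x_i^k are distinct, so a factorization whose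
  first factor occurs in \<open>power_sum k\<close> is given by exactly one
  \<open>i\<close>.\<close>

lemma mcoeff_power_sum_mult:
  assumes k: "k > 0"
  shows "mcoeff (power_sum k * g) (exponents A)
    = (\<Sum>i | replicate_mset k i \<subseteq># A. mcoeff g (exponents (A - replicate_mset k i)))"
proof -
  let ?I = "{i. replicate_mset k i \<subseteq># A}"
  let ?f = "\<lambda>i. (Poly_Mapping.single i k, exponents (A - replicate_mset k i))"
  have ex: "p \<in> ?f ` ?I" if p: "p \<in> splits (exponents A)" and e: "fst p = Poly_Mapping.single i k" for p i
  proof -
    obtain B where B: "snd p = exponents B" by (rule exponents_surj)
    have "exponents (replicate_mset k i + B) = exponents A"
      using p e B by (auto simp: splits_def exponents_add exponents_replicate)
    then have A: "A = replicate_mset k i + B" by (simp add: exponents_inject)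
    then have "p = ?f i" using e B by (simp add: prod_eq_iff)
    then show ?thesis using A by auto
  qed
  have "mcoeff (power_sum k * g) (exponents A) = (\<Sum>p\<in>splits (exponents A). mcoeff (power_sum k) (fst p) * mcoeff g (snd p))"
    by (simp add: times_mseries.rep_eq split_def)
  also have "\<dots> = (\<Sum>p\<in>?f ` ?I. mcoeff (power_sum k) (fst p) * mcoeff g (snd p))"
  proof (rule sum.mono_neutral_right)
    show "?f ` ?I \<subseteq> splits (exponents A)"
    proof
      fix p assume "p \<in> ?f ` ?I"
      then obtain i where i: "replicate_mset k i \<subseteq># A" "p = ?f i" by blast
      have "Poly_Mapping.single i k + exponents (A - replicate_mset k i) = exponents A"
        unfolding exponents_replicate[symmetric] exponents_add[symmetric] using i(1) by simp
      then show "p \<in> splits (exponents A)" using i(2) by (simp add: splits_def)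
    qed
    show "\<forall>p\<in>splits (exponents A) - ?f ` ?I. mcoeff (power_sum k) (fst p) * mcoeff g (snd p) = 0"
    proof
      fix p assume p: "p \<in> splits (exponents A) - ?f ` ?I"
      then have "\<nexists>i. fst p = Poly_Mapping.single i k" using ex by blast
      then show "mcoeff (power_sum k) (fst p) * mcoeff g (snd p) = 0" by (simp add: power_sum.rep_eq)
    qed
  qed simp
  also have "\<dots> = (\<Sum>i\<in>?I. mcoeff (power_sum k) (fst (?f i)) * mcoeff g (snd (?f i)))"
  proof (rule sum.reindex_cong[where l = ?f])
    show "inj_on ?f ?I"
    proof (rule inj_onI)
      fix i j assume "?f i = ?f j"
      then have "replicate_mset k i = replicate_mset k j" using exponents_inject by (simp add: exponents_replicate[symmetric])
      then show "i = j" using k by (metis in_replicate_mset)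
    qed
  qed auto
  also have "\<dots> = (\<Sum>i\<in>?I. mcoeff g (exponents (A - replicate_mset k i)))"
    by (intro sum.cong) (auto simp: power_sum.rep_eq)
  finally show ?thesis .
qed

lemma finite_letter_choices:
  assumes "\<forall>k\<in>set \<mu>. k > (0 :: nat)"
  shows "finite {cs. length cs = length \<mu> \<and> (\<Sum>(c, k)\<leftarrow>zip cs \<mu>. replicate_mset k c) = A}"
proof (rule finite_subset)
  have "set cs \<subseteq> set_mset (\<Sum>(c, k)\<leftarrow>zip cs \<mu>. replicate_mset k c)" if "length cs = length \<mu>" for cs
    using that assms by (induction cs \<mu> rule: list_induct2) auto
  then show "{cs. length cs = length \<mu> \<and> (\<Sum>(c, k)\<leftarrow>zip cs \<mu>. replicate_mset k c) = A}
      \<subseteq> {cs. set cs \<subseteq> set_mset A \<and> length cs = length \<mu>}" by blast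
  show "finite {cs. set cs \<subseteq> set_mset A \<and> length cs = length \<mu>}"
    by (rule finite_lists_length_eq) simp
qed

text \<open>Expanding the product means choosing one variable for each part;
  \<open>fixed_words_eq_card\<close> counts the same choices.\<close>

lemma mcoeff_power_sum_part:
  assumes "\<forall>k\<in>set \<mu>. k > 0"
  shows "(mcoeff (power_sum_part \<mu>) (exponents A) :: 'a :: comm_ring_1)
    = of_nat (card {cs. length cs = length \<mu> \<and> (\<Sum>(c, k)\<leftarrow>zip cs \<mu>. replicate_mset k c) = A})"
  using assms
proof (induction \<mu> arbitrary: A)
  case Nil
  have "exponents A = 0 \<longleftrightarrow> A = {#}" using exponents_inject[of A "{#}"] by (simp add: exponents_def)
  then show ?case by (auto simp: power_sum_part_def one_mseries.rep_eq)
next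
  case (Cons k \<mu>)
  let ?L = "\<lambda>A. {cs. length cs = length \<mu> \<and> (\<Sum>(c, k)\<leftarrow>zip cs \<mu>. replicate_mset k c) = A}"
  let ?I = "{i. replicate_mset k i \<subseteq># A}"
  have k: "k > 0" and pos: "\<forall>k\<in>set \<mu>. k > 0" using Cons.prems by auto
  have finI: "finite ?I"
  proof (rule finite_subset)
    show "?I \<subseteq> set_mset A" using k mset_subset_eqD[of "replicate_mset k _" A] by fastforce
  qed simp
  have "{cs. length cs = length (k # \<mu>) \<and> (\<Sum>(c, k)\<leftarrow>zip cs (k # \<mu>). replicate_mset k c) = A}
      = (\<Union>i\<in>?I. (#) i ` ?L (A - replicate_mset k i))"
  proof
    show "{cs. length cs = length (k # \<mu>) \<and> (\<Sum>(c, k)\<leftarrow>zip cs (k # \<mu>). replicate_mset k c) = A}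
        \<subseteq> (\<Union>i\<in>?I. (#) i ` ?L (A - replicate_mset k i))"
    proof
      fix cs assume "cs \<in> {cs. length cs = length (k # \<mu>) \<and> (\<Sum>(c, k)\<leftarrow>zip cs (k # \<mu>). replicate_mset k c) = A}"
      then obtain c ds where cs: "cs = c # ds" "length ds = length \<mu>"
        "replicate_mset k c + (\<Sum>(c, k)\<leftarrow>zip ds \<mu>. replicate_mset k c) = A"
        by (cases cs) auto
      then have "replicate_mset k c \<subseteq># A" "ds \<in> ?L (A - replicate_mset k c)" by auto
      then show "cs \<in> (\<Union>i\<in>?I. (#) i ` ?L (A - replicate_mset k i))" using cs(1) by blast
    qed
    show "(\<Union>i\<in>?I. (#) i ` ?L (A - replicate_mset k i))
        \<subseteq> {cs. length cs = length (k # \<mu>) \<and> (\<Sum>(c, k)\<leftarrow>zip cs (k # \<mu>). replicate_mset k c) = A}"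
      by auto
  qed
  then have "card {cs. length cs = length (k # \<mu>) \<and> (\<Sum>(c, k)\<leftarrow>zip cs (k # \<mu>). replicate_mset k c) = A}
      = card (\<Union>i\<in>?I. (#) i ` ?L (A - replicate_mset k i))" by (rule arg_cong)
  also have "\<dots> = (\<Sum>i\<in>?I. card ((#) i ` ?L (A - replicate_mset k i)))"
    by (rule card_UN_disjoint) (use finI finite_letter_choices[OF pos] in auto)
  also have "\<dots> = (\<Sum>i\<in>?I. card (?L (A - replicate_mset k i)))"
    by (intro sum.cong refl card_image) (auto simp: inj_on_def)
  finally have card: "card {cs. length cs = length (k # \<mu>) \<and> (\<Sum>(c, k)\<leftarrow>zip cs (k # \<mu>). replicate_mset k c) = A}
      = (\<Sum>i\<in>?I. card (?L (A - replicate_mset k i)))" .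
  have "(mcoeff (power_sum_part (k # \<mu>)) (exponents A) :: 'a) = mcoeff (power_sum k * power_sum_part \<mu>) (exponents A)"
    by (simp add: power_sum_part_def)
  also have "\<dots> = (\<Sum>i\<in>?I. of_nat (card (?L (A - replicate_mset k i))))"
    unfolding mcoeff_power_sum_mult[OF k] by (intro sum.cong refl Cons.IH[OF pos])
  finally show ?case unfolding card of_nat_sum .
qed

lemma mcoeff_of_nat_mult: "mcoeff (of_nat c * f) m = of_nat c * mcoeff f m"
  by (induction c) (simp_all add: zero_mseries.rep_eq plus_mseries.rep_eq algebra_simps)

lemma mcoeff_sum: "mcoeff (sum f A) m = (\<Sum>a\<in>A. mcoeff (f a) m)"
  by (induction A rule: infinite_finite_induct) (simp_all add: zero_mseries.rep_eq plus_mseries.rep_eq)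

lemma mcoeff_power_sum_cycle_type:
  assumes w: "w \<in> perms n"
  shows "mcoeff (power_sum_part (cycle_type n w)) (exponents A) = of_nat (fixed_words n A w)"
proof -
  obtain e where e: "type_enum n w (cycle_type n w) e" using cycle_type_enum[OF w] .
  have "\<forall>k\<in>set (cycle_type n w). k > 0" using cycle_type_partition[OF w] by (simp add: partitions_of_def)
  then show ?thesis unfolding fixed_words_eq_card[OF e w] by (rule mcoeff_power_sum_part)
qed

section \<open>Class functions attached to sets of cycle types\<close>

lemma conj_fixed_iff:
  assumes "g \<in> perms n" shows "g \<circ> w \<circ> inv g = w \<longleftrightarrow> g \<circ> w = w \<circ> g"
proof
  assume "g \<circ> w \<circ> inv g = w"
  then have "g \<circ> w \<circ> inv g \<circ> g = w \<circ> g" by (rule arg_cong)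
  then show "g \<circ> w = w \<circ> g" by (simp only: perms_inv_cancel[OF assms])
next
  assume "g \<circ> w = w \<circ> g"
  then show "g \<circ> w \<circ> inv g = w" by (simp only: perms_inv_cancel[OF assms])
qed

text \<open>Orbit-stabilizer for conjugation, where the stabilizers are the centralizers.\<close>

lemma sum_centralizers:
  assumes \<mu>: "\<mu> \<in> partitions_of n"
  shows "(\<Sum>w | w \<in> perms n \<and> cycle_type n w = \<mu>. card (centralizer n w)) = fact n"
proof -
  obtain w0 where w0: "w0 \<in> perms n" "cycle_type n w0 = \<mu>" using exists_cycle_type[OF \<mu>] by blast
  have "(\<Sum>w | w \<in> perms n \<and> cycle_type n w = \<mu>. card {g \<in> perms n. g \<circ> w \<circ> inv g = w}) = fact n"
  proof (rule transitive_action_sum_stabilizers[where act = "\<lambda>g w. g \<circ> w \<circ> inv g"])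
    show "g \<circ> h \<circ> w \<circ> inv (g \<circ> h) = g \<circ> (h \<circ> w \<circ> inv h) \<circ> inv g" if "g \<in> perms n" "h \<in> perms n" for g h w
      by (simp only: inv_comp_perms[OF that] comp_assoc)
    show "g \<circ> w \<circ> inv g \<in> {w \<in> perms n. cycle_type n w = \<mu>}" if g: "g \<in> perms n" and "w \<in> {w \<in> perms n. cycle_type n w = \<mu>}" for g w
      using that cycle_type_conj[OF _ g, of w] comp_perms[OF comp_perms[OF g] inv_perms[OF g], of w] by blast
    show "w0 \<in> {w \<in> perms n. cycle_type n w = \<mu>}" using w0 by blast
    show "\<exists>g\<in>perms n. g \<circ> w0 \<circ> inv g = w" if "w \<in> {w \<in> perms n. cycle_type n w = \<mu>}" for w
      by (rule conjugate_if_same_type) (use that w0 in auto)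
  qed
  moreover have "{g \<in> perms n. g \<circ> w \<circ> inv g = w} = centralizer n w" for w
    unfolding centralizer_def using conj_fixed_iff by blast
  ultimately show ?thesis by simp
qed

lemma card_centralizer_conj:
  assumes g: "g \<in> perms n" and w: "w \<in> perms n"
  shows "card (centralizer n (g \<circ> w \<circ> inv g)) = card (centralizer n w)"
proof -
  have cj: "(g \<circ> h \<circ> inv g) \<in> centralizer n (g \<circ> w \<circ> inv g)" if g: "g \<in> perms n" and h: "h \<in> centralizer n w" for g h w
  proof -
    have hw: "h \<circ> w = w \<circ> h" using h by (simp add: centralizer_def)
    have "g \<circ> h \<circ> inv g \<circ> (g \<circ> w \<circ> inv g) = g \<circ> (h \<circ> w) \<circ> inv g"
      by (simp only: comp_assoc perms_inv_cancel[OF g])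
    also have "\<dots> = g \<circ> w \<circ> inv g \<circ> (g \<circ> h \<circ> inv g)" unfolding hw
      by (simp only: comp_assoc perms_inv_cancel[OF g])
    finally show ?thesis
      using comp_perms[OF comp_perms[OF g centralizerD(1)[OF h]] inv_perms[OF g]] unfolding centralizer_def by blast
  qed
  have undo: "inv g \<circ> (g \<circ> h \<circ> inv g) \<circ> inv (inv g) = h" and redo: "g \<circ> (inv g \<circ> h \<circ> inv (inv g)) \<circ> inv g = h" for h
    by (simp_all only: comp_assoc perms_inv_cancel[OF g] comp_id)
  have "bij_betw (\<lambda>h. g \<circ> h \<circ> inv g) (centralizer n w) (centralizer n (g \<circ> w \<circ> inv g))"
  proof (rule bij_betw_byWitness[where f' = "\<lambda>h. inv g \<circ> h \<circ> inv (inv g)"])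
    show "(\<lambda>h. g \<circ> h \<circ> inv g) ` centralizer n w \<subseteq> centralizer n (g \<circ> w \<circ> inv g)" using cj[OF g] by blast
    show "(\<lambda>h. inv g \<circ> h \<circ> inv (inv g)) ` centralizer n (g \<circ> w \<circ> inv g) \<subseteq> centralizer n w"
      using cj[OF inv_perms[OF g], of _ "g \<circ> w \<circ> inv g"] unfolding undo by blast
  qed (use undo redo in blast)+
  then show ?thesis by (rule bij_betw_same_card[symmetric])
qed

text \<open>The inverse Frobenius image of the sum of the power sums over \<open>Q\<close>: the
  weights on each class in \<open>Q\<close> add up to \<open>fact n\<close>, so every power sum is
  counted once.\<close>

definition type_char :: "nat \<Rightarrow> nat list set \<Rightarrow> (nat \<Rightarrow> nat) \<Rightarrow> real" where
  "type_char n Q w = (if cycle_type n w \<in> Q then real (card (centralizer n w)) else 0)"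

lemma class_function_type_char: "class_function n (type_char n Q)"
  unfolding class_function_def type_char_def
  by (intro ballI) (simp only: cycle_type_conj card_centralizer_conj)

lemma sum_type_char_fixed_words:
  assumes Q: "Q \<subseteq> partitions_of n"
  shows "(\<Sum>w\<in>perms n. type_char n Q w * real (fixed_words n A w))
    = fact n * real_of_int (mcoeff (\<Sum>\<mu>\<in>Q. power_sum_part \<mu>) (exponents A))"
proof -
  let ?C = "\<lambda>\<mu>. {w \<in> perms n. cycle_type n w = \<mu>}"
  have "(\<Sum>w\<in>perms n. type_char n Q w * real (fixed_words n A w))
      = (\<Sum>\<mu>\<in>partitions_of n. \<Sum>w\<in>?C \<mu>. type_char n Q w * real (fixed_words n A w))"
    by (rule sum.group[symmetric]) (use cycle_type_partition in auto)
  also have "\<dots> = (\<Sum>\<mu>\<in>partitions_of n. if \<mu> \<in> Q then fact n * real_of_int (mcoeff (power_sum_part \<mu>) (exponents A)) else 0)"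
  proof (rule sum.cong[OF refl])
    fix \<mu> assume \<mu>: "\<mu> \<in> partitions_of n"
    have "(\<Sum>w\<in>?C \<mu>. type_char n Q w * real (fixed_words n A w))
        = (\<Sum>w\<in>?C \<mu>. (if \<mu> \<in> Q then real (card (centralizer n w)) * real_of_int (mcoeff (power_sum_part \<mu>) (exponents A)) else 0))"
      by (intro sum.cong refl) (auto simp: type_char_def mcoeff_power_sum_cycle_type)
    also have "\<dots> = (if \<mu> \<in> Q then real (\<Sum>w\<in>?C \<mu>. card (centralizer n w)) * real_of_int (mcoeff (power_sum_part \<mu>) (exponents A)) else 0)"
      by (simp add: sum_distrib_right)
    also have "\<dots> = (if \<mu> \<in> Q then fact n * real_of_int (mcoeff (power_sum_part \<mu>) (exponents A)) else 0)"
      unfolding sum_centralizers[OF \<mu>] by simp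
    finally show "(\<Sum>w\<in>?C \<mu>. type_char n Q w * real (fixed_words n A w))
        = (if \<mu> \<in> Q then fact n * real_of_int (mcoeff (power_sum_part \<mu>) (exponents A)) else 0)" .
  qed
  also have "\<dots> = (\<Sum>\<mu>\<in>Q. fact n * real_of_int (mcoeff (power_sum_part \<mu>) (exponents A)))"
    using Q by (simp add: sum.If_cases Int_absorb1)
  finally show ?thesis by (simp add: mcoeff_sum sum_distrib_left)
qed

text \<open>Divided by \<open>fact n\<close>, the pairings are the Schur coefficients: expand
  \<open>type_char\<close> in the \<open>schur_char\<close> and pair with permutation characters.
  This gives the coefficients of the power sums on one side and Kostka numbers, the coefficients of
  \<open>schur\<close>, on the other.\<close>

theorem schur_positive_if_pairings_nonneg:
  assumes Q: "Q \<subseteq> partitions_of n"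
    and pos: "\<And>\<mu>. \<mu> \<in> partitions_of n \<Longrightarrow> (\<Sum>w\<in>perms n. type_char n Q w * schur_char n \<mu> w) \<ge> 0"
  shows "schur_positive (\<Sum>\<mu>\<in>Q. power_sum_part \<mu> :: int mseries)"
proof -
  let ?f = "\<Sum>\<mu>\<in>Q. power_sum_part \<mu> :: int mseries"
  \<comment> \<open>Integrality: \<open>type_char\<close> paired with a permutation character is
    \<open>fact n\<close> times a coefficient of \<open>?f\<close>, and \<open>schur_char\<close> is
    an integral combination of permutation characters.\<close>
  have "\<exists>z. (\<Sum>w\<in>perms n. type_char n Q w * schur_char n \<mu> w) = fact n * real_of_int z" for \<mu>
  proof -
    let ?k = "\<lambda>s j. int (part_at \<mu> j) - int j + int (s j)"
    have ex: "\<exists>z. (\<Sum>w\<in>perms n. type_char n Q w * real_of_int (fixed_vec n (?k s) w)) = fact n * real_of_int z" for s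
    proof (cases "\<forall>j<n. ?k s j \<ge> 0")
      case True
      then have "fixed_vec n (?k s) w = int (fixed_words n (vec_mset n (?k s)) w)" for w
        unfolding fixed_vec_def by (rule if_P)
      then show ?thesis using sum_type_char_fixed_words[OF Q, of "vec_mset n (?k s)"] by auto
    next
      case False
      then show ?thesis using fixed_vec_neg[OF False] by (intro exI[of _ 0]) simp
    qed
    then obtain z where z: "\<And>s. (\<Sum>w\<in>perms n. type_char n Q w * real_of_int (fixed_vec n (?k s) w)) = fact n * real_of_int (z s)"
      by metis
    have "(\<Sum>w\<in>perms n. type_char n Q w * schur_char n \<mu> w)
        = (\<Sum>s\<in>perms n. real_of_int (sign s) * (\<Sum>w\<in>perms n. type_char n Q w * real_of_int (fixed_vec n (?k s) w)))"
      unfolding schur_char_def of_int_sum sum_distrib_left by (subst sum.swap) (simp add: mult.left_commute)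
    also have "\<dots> = fact n * real_of_int (\<Sum>s\<in>perms n. sign s * z s)"
      unfolding z of_int_sum sum_distrib_left by (simp add: mult.left_commute)
    finally show ?thesis by blast
  qed
  then obtain z where z: "\<And>\<mu>. (\<Sum>w\<in>perms n. type_char n Q w * schur_char n \<mu> w) = fact n * real_of_int (z \<mu>)"
    by metis
  have zpos: "z \<mu> \<ge> 0" if "\<mu> \<in> partitions_of n" for \<mu>
  proof (rule ccontr)
    assume "\<not> ?thesis"
    then have "real_of_int (z \<mu>) < 0" by simp
    then have "fact n * real_of_int (z \<mu>) < 0" by (rule mult_pos_neg[OF fact_gt_zero])
    then show False using pos[OF that] unfolding z by linarith
  qed
  have expand: "type_char n Q w = (\<Sum>\<mu>\<in>partitions_of n. real_of_int (z \<mu>) * schur_char n \<mu> w)" if w: "w \<in> perms n" for w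
  proof -
    have "fact n * type_char n Q w = (\<Sum>\<mu>\<in>partitions_of n. (\<Sum>v\<in>perms n. type_char n Q v * schur_char n \<mu> v) * schur_char n \<mu> w)"
      by (rule schur_char_complete[OF class_function_type_char w])
    also have "\<dots> = fact n * (\<Sum>\<mu>\<in>partitions_of n. real_of_int (z \<mu>) * schur_char n \<mu> w)"
      by (simp only: z sum_distrib_left mult.assoc)
    finally have "fact n * type_char n Q w = fact n * (\<Sum>\<mu>\<in>partitions_of n. real_of_int (z \<mu>) * schur_char n \<mu> w)" .
    then show ?thesis by simp
  qed
  have "?f = (\<Sum>\<mu>\<in>partitions_of n. of_nat (nat (z \<mu>)) * schur \<mu>)"
  proof (rule mseries_eqI)
    fix m
    obtain A where m: "m = exponents A" by (rule exponents_surj)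
    have "mcoeff ?f (exponents A) = (\<Sum>\<mu>\<in>partitions_of n. z \<mu> * int (ssyt_count \<mu> A))"
    proof (cases "size A = n")
      case True
      have "fact n * real_of_int (mcoeff ?f (exponents A)) = (\<Sum>w\<in>perms n. type_char n Q w * real (fixed_words n A w))"
        by (rule sum_type_char_fixed_words[OF Q, symmetric])
      also have "\<dots> = (\<Sum>w\<in>perms n. \<Sum>\<mu>\<in>partitions_of n. real_of_int (z \<mu>) * real_of_int (schur_char n \<mu> w * int (fixed_words n A w)))"
        using expand by (intro sum.cong refl) (simp add: sum_distrib_right mult.assoc)
      also have "\<dots> = (\<Sum>\<mu>\<in>partitions_of n. real_of_int (z \<mu>) * real_of_int (\<Sum>w\<in>perms n. schur_char n \<mu> w * int (fixed_words n A w)))"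
        unfolding of_int_sum sum_distrib_left by (rule sum.swap)
      also have "\<dots> = (\<Sum>\<mu>\<in>partitions_of n. real_of_int (z \<mu>) * real_of_int (fact n * int (ssyt_count \<mu> A)))"
        using sum_schur_char_fixed_words[OF _ True] by (intro sum.cong refl) simp
      also have "\<dots> = fact n * real_of_int (\<Sum>\<mu>\<in>partitions_of n. z \<mu> * int (ssyt_count \<mu> A))"
        by (simp add: sum_distrib_left mult.left_commute)
      finally have "real_of_int (mcoeff ?f (exponents A)) = real_of_int (\<Sum>\<mu>\<in>partitions_of n. z \<mu> * int (ssyt_count \<mu> A))"
        by (simp only: mult_cancel_left fact_nonzero) simp
      then show ?thesis by (simp only: of_int_eq_iff)
    next
      case False
      \<comment> \<open>In degrees other than \<open>n\<close> there are neither tableaux nor words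
        of content \<open>A\<close>.\<close>
      have "ssyt_count \<mu> A = 0" if "\<mu> \<in> partitions_of n" for \<mu>
      proof -
        have "image_mset T (mset_set (cells \<mu>)) \<noteq> A" for T
          using False card_cells_partition[OF that] by auto
        then show ?thesis by (simp add: ssyt_count_def)
      qed
      moreover have "fact n * real_of_int (mcoeff ?f (exponents A)) = 0"
        unfolding sum_type_char_fixed_words[OF Q, symmetric] using fixed_words_eq_0[OF False] by simp
      then have "mcoeff ?f (exponents A) = 0" by simp
      ultimately show ?thesis by simp
    qed
    also have "\<dots> = (\<Sum>\<mu>\<in>partitions_of n. of_nat (nat (z \<mu>)) * mcoeff (schur \<mu>) (exponents A))"
      using zpos by (intro sum.cong refl) (simp add: mcoeff_schur)
    finally show "mcoeff ?f m = mcoeff (\<Sum>\<mu>\<in>partitions_of n. of_nat (nat (z \<mu>)) * schur \<mu>) m"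
      by (simp only: m mcoeff_sum mcoeff_of_nat_mult)
  qed
  then show ?thesis unfolding schur_positive_def
    by (intro exI[of _ "partitions_of n"] exI[of _ "\<lambda>\<mu>. nat (z \<mu>)"]) auto
qed

lemma sum_centralizer_cyc_char:
  assumes w: "w \<in> perms n"
  shows "(\<Sum>u\<in>perms n. if w \<in> centralizer n u then cyc_char n (bounded_prod S n) u w else 0)
    = (if set (cycle_type n w) \<subseteq> P_in S then of_nat (card (centralizer n w)) else 0)"
proof -
  have "(\<Sum>u\<in>perms n. if w \<in> centralizer n u then cyc_char n (bounded_prod S n) u w else 0)
      = (\<Sum>u\<in>centralizer n w. cyc_char n (bounded_prod S n) u w)"
  proof (rule sum.mono_neutral_cong_right)
    show "centralizer n w \<subseteq> perms n" using centralizerD(1) by blast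
    show "\<forall>u\<in>perms n - centralizer n w. (if w \<in> centralizer n u then cyc_char n (bounded_prod S n) u w else 0) = 0"
      using centralizer_sym by auto
    show "(if w \<in> centralizer n u then cyc_char n (bounded_prod S n) u w else 0) = cyc_char n (bounded_prod S n) u w"
      if "u \<in> centralizer n w" for u using centralizer_sym[OF w that] by simp
  qed simp
  then show ?thesis using sum_cyc_char[OF w] by simp
qed

lemma schur_positive_P_in:
  "schur_positive (\<Sum>\<mu> | \<mu> \<in> partitions_of n \<and> set \<mu> \<subseteq> P_in S. power_sum_part \<mu> :: int mseries)"
proof (rule schur_positive_if_pairings_nonneg)
  let ?Q = "{\<mu>. \<mu> \<in> partitions_of n \<and> set \<mu> \<subseteq> P_in S}" and ?M = "bounded_prod S n"
  show "?Q \<subseteq> partitions_of n" by blast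
  fix \<mu> assume \<mu>: "\<mu> \<in> partitions_of n"
  show "(\<Sum>w\<in>perms n. type_char n ?Q w * schur_char n \<mu> w) \<ge> 0"
  \<comment> \<open>Every \<open>u\<close> contributes its own character; the members of one
    conjugacy class together make up an induced character.\<close>
  proof (rule sum_linear_characters_pairing_nonneg[OF \<mu> class_function_type_char,
        where U = "perms n" and K = "centralizer n" and ch = "\<lambda>u w. if w \<in> centralizer n u then cyc_char n ?M u w else 0"])
    show "complex_of_real (type_char n ?Q w) = (\<Sum>u\<in>perms n. if w \<in> centralizer n u then cyc_char n ?M u w else 0)"
      if w: "w \<in> perms n" for w
      unfolding sum_centralizer_cyc_char[OF w] using cycle_type_partition[OF w] by (simp add: type_char_def)
    show "perm_subgroup n (centralizer n u)" if "u \<in> perms n" for u using that by (rule perm_subgroup_centralizer)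
    show "(if v \<circ> w \<in> centralizer n u then cyc_char n ?M u (v \<circ> w) else 0)
        = (if v \<in> centralizer n u then cyc_char n ?M u v else 0) * (if w \<in> centralizer n u then cyc_char n ?M u w else 0)"
      if "u \<in> perms n" "v \<in> centralizer n u" "w \<in> centralizer n u" for u v w
      using cyc_char_hom[OF that] perm_subgroupD(3)[OF perm_subgroup_centralizer[OF that(1)] that(2,3)] that by simp
  qed (simp_all add: cyc_char_unit)
qed

text \<open>Each character is taken once as it is and once twisted by \<open>sign\<close>, indexed
  by a Boolean. Together they give the factor \<open>1 + sign w\<close>, which is 2 on even
  permutations and 0 on odd ones; doubling \<open>type_char\<close> avoids halves.\<close>

lemma schur_positive_P_in_even:
  "schur_positive (\<Sum>\<mu> | \<mu> \<in> partitions_of n \<and> set \<mu> \<subseteq> P_in S \<and> even (n - length \<mu>). power_sum_part \<mu> :: int mseries)"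
proof (rule schur_positive_if_pairings_nonneg)
  let ?Q = "{\<mu>. \<mu> \<in> partitions_of n \<and> set \<mu> \<subseteq> P_in S \<and> even (n - length \<mu>)}" and ?M = "bounded_prod S n"
  let ?e = "\<lambda>b w. if b then complex_of_int (sign w) else 1"
  show "?Q \<subseteq> partitions_of n" by blast
  fix \<mu> assume \<mu>: "\<mu> \<in> partitions_of n"
  have "(\<Sum>w\<in>perms n. (2 * type_char n ?Q w) * schur_char n \<mu> w) \<ge> 0"
  proof (rule sum_linear_characters_pairing_nonneg[OF \<mu>,
        where U = "perms n \<times> UNIV" and K = "\<lambda>(u, b). centralizer n u"
          and ch = "\<lambda>(u, b) w. if w \<in> centralizer n u then ?e b w * cyc_char n ?M u w else 0"])
    show "class_function n (\<lambda>w. 2 * type_char n ?Q w)"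
      using class_function_type_char[of n ?Q] unfolding class_function_def by simp
    show "complex_of_real (2 * type_char n ?Q w)
        = (\<Sum>p\<in>perms n \<times> UNIV. (case p of (u, b) \<Rightarrow> \<lambda>w. if w \<in> centralizer n u then ?e b w * cyc_char n ?M u w else 0) w)"
      if w: "w \<in> perms n" for w
    proof -
      let ?s = "\<Sum>u\<in>perms n. if w \<in> centralizer n u then cyc_char n ?M u w else 0"
      have "(\<Sum>p\<in>perms n \<times> UNIV. (case p of (u, b) \<Rightarrow> \<lambda>w. if w \<in> centralizer n u then ?e b w * cyc_char n ?M u w else 0) w)
          = (\<Sum>u\<in>perms n. \<Sum>b\<in>UNIV. if w \<in> centralizer n u then ?e b w * cyc_char n ?M u w else 0)"
        by (simp only: sum.cartesian_product) (simp add: split_def)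
      also have "\<dots> = (\<Sum>u\<in>perms n. (1 + complex_of_int (sign w)) * (if w \<in> centralizer n u then cyc_char n ?M u w else 0))"
        by (intro sum.cong refl) (simp add: UNIV_bool algebra_simps)
      also have "\<dots> = (1 + complex_of_int (sign w)) * ?s" by (simp only: sum_distrib_left)
      also have "\<dots> = (1 + complex_of_int (sign w)) * (if set (cycle_type n w) \<subseteq> P_in S then of_nat (card (centralizer n w)) else 0)"
        unfolding sum_centralizer_cyc_char[OF w] ..
      also have "\<dots> = complex_of_real (2 * type_char n ?Q w)"
      proof -
        obtain e where "type_enum n w (cycle_type n w) e" using cycle_type_enum[OF w] .
        then have "sign w = (-1) ^ (n - length (cycle_type n w))" by (rule sign_cycle_type[OF w])
        then show ?thesis using cycle_type_partition[OF w] by (simp add: type_char_def)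
      qed
      finally show ?thesis ..
    qed
    show "perm_subgroup n (case p of (u, b) \<Rightarrow> centralizer n u)" if "p \<in> perms n \<times> UNIV" for p :: "(nat \<Rightarrow> nat) \<times> bool"
      by (cases p) (use that in \<open>simp add: perm_subgroup_centralizer\<close>)
    show "(case p of (u, b) \<Rightarrow> \<lambda>w. if w \<in> centralizer n u then ?e b w * cyc_char n ?M u w else 0) w = 0"
      if "w \<notin> (case p of (u, b) \<Rightarrow> centralizer n u)" for p w
      using that by (cases p) simp
    show "(case p of (u, b) \<Rightarrow> \<lambda>w. if w \<in> centralizer n u then ?e b w * cyc_char n ?M u w else 0) (v \<circ> w)
        = (case p of (u, b) \<Rightarrow> \<lambda>w. if w \<in> centralizer n u then ?e b w * cyc_char n ?M u w else 0) v
          * (case p of (u, b) \<Rightarrow> \<lambda>w. if w \<in> centralizer n u then ?e b w * cyc_char n ?M u w else 0) w"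
      if p: "p \<in> perms n \<times> UNIV" and v: "v \<in> (case p of (u, b) \<Rightarrow> centralizer n u)" and w: "w \<in> (case p of (u, b) \<Rightarrow> centralizer n u)" for p v w
    proof -
      obtain u b where pu: "p = (u, b)" by force
      have u: "u \<in> perms n" and v': "v \<in> centralizer n u" and w': "w \<in> centralizer n u" using p v w pu by auto
      have vw: "v \<circ> w \<in> centralizer n u" by (rule perm_subgroupD(3)[OF perm_subgroup_centralizer[OF u] v' w'])
      have s: "sign (v \<circ> w) = sign v * sign w"
        by (rule sign_compose[OF permutation_perms[OF centralizerD(1)[OF v']] permutation_perms[OF centralizerD(1)[OF w']]])
      show ?thesis
        unfolding pu prod.case if_P[OF vw] if_P[OF v'] if_P[OF w'] s cyc_char_hom[OF u v' w'] by simp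
    qed
    show "(case p of (u, b) \<Rightarrow> \<lambda>w. if w \<in> centralizer n u then ?e b w * cyc_char n ?M u w else 0) w
        * cnj ((case p of (u, b) \<Rightarrow> \<lambda>w. if w \<in> centralizer n u then ?e b w * cyc_char n ?M u w else 0) w) = 1"
      if "w \<in> (case p of (u, b) \<Rightarrow> centralizer n u)" for p w
    proof -
      obtain u b where pu: "p = (u, b)" by force
      have w': "w \<in> centralizer n u" using that pu by simp
      have "?e b w * cnj (?e b w) = 1" by (cases w rule: sign_cases) simp_all
      moreover have "(?e b w * cyc_char n ?M u w) * cnj (?e b w * cyc_char n ?M u w)
          = (?e b w * cnj (?e b w)) * (cyc_char n ?M u w * cnj (cyc_char n ?M u w))"
        by (simp only: complex_cnj_mult ac_simps)
      ultimately have "(?e b w * cyc_char n ?M u w) * cnj (?e b w * cyc_char n ?M u w) = 1"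
        by (simp only: cyc_char_unit mult_1)
      then show ?thesis unfolding pu prod.case if_P[OF w'] .
    qed
  qed
  then show "(\<Sum>w\<in>perms n. type_char n ?Q w * schur_char n \<mu> w) \<ge> 0"
    by (simp add: mult.assoc flip: sum_distrib_left)
qed

text \<open>A part \<open>k\<close> contributes \<open>k + 1\<close> to the left-hand side, which is
  odd exactly when \<open>k\<close> is even.\<close>

lemma even_parts_parity: "even (sum_list \<mu> + length \<mu>) \<longleftrightarrow> even (length (filter even \<mu>))" for \<mu> :: "nat list"
  by (induction \<mu>) auto

theorem theorem3p6:
  fixes S :: "nat set" and n :: nat
  assumes "\<forall>p\<in>S. prime p" and "n \<ge> 1"
  shows "schur_positive
           (\<Sum>\<mu> | \<mu> \<in> partitions_of n \<and> set \<mu> \<subseteq> P_in S. power_sum_part \<mu> :: int mseries)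
       \<and> schur_positive
           (\<Sum>\<mu> | \<mu> \<in> partitions_of n \<and> set \<mu> \<subseteq> P_avoid S. power_sum_part \<mu> :: int mseries)
       \<and> schur_positive
           (\<Sum>\<mu> | \<mu> \<in> partitions_of n \<and> set \<mu> \<subseteq> P_in S \<and> even (n - length \<mu>).
              power_sum_part \<mu> :: int mseries)
       \<and> (\<Sum>\<mu> | \<mu> \<in> partitions_of n \<and> set \<mu> \<subseteq> P_in S \<and> even (n - length \<mu>).
              power_sum_part \<mu> :: int mseries)
         = (\<Sum>\<mu> | \<mu> \<in> partitions_of n \<and> set \<mu> \<subseteq> P_in S \<and> even (length (filter even \<mu>)).
              power_sum_part \<mu>)"
proof (intro conjI)
  \<comment> \<open>\<open>P_in\<close> tests membership on prime divisors only, so the complement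
    in all naturals serves as the complementary set of primes.\<close>
  have "P_avoid S = P_in (- S)" by (auto simp: P_avoid_def P_in_def)
  then show "schur_positive (\<Sum>\<mu> | \<mu> \<in> partitions_of n \<and> set \<mu> \<subseteq> P_avoid S. power_sum_part \<mu> :: int mseries)"
    using schur_positive_P_in[of n "- S"] by simp
  \<comment> \<open>As \<open>length \<mu> \<le> n\<close>, the subtraction is exact and has the
    parity of \<open>sum_list \<mu> + length \<mu>\<close>.\<close>
  have "even (n - length \<mu>) \<longleftrightarrow> even (length (filter even \<mu>))" if "\<mu> \<in> partitions_of n" for \<mu>
    using even_parts_parity[of \<mu>] partitions_ofD(1,2)[OF that] by (simp add: even_diff_nat)
  then show "(\<Sum>\<mu> | \<mu> \<in> partitions_of n \<and> set \<mu> \<subseteq> P_in S \<and> even (n - length \<mu>). power_sum_part \<mu> :: int mseries)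
      = (\<Sum>\<mu> | \<mu> \<in> partitions_of n \<and> set \<mu> \<subseteq> P_in S \<and> even (length (filter even \<mu>)). power_sum_part \<mu>)"
    by (intro sum.cong) auto
qed (rule schur_positive_P_in schur_positive_P_in_even)+

end
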